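(* Let $d\ge 1$ and let $H_{L}=H_{\lambda,L,\omega}=-\Delta_L+\lambda V_{L,\omega}$ on $L^2(\Lambda_L)$ be as described in the context, with a fixed coupling constant $\lambda\ge 0$. For any $\varphi\in L^2(\mathbb{R}^d)$ and any $f\in C_\infty(\mathbb{R}):=\{f:\mathbb{R}\to\mathbb{C} \text{ continuous and vanishing at infinity}\}$, the limit $$\lim_{L\to\infty}\langle \varphi, f(H_L)\varphi\rangle_L$$ exists for almost all $\omega$.
   Context: For $L>0$ let $\Lambda_L=[-L/2,L/2)^d\subset\mathbb{R}^d$ and $\langle f,g\rangle_L=\int_{\Lambda_L}\overline{f(x)}g(x)\,dx$; for $\varphi\in L^2(\mathbb{R}^d)$, $\langle\varphi,f(H_L)\varphi\rangle_L$ means the inner product in $L^2(\Lambda_L)$ with $\varphi$ replaced by its restriction $\varphi|_{\Lambda_L}$. $-\Delta_L$ is the Laplacian on $L^2(\Lambda_L)$ with periodic boundary conditions: with $\Lambda_L^*=(\frac1L\mathbb{Z})^d$ and Fourier coefficients $\hat f(p)=\int_{\Lambda_L}e^{-2\pi i p\cdot x}f(x)\,dx$, its domain is $\{f\in L^2(\Lambda_L):\nu\hat f\in\ell^2(\Lambda_L^* )\}$ and $(-\Delta_L f)^\wedge(p)=\nu(p)\hat f(p)$, $\nu(p)=(2\pi p)^2=|2\pi p|^2$. For $h:\mathbb{R}^d\to\mathbb{C}$, $h_{\#,L}$ denotes the $L$-periodic extension of $h|_{\Lambda_L}$ to $\mathbb{R}^d$ (i.e. $h_{\#,L}(y)=h(x)$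 where $x\in\Lambda_L$ is the unique point with $x-y\in(L\mathbb{Z})^d$). The random potential is $V_{L,\omega}(x)=\int_{\Lambda_L}B_{\#,L}(x-y)\,d\mu_\omega(y)=\sum_{\gamma: y_\gamma(\omega)\in\Lambda_L}v_\gamma(\omega)B_{\#,L}(x-y_\gamma(\omega))$, where $\mu_\omega=\sum_{\gamma\ge1}v_\gamma(\omega)\delta_{y_\gamma(\omega)}$, $\{y_\gamma\}$ is a Poisson point process on $\mathbb{R}^d$ with homogeneous unit density, and the weights $v_\gamma$ are i.i.d. real random variables, independent of the point process, with moments $m_k=\mathbf{E}v_\gamma^k<\infty$ for $k=1,\dots,d+1$. The single-site profile $B:\mathbb{R}^d\to\mathbb{R}$ satisfies $|B(x)|\le C_B\langle x\rangle^{-d-1-\epsilon}$ for some constants $C_B$ and $\epsilon>0$, where $\langle x\rangle=\sqrt{1+|x|^2}$. (Almost surely $V_{L,\omega}$ is bounded, so $H_L$ is self-adjoint.) *)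

theory Defs
  imports "HOL-Analysis.Analysis" "HOL-Probability.Probability"
begin

definition box_L :: "real \<Rightarrow> (real^'n) set" where
  "box_L L = {x. \<forall>i. - L / 2 \<le> x $ i \<and> x $ i < L / 2}"

definition ip_L :: "real \<Rightarrow> (real^'n \<Rightarrow> complex) \<Rightarrow> (real^'n \<Rightarrow> complex) \<Rightarrow> complex" where
  "ip_L L f g = set_lebesgue_integral lebesgue (box_L L) (\<lambda>x. cnj (f x) * g x)"

definition L2_L :: "real \<Rightarrow> (real^'n \<Rightarrow> complex) \<Rightarrow> bool" where
  "L2_L L f \<longleftrightarrow> (\<lambda>x. indicator (box_L L) x *\<^sub>R f x) \<in> borel_measurable lebesgue
     \<and> set_integrable lebesgue (box_L L) (\<lambda>x. (cmod (f x))\<^sup>2)"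

definition dual_pt :: "real \<Rightarrow> int^'n \<Rightarrow> real^'n" where
  "dual_pt L k = (\<chi> i. of_int (k $ i) / L)"

definition fcoef :: "real \<Rightarrow> (real^'n \<Rightarrow> complex) \<Rightarrow> int^'n \<Rightarrow> complex" where
  "fcoef L f k = set_lebesgue_integral lebesgue (box_L L)
      (\<lambda>x. exp (- (2 * complex_of_real pi * \<i> * complex_of_real (dual_pt L k \<bullet> x))) * f x)"

definition nu :: "real^'n \<Rightarrow> real" where
  "nu p = (norm (2 * pi *\<^sub>R p))\<^sup>2"

definition lap_dom :: "real \<Rightarrow> (real^'n \<Rightarrow> complex) \<Rightarrow> bool" where
  "lap_dom L f \<longleftrightarrow> L2_L L f \<and>
     (\<lambda>k. (cmod (complex_of_real (nu (dual_pt L k)) * fcoef L f k))\<^sup>2) summable_on UNIV"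

text \<open>psi is an eigenfunction of H = -Delta_L + W (W a bounded real potential,
  W = lambda V_{L,omega}) with eigenvalue E, i.e. psi in dom(-Delta_L) and
  H psi = E psi in L^2(Lambda_L), written on the Fourier side.\<close>
definition is_eig :: "real \<Rightarrow> (real^'n \<Rightarrow> real) \<Rightarrow> (real^'n \<Rightarrow> complex) \<Rightarrow> real \<Rightarrow> bool" where
  "is_eig L W psi E \<longleftrightarrow> lap_dom L psi \<and>
     (\<forall>k. complex_of_real (nu (dual_pt L k)) * fcoef L psi k
           + fcoef L (\<lambda>x. complex_of_real (W x) * psi x) k = complex_of_real E * fcoef L psi k)"

definition eig_onb :: "real \<Rightarrow> (real^'n \<Rightarrow> real) \<Rightarrow> (nat \<Rightarrow> real) \<Rightarrow> (nat \<Rightarrow> real^'n \<Rightarrow> complex) \<Rightarrow> bool" where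
  "eig_onb L W E psi \<longleftrightarrow>
     (\<forall>n. is_eig L W (psi n) (E n)) \<and>
     (\<forall>n m. ip_L L (psi n) (psi m) = (if n = m then 1 else 0)) \<and>
     (\<forall>g. L2_L L g \<and> (\<forall>n. ip_L L (psi n) g = 0) \<longrightarrow>
          (AE x in lebesgue. x \<in> box_L L \<longrightarrow> g x = 0))"

text \<open>Functional calculus: <phi, f(H) phi>_L = sum_n f(E_n) |<psi_n, phi>_L|^2 for any
  orthonormal eigenbasis (H has compact resolvent, so such a basis exists and the
  value does not depend on the choice).\<close>
definition fc_quad :: "real \<Rightarrow> (real^'n \<Rightarrow> real) \<Rightarrow> (real \<Rightarrow> complex) \<Rightarrow> (real^'n \<Rightarrow> complex) \<Rightarrow> complex" where
  "fc_quad L W f phi =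
     (let EP = (SOME EP. eig_onb L W (fst EP) (snd EP))
      in (\<Sum>n. f (fst EP n) * complex_of_real ((cmod (ip_L L (snd EP n) phi))\<^sup>2)))"

definition per_ext :: "real \<Rightarrow> (real^'n \<Rightarrow> 'b) \<Rightarrow> real^'n \<Rightarrow> 'b" where
  "per_ext L h y = h (THE x. x \<in> box_L L \<and> (\<forall>i. (x $ i - y $ i) / L \<in> \<int>))"

definition pot :: "real \<Rightarrow> (nat \<Rightarrow> 'w \<Rightarrow> real^'n) \<Rightarrow> (nat \<Rightarrow> 'w \<Rightarrow> real)
                   \<Rightarrow> (real^'n \<Rightarrow> real) \<Rightarrow> 'w \<Rightarrow> real^'n \<Rightarrow> real" where
  "pot L y v B \<omega> x = (\<Sum>\<gamma> | y \<gamma> \<omega> \<in> box_L L. v \<gamma> \<omega> * per_ext L B (x - y \<gamma> \<omega>))"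

definition poisson_pp :: "'w measure \<Rightarrow> (nat \<Rightarrow> 'w \<Rightarrow> real^'n) \<Rightarrow> bool" where
  "poisson_pp M y \<longleftrightarrow>
     (\<forall>A n. A \<in> sets borel \<and> bounded A \<longrightarrow>
        measure M {\<omega> \<in> space M. finite {\<gamma>. y \<gamma> \<omega> \<in> A} \<and> card {\<gamma>. y \<gamma> \<omega> \<in> A} = n}
          = exp (- measure lborel A) * (measure lborel A) ^ n / fact n) \<and>
     (\<forall>(A :: nat \<Rightarrow> (real^'n) set) k.
        (\<forall>j<k. A j \<in> sets borel \<and> bounded (A j)) \<and> disjoint_family_on A {..<k} \<longrightarrow>
        prob_space.indep_vars M (\<lambda>_. count_space UNIV)
           (\<lambda>j \<omega>. card {\<gamma>. y \<gamma> \<omega> \<in> A j}) {..<k})"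

end

theory Submission
  imports Defs "HOL-Complex_Analysis.Great_Picard" "HOL-Real_Asymp.Real_Asymp"
begin

text \<open>
  The operators \<open>H L\<close> converge in the strong resolvent sense because they share approximate solutions
  of the resolvent equation: given \<open>\<phi>\<close> and a non-real \<open>z\<close>, some torus of size \<open>L0\<close> carries a
  trigonometric polynomial \<open>t\<close> with \<open>(H L0 - z) t\<close> close to \<open>\<phi>\<close>, and for a cutoff \<open>\<chi>\<close> on the scale
  \<open>L0\<close> the function \<open>u = \<chi> t\<close> satisfies \<open>(H L - z) u \<approx> \<phi>\<close> uniformly in \<open>L \<ge> L0\<close>. The commutator
  terms are of order \<open>|\<nabla>t| / L0 = O(L0\<^sup>-\<^sup>1\<^sup>/\<^sup>2)\<close>, since almost surely the potential grows at most
  linearly; this is where the moment of order \<open>d + 1\<close> enters. The bound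
  \<open>|(H L - z)\<^sup>-\<^sup>1| \<le> 1 / |Im z|\<close> then gives \<open>(H L - z)\<^sup>-\<^sup>1 \<phi> \<approx> u\<close>. Functions with this property form an
  algebra closed under uniform limits, so by the Stone-Weierstrass theorem on the Cayley transform of
  the line it contains \<open>C\<^sub>\<infinity>\<close>. The orthonormal eigenbasis of \<open>H L\<close> is obtained by minimizing the energy
  on successive orthogonal complements.
\<close>

section \<open>Square-integrable functions\<close>

text \<open>The operators act on different spaces, and no limiting operator is constructed: with a
  potential unbounded on the whole space, its self-adjointness would be a separate problem. What the
  finite-volume operators share is a function \<open>u\<close> supported in a ball of radius
  \<open>L0 / 8\<close>, which every larger torus sees in the same way; the limit of the quadratic
  form is read off from the inner products of \<open>\<phi>\<close> with \<open>u\<close> over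
  growing boxes. Randomness enters once, through the event that the total weight in the unit cube at
  the lattice point \<open>n\<close> is at most \<open>K * (1 + |n|)\<close>. On this event
  everything is deterministic, so \<open>L\<close> can run over all reals without collecting
  exceptional sets, and the event depends neither on \<open>f\<close> nor on \<open>\<phi>\<close>.
  The linear growth leaves room: a gradient of order \<open>sqrt b\<close> against a cutoff gradient
  of order \<open>1 / L0\<close> tolerates any bound \<open>b\<close> for which
  \<open>b / L0\<^sup>2\<close> tends to zero. Since \<open>fc_quad\<close> selects its eigenbasis
  by \<open>SOME\<close>, its value is meaningful only once an eigenbasis is known to exist; this
  forces the spectral theory on the boxes.\<close>

definition l2 :: "'a measure \<Rightarrow> ('a \<Rightarrow> complex) set" where
  "l2 M = {f \<in> borel_measurable M. integrable M (\<lambda>x. (cmod (f x))\<^sup>2)}"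

definition ip :: "'a measure \<Rightarrow> ('a \<Rightarrow> complex) \<Rightarrow> ('a \<Rightarrow> complex) \<Rightarrow> complex" where
  "ip M f g = (LINT x|M. cnj (f x) * g x)"

text \<open>A seminorm on functions rather than a norm on classes: \<open>nrm M f = 0\<close> only
  says that \<open>f\<close> vanishes almost everywhere, and limits below are determined up to null
  sets.\<close>

definition nrm :: "'a measure \<Rightarrow> ('a \<Rightarrow> complex) \<Rightarrow> real" where
  "nrm M f = sqrt (LINT x|M. (cmod (f x))\<^sup>2)"

lemma borel_measurable_cnj [measurable]:
  "f \<in> borel_measurable M \<Longrightarrow> (\<lambda>x. cnj (f x)) \<in> borel_measurable M"
  by (rule borel_measurable_continuous_on[where f = cnj, OF continuous_on_cnj[OF continuous_on_id]])

lemma l2_measurable [measurable_dest]: "f \<in> l2 M \<Longrightarrow> f \<in> borel_measurable M"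
  by (simp add: l2_def)

lemma l2_square_integrable: "f \<in> l2 M \<Longrightarrow> integrable M (\<lambda>x. (cmod (f x))\<^sup>2)"
  by (simp add: l2_def)

lemma l2_bound:
  assumes "f \<in> borel_measurable M" "integrable M h" "\<And>x. x \<in> space M \<Longrightarrow> (cmod (f x))\<^sup>2 \<le> h x"
  shows "f \<in> l2 M"
proof -
  have "integrable M (\<lambda>x. (cmod (f x))\<^sup>2)"
    by (rule Bochner_Integration.integrable_bound[OF assms(2)])
       (use assms(1,3) in \<open>auto intro!: AE_I2 order_trans[OF _ abs_ge_self]\<close>)
  then show ?thesis using assms(1) by (simp add: l2_def)
qed

lemma sum_sq_le: "(cmod (a + b))\<^sup>2 \<le> 2 * (cmod a)\<^sup>2 + 2 * (cmod b)\<^sup>2"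
proof -
  have "(cmod (a + b))\<^sup>2 \<le> (cmod a + cmod b)\<^sup>2"
    by (intro power_mono norm_triangle_ineq) auto
  also have "\<dots> \<le> 2 * (cmod a)\<^sup>2 + 2 * (cmod b)\<^sup>2"
    using zero_le_power2[of "cmod a - cmod b"] by (simp add: power2_eq_square algebra_simps)
  finally show ?thesis .
qed

lemma l2_add [simp]:
  assumes [measurable]: "f \<in> l2 M" "g \<in> l2 M" shows "(\<lambda>x. f x + g x) \<in> l2 M"
  by (rule l2_bound[where h = "\<lambda>x. 2 * (cmod (f x))\<^sup>2 + 2 * (cmod (g x))\<^sup>2"])
     (use assms in \<open>auto intro!: sum_sq_le l2_square_integrable\<close>)

lemma l2_cmult [simp]: 
  assumes [measurable]: "f \<in> l2 M" shows "(\<lambda>x. c * f x) \<in> l2 M"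
  by (rule l2_bound[where h = "\<lambda>x. (cmod c)\<^sup>2 * (cmod (f x))\<^sup>2"])
     (use assms in \<open>auto intro!: l2_square_integrable simp: norm_mult power_mult_distrib\<close>)

lemma l2_uminus [simp]: "f \<in> l2 M \<Longrightarrow> (\<lambda>x. - f x) \<in> l2 M"
  using l2_cmult[of f M "-1"] by simp

lemma l2_diff [simp]: "f \<in> l2 M \<Longrightarrow> g \<in> l2 M \<Longrightarrow> (\<lambda>x. f x - g x) \<in> l2 M"
  using l2_add[of f M "\<lambda>x. - g x"] by simp

lemma l2_zero [simp]: "(\<lambda>x. 0) \<in> l2 M"
  by (simp add: l2_def)

lemma l2_sum [simp]: "(\<And>i. i \<in> I \<Longrightarrow> f i \<in> l2 M) \<Longrightarrow> (\<lambda>x. \<Sum>i\<in>I. f i x) \<in> l2 M"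
  by (induction I rule: infinite_finite_induct) auto

lemma l2_mult_bounded:
  assumes [measurable]: "f \<in> l2 M" "w \<in> borel_measurable M" and b: "\<And>x. x \<in> space M \<Longrightarrow> cmod (w x) \<le> b"
  shows "(\<lambda>x. w x * f x) \<in> l2 M"
  by (rule l2_bound[where h = "\<lambda>x. b\<^sup>2 * (cmod (f x))\<^sup>2"])
     (use assms in \<open>auto intro!: l2_square_integrable power_mono mult_right_mono simp: norm_mult
         power_mult_distrib\<close>)

lemma ip_integrable [simp]:
  assumes [measurable]: "f \<in> l2 M" "g \<in> l2 M" shows "integrable M (\<lambda>x. cnj (f x) * g x)"
proof (rule Bochner_Integration.integrable_bound[where f = "\<lambda>x. (cmod (f x))\<^sup>2 + (cmod (g x))\<^sup>2"])
  have "cmod (f x) * cmod (g x) \<le> (cmod (f x))\<^sup>2 + (cmod (g x))\<^sup>2" for x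
    using zero_le_power2[of "cmod (f x) - cmod (g x)"] mult_nonneg_nonneg[of "cmod (f x)" "cmod (g x)"]
    unfolding power2_eq_square by (simp add: algebra_simps) (smt (verit) zero_le_mult_iff norm_ge_zero)
  then show "AE x in M. norm (cnj (f x) * g x) \<le> norm ((cmod (f x))\<^sup>2 + (cmod (g x))\<^sup>2)"
    by (auto simp: norm_mult)
qed (use assms in \<open>auto intro!: l2_square_integrable\<close>)

lemma ip_integrable' [simp]: "f \<in> l2 M \<Longrightarrow> g \<in> l2 M \<Longrightarrow> integrable M (\<lambda>x. g x * cnj (f x))"
  using ip_integrable[of f M g] by (simp add: mult.commute)

lemma ip_add_right: "f \<in> l2 M \<Longrightarrow> g \<in> l2 M \<Longrightarrow> h \<in> l2 M \<Longrightarrow> ip M f (\<lambda>x. g x + h x) = ip M f g + ip M f h"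
  by (simp add: ip_def ring_distribs)

lemma ip_diff_right: "f \<in> l2 M \<Longrightarrow> g \<in> l2 M \<Longrightarrow> h \<in> l2 M \<Longrightarrow> ip M f (\<lambda>x. g x - h x) = ip M f g - ip M f h"
  by (simp add: ip_def ring_distribs)

lemma ip_add_left: "f \<in> l2 M \<Longrightarrow> g \<in> l2 M \<Longrightarrow> h \<in> l2 M \<Longrightarrow> ip M (\<lambda>x. g x + h x) f = ip M g f + ip M h f"
  by (simp add: ip_def ring_distribs)

lemma ip_diff_left: "f \<in> l2 M \<Longrightarrow> g \<in> l2 M \<Longrightarrow> h \<in> l2 M \<Longrightarrow> ip M (\<lambda>x. g x - h x) f = ip M g f - ip M h f"
  by (simp add: ip_def ring_distribs)

lemma ip_cmult_right: "ip M f (\<lambda>x. c * g x) = c * ip M f g"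
  unfolding ip_def by (subst integral_mult_right_zero[symmetric]) (simp add: ac_simps)

lemma ip_cmult_left: "ip M (\<lambda>x. c * g x) f = cnj c * ip M g f"
  unfolding ip_def by (subst integral_mult_right_zero[symmetric]) (simp add: ac_simps)

lemma ip_sum_right: "f \<in> l2 M \<Longrightarrow> (\<And>i. i \<in> I \<Longrightarrow> g i \<in> l2 M)
    \<Longrightarrow> ip M f (\<lambda>x. \<Sum>i\<in>I. g i x) = (\<Sum>i\<in>I. ip M f (g i))"
  by (induction I rule: infinite_finite_induct) (auto simp: ip_add_right, auto simp: ip_def)

lemma ip_cnj: "cnj (ip M f g) = ip M g f"
  unfolding ip_def Bochner_Integration.integral_cnj[symmetric]
      by (rule Bochner_Integration.integral_cong) simp_all

lemma ip_sum_left: "f \<in> l2 M \<Longrightarrow> (\<And>i. i \<in> I \<Longrightarrow> g i \<in> l2 M)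
    \<Longrightarrow> ip M (\<lambda>x. \<Sum>i\<in>I. g i x) f = (\<Sum>i\<in>I. ip M (g i) f)"
  by (subst ip_cnj[symmetric], subst ip_sum_right) (auto simp: ip_cnj)

lemmas ip_simps = ip_add_right ip_add_left ip_diff_right ip_diff_left ip_cmult_right ip_cmult_left
  ip_sum_right ip_sum_left

lemma ip_zero [simp]: "ip M f (\<lambda>x. 0) = 0" "ip M (\<lambda>x. 0) f = 0"
  by (simp_all add: ip_def)

lemma nrm_nonneg [simp]: "0 \<le> nrm M f"
  by (simp add: nrm_def)

lemma nrm_sq: "(nrm M f)\<^sup>2 = (LINT x|M. (cmod (f x))\<^sup>2)"
  by (simp add: nrm_def)

lemma ip_self: "ip M f f = of_real ((nrm M f)\<^sup>2)"
proof -
  have "ip M f f = (LINT x|M. of_real ((cmod (f x))\<^sup>2))"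
    unfolding ip_def by (intro Bochner_Integration.integral_cong refl) (simp add:
        complex_norm_square mult.commute del: of_real_power)
  also have "\<dots> = of_real (LINT x|M. (cmod (f x))\<^sup>2)"
    by (rule integral_complex_of_real)
  finally show ?thesis by (simp add: nrm_sq)
qed

lemma ip_cong_AE: 
  assumes "AE x in M. f x = f' x" "AE x in M. g x = g' x"
    and [measurable]: "f \<in> borel_measurable M" "f' \<in> borel_measurable M"
    "g \<in> borel_measurable M" "g' \<in> borel_measurable M"
  shows "ip M f g = ip M f' g'"
  unfolding ip_def by (rule integral_cong_AE) (use assms in auto)

lemma nrm_eq_0_iff: "f \<in> l2 M \<Longrightarrow> nrm M f = 0 \<longleftrightarrow> (AE x in M. f x = 0)"
  by (simp add: nrm_def integral_nonneg_eq_0_iff_AE l2_square_integrable)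

lemma nrm_cmult: "nrm M (\<lambda>x. c * f x) = cmod c * nrm M f"
  by (simp add: nrm_def norm_mult power_mult_distrib real_sqrt_mult)

lemma nrm_uminus [simp]: "nrm M (\<lambda>x. - f x) = nrm M f"
  by (simp add: nrm_def)

lemma nrm_minus_commute: "nrm M (\<lambda>x. f x - g x) = nrm M (\<lambda>x. g x - f x)"
  by (simp add: nrm_def norm_minus_commute)

lemma nrm_zero [simp]: "nrm M (\<lambda>x. 0) = 0"
  by (simp add: nrm_def)

lemma nrm_sq_diff:
  assumes "f \<in> l2 M" "g \<in> l2 M"
  shows "(nrm M (\<lambda>x. f x - g x))\<^sup>2 = (nrm M f)\<^sup>2 + (nrm M g)\<^sup>2 - 2 * Re (ip M g f)"
proof -
  have "complex_of_real ((nrm M (\<lambda>x. f x - g x))\<^sup>2) = ip M f f + ip M g g - (ip M g f + cnj (ip M g f))"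
    unfolding ip_self[symmetric] ip_cnj using assms by (simp add: ip_simps)
  also have "\<dots> = of_real ((nrm M f)\<^sup>2 + (nrm M g)\<^sup>2 - 2 * Re (ip M g f))"
    unfolding ip_self by (simp add: complex_add_cnj)
  finally show ?thesis unfolding of_real_eq_iff .
qed

lemma cauchy_schwarz:
  assumes "f \<in> l2 M" "g \<in> l2 M" shows "cmod (ip M f g) \<le> nrm M f * nrm M g"
proof (cases "nrm M f = 0")
  case True
  then have "AE x in M. f x = 0" using assms(1) by (simp add: nrm_eq_0_iff)
  then have "ip M f g = ip M (\<lambda>x. 0) g" by (intro ip_cong_AE) (use assms in \<open>auto dest: l2_measurable\<close>)
  then show ?thesis by simp
next
  case False
  define c where "c = ip M f g / of_real ((nrm M f)\<^sup>2)"
  have pos: "(nrm M f)\<^sup>2 > 0" using False by simp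
  have "0 \<le> (nrm M (\<lambda>x. g x - c * f x))\<^sup>2" by simp
  also have "\<dots> = (nrm M g)\<^sup>2 + (cmod c * nrm M f)\<^sup>2 - 2 * Re (cnj c * ip M f g)"
    using assms by (subst nrm_sq_diff) (auto simp: nrm_cmult ip_simps)
  also have "cnj c * ip M f g = of_real ((cmod (ip M f g))\<^sup>2 / (nrm M f)\<^sup>2)"
    unfolding of_real_divide complex_norm_square by (simp add: c_def)
  also have "(cmod c * nrm M f)\<^sup>2 = (cmod (ip M f g))\<^sup>2 / (nrm M f)\<^sup>2"
    using False by (simp add: c_def norm_divide norm_power power_divide) (simp add: power2_eq_square
        field_simps power4_eq_xxxx)
  finally have "(cmod (ip M f g))\<^sup>2 \<le> (nrm M f * nrm M g)\<^sup>2"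
    using pos by (simp add: field_simps power_mult_distrib)
  then show ?thesis by (rule power2_le_imp_le) simp
qed

lemma nrm_triangle:
  assumes "f \<in> l2 M" "g \<in> l2 M" shows "nrm M (\<lambda>x. f x + g x) \<le> nrm M f + nrm M g"
proof (rule power2_le_imp_le)
  have "(nrm M (\<lambda>x. f x + g x))\<^sup>2 = (nrm M f)\<^sup>2 + (nrm M g)\<^sup>2 - 2 * Re (ip M (\<lambda>x. (-1) * g x) f)"
    using nrm_sq_diff[of f M "\<lambda>x. (-1) * g x"] assms by simp
  also have "\<dots> = (nrm M f)\<^sup>2 + (nrm M g)\<^sup>2 + 2 * Re (ip M g f)"
    unfolding ip_cmult_left by simp
  also have "\<dots> \<le> (nrm M f)\<^sup>2 + (nrm M g)\<^sup>2 + 2 * (nrm M g * nrm M f)"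
    using cauchy_schwarz[OF assms(2,1)] complex_Re_le_cmod[of "ip M g f"] by linarith
  also have "\<dots> = (nrm M f + nrm M g)\<^sup>2" by (simp add: power2_eq_square algebra_simps)
  finally show "(nrm M (\<lambda>x. f x + g x))\<^sup>2 \<le> (nrm M f + nrm M g)\<^sup>2" .
qed simp

lemma nrm_triangle_diff:
  "f \<in> l2 M \<Longrightarrow> g \<in> l2 M \<Longrightarrow> nrm M (\<lambda>x. f x - g x) \<le> nrm M f + nrm M g"
  using nrm_triangle[of f M "\<lambda>x. - g x"] by simp

lemma nrm_triangle_mid:
  assumes "f \<in> l2 M" "g \<in> l2 M" "h \<in> l2 M"
  shows "nrm M (\<lambda>x. f x - h x) \<le> nrm M (\<lambda>x. f x - g x) + nrm M (\<lambda>x. g x - h x)"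
  using nrm_triangle[of "\<lambda>x. f x - g x" M "\<lambda>x. g x - h x"] assms by simp

lemma nrm_sum_le:
  "(\<And>i. i \<in> I \<Longrightarrow> f i \<in> l2 M) \<Longrightarrow> nrm M (\<lambda>x. \<Sum>i\<in>I. f i x) \<le> (\<Sum>i\<in>I. nrm M (f i))"
proof (induction I rule: infinite_finite_induct)
  case (insert i I)
  then show ?case using nrm_triangle[of "f i" M "\<lambda>x. \<Sum>i\<in>I. f i x"] by auto
qed auto

lemma nrm_mono:
  assumes "f \<in> borel_measurable M" "g \<in> l2 M" "\<And>x. x \<in> space M \<Longrightarrow> cmod (f x) \<le> cmod (g x)"
  shows "f \<in> l2 M" "nrm M f \<le> nrm M g"
proof -
  show f: "f \<in> l2 M"
    by (rule l2_bound[OF assms(1) l2_square_integrable[OF assms(2)]]) (use assms in \<open>auto intro!: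
        power_mono\<close>)
  show "nrm M f \<le> nrm M g" unfolding nrm_def
    by (intro real_sqrt_le_mono integral_mono l2_square_integrable f assms) (use assms in \<open>auto
        intro!: power_mono\<close>)
qed

lemma nrm_mult_bounded:
  assumes "f \<in> l2 M" "w \<in> borel_measurable M" "\<And>x. x \<in> space M \<Longrightarrow> cmod (w x) \<le> b" "b \<ge> 0"
  shows "nrm M (\<lambda>x. w x * f x) \<le> b * nrm M f"
proof -
  have "nrm M (\<lambda>x. w x * f x) \<le> nrm M (\<lambda>x. of_real b * f x)"
    by (rule nrm_mono(2)) (use assms in \<open>auto simp: norm_mult intro!: mult_right_mono dest:
        l2_measurable\<close>)
  also have "\<dots> = b * nrm M f" using assms by (simp add: nrm_cmult)
  finally show ?thesis .
qed

lemma nn_integral_nrm: "f \<in> l2 M \<Longrightarrow> (\<integral>\<^sup>+x. ennreal ((cmod (f x))\<^sup>2) \<partial>M) = ennreal ((nrm M f)\<^sup>2)"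
  unfolding nrm_sq by (rule nn_integral_eq_integral) (auto simp: l2_square_integrable)

text \<open>A rapidly Cauchy subsequence converges almost everywhere because
  \<open>\<Sum>k. 2 ^ k * |d k|\<^sup>2\<close> is integrable for its increments \<open>d k\<close>; Fatou then
  gives convergence in norm.\<close>

lemma l2_complete:
  fixes u :: "nat \<Rightarrow> 'a \<Rightarrow> complex"
  assumes u [measurable]: "\<And>n. u n \<in> l2 M"
    and cauchy: "\<And>e. e > 0 \<Longrightarrow> \<exists>N. \<forall>m\<ge>N. \<forall>n\<ge>N. nrm M (\<lambda>x. u m x - u n x) < e"
  shows "\<exists>v\<in>l2 M. (\<lambda>n. nrm M (\<lambda>x. u n x - v x)) \<longlonglongrightarrow> 0"
proof -
  have "\<forall>k. \<exists>N. \<forall>m\<ge>N. \<forall>n\<ge>N. nrm M (\<lambda>x. u m x - u n x) < (1/2)^k" using cauchy by auto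
  then obtain N where N: "\<And>k m n. m \<ge> N k \<Longrightarrow> n \<ge> N k \<Longrightarrow> nrm M (\<lambda>x. u m x - u n x) < (1/2)^k" by metis
  \<comment> \<open>Summing the \<open>N i\<close> makes \<open>r\<close> nondecreasing and at least
    \<open>N k\<close>; the summand \<open>k\<close> makes it unbounded even if the
    \<open>N i\<close> are bounded, which the passage to the limit in \<open>key\<close> relies
    on.\<close>
  define r where "r k = (\<Sum>i\<le>k. N i) + k" for k
  have rN: "r k \<ge> N k" for k unfolding r_def by (rule trans_le_add1) (auto intro!: member_le_sum)
  have r_Suc: "r (Suc k) \<ge> r k" for k by (simp add: r_def)
  have r_ge: "r k \<ge> k" for k by (simp add: r_def)
  define d where "d k x = u (r (Suc k)) x - u (r k) x" for k x
  have d [measurable]: "d k \<in> l2 M" for k unfolding d_def by (intro l2_diff u)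
  have dn: "nrm M (d k) < (1/2)^k" for k
    unfolding d_def using order_trans[OF rN r_Suc] rN by (intro N) auto
  have "(\<integral>\<^sup>+x. (\<Sum>k. ennreal (2^k * (cmod (d k x))\<^sup>2)) \<partial>M)
      = (\<Sum>k. \<integral>\<^sup>+x. ennreal (2^k * (cmod (d k x))\<^sup>2) \<partial>M)"
    by (rule nn_integral_suminf) simp
  also have "\<dots> = (\<Sum>k. ennreal (2^k * (nrm M (d k))\<^sup>2))"
    using d by (simp add: ennreal_mult' nn_integral_cmult nn_integral_nrm)
  also have "\<dots> \<le> (\<Sum>k. ennreal ((1/2)^k))"
  proof (intro suminf_le ennreal_leI)
    fix k
    have "(nrm M (d k))\<^sup>2 \<le> ((1/2)^k)\<^sup>2" using dn[of k] by (intro power_mono) auto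
    then have "2^k * (nrm M (d k))\<^sup>2 \<le> 2^k * ((1/2)^k)\<^sup>2" by simp
    also have "\<dots> = (1/2)^k" by (simp add: power2_eq_square power_divide)
    finally show "2^k * (nrm M (d k))\<^sup>2 \<le> (1/2)^k" .
  qed auto
  also have "\<dots> = ennreal (\<Sum>k. (1/2)^k)" by (intro suminf_ennreal2) (auto intro!: summable_geometric)
  also have "\<dots> < \<infinity>" by simp
  finally have "AE x in M. (\<Sum>k. ennreal (2^k * (cmod (d k x))\<^sup>2)) \<noteq> \<infinity>"
    by (intro nn_integral_noteq_infinite) auto
  then have conv: "AE x in M. convergent (\<lambda>k. u (r k) x)"
  proof (eventually_elim)
    case (elim x)
    then have sm: "summable (\<lambda>k. 2^k * (cmod (d k x))\<^sup>2)"
      by (intro summable_suminf_not_top) auto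
    then have "(\<lambda>k. 2^k * (cmod (d k x))\<^sup>2) \<longlonglongrightarrow> 0" by (rule summable_LIMSEQ_zero)
    then obtain C where C: "\<And>k. 2^k * (cmod (d k x))\<^sup>2 \<le> C"
      using sums_summable summable_imp_Bseq[OF sm]
      by (auto simp: Bseq_def)
    have C0: "C \<ge> 0" using C[of 0] by (simp add: order_trans[OF zero_le_power2])
    have "summable (\<lambda>k. d k x)"
    proof (rule summable_comparison_test')
      show "summable (\<lambda>k. sqrt C * (1 / sqrt 2)^k)"
        by (intro summable_mult summable_geometric) (auto simp: real_less_rsqrt)
      fix k :: nat assume "k \<ge> 0"
      have "(cmod (d k x))\<^sup>2 \<le> C / 2^k" using C[of k] by (simp add: field_simps)
      also have "C / 2^k = (sqrt C * (1 / sqrt 2)^k)\<^sup>2"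
      proof -
        have "(sqrt C * (1 / sqrt 2)^k)\<^sup>2 = (sqrt C)\<^sup>2 * ((1 / sqrt 2)\<^sup>2)^k"
          by (simp only: power_mult_distrib power_mult[symmetric] mult.commute[of k])
        also have "(1 / sqrt 2)\<^sup>2 = (1/2::real)" by (simp add: power_divide)
        also have "(sqrt C)\<^sup>2 * (1/2)^k = C / 2^k" using C0 by (simp add: power_one_over)
        finally show ?thesis by simp
      qed
      finally show "norm (d k x) \<le> sqrt C * (1 / sqrt 2)^k"
        by (rule power2_le_imp_le) (use C0 in auto)
    qed
    then have "convergent (\<lambda>n. u (r 0) x + (\<Sum>k<n. d k x))"
      by (intro convergent_add convergent_const) (simp add: summable_iff_convergent)
    moreover have "u (r 0) x + (\<Sum>k<n. d k x) = u (r n) x" for n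
      unfolding d_def using sum_lessThan_telescope[of "\<lambda>k. u (r k) x" n] by simp
    ultimately show ?case by simp
  qed
  define v where "v x = lim (\<lambda>k. u (r k) x)" for x
  have vm [measurable]: "v \<in> borel_measurable M"
    unfolding v_def by (rule borel_measurable_lim_metric) simp
  have key: "(\<integral>\<^sup>+x. ennreal ((cmod (u n x - v x))\<^sup>2) \<partial>M) \<le> ennreal (((1/2)^k)\<^sup>2)" if "n \<ge> N k" for n k
  proof -
    have "(\<integral>\<^sup>+x. ennreal ((cmod (u n x - v x))\<^sup>2) \<partial>M)
        = (\<integral>\<^sup>+x. liminf (\<lambda>j. ennreal ((cmod (u n x - u (r j) x))\<^sup>2)) \<partial>M)"
    proof (rule nn_integral_cong_AE)
      show "AE x in M. ennreal ((cmod (u n x - v x))\<^sup>2)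
          = liminf (\<lambda>j. ennreal ((cmod (u n x - u (r j) x))\<^sup>2))"
        using conv
      proof eventually_elim
        case (elim x)
        then have "(\<lambda>j. u (r j) x) \<longlonglongrightarrow> v x" unfolding v_def by (simp add: convergent_LIMSEQ_iff)
        then have "(\<lambda>j. ennreal ((cmod (u n x - u (r j) x))\<^sup>2)) \<longlonglongrightarrow> ennreal ((cmod (u n x - v x))\<^sup>2)"
          by (intro tendsto_intros) auto
        then show ?case by (intro lim_imp_Liminf[symmetric]) auto
      qed
    qed
    also have "\<dots> \<le> liminf (\<lambda>j. \<integral>\<^sup>+x. ennreal ((cmod (u n x - u (r j) x))\<^sup>2) \<partial>M)"
      by (rule nn_integral_liminf) simp
    also have "\<dots> \<le> liminf (\<lambda>j. ennreal (((1/2)^k)\<^sup>2))"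
    proof (rule Liminf_mono)
      show "eventually (\<lambda>j. (\<integral>\<^sup>+x. ennreal ((cmod (u n x - u (r j) x))\<^sup>2) \<partial>M)
          \<le> ennreal (((1/2)^k)\<^sup>2)) sequentially"
        using eventually_ge_at_top[of "N k"]
      proof eventually_elim
        case (elim j)
        then have "nrm M (\<lambda>x. u n x - u (r j) x) < (1/2)^k" using that r_ge[of j] by (intro N) auto
        then show ?case using u by (subst nn_integral_nrm) (auto intro!: ennreal_leI power_mono)
      qed
    qed
    also have "\<dots> = ennreal (((1/2)^k)\<^sup>2)" by (simp add: Liminf_const)
    finally show ?thesis .
  qed
  have diff_l2: "(\<lambda>x. u (N 0) x - v x) \<in> l2 M"
  proof -
    have "(\<integral>\<^sup>+x. ennreal (norm ((cmod (u (N 0) x - v x))\<^sup>2)) \<partial>M) < \<infinity>"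
      using key[of 0 "N 0"] by simp (metis ennreal_one_less_top order_le_less_trans
          infinity_ennreal_def)
    then have "integrable M (\<lambda>x. (cmod (u (N 0) x - v x))\<^sup>2)" by (intro integrableI_bounded) auto
    then show ?thesis by (simp add: l2_def)
  qed
  have v: "v \<in> l2 M" using l2_diff[OF u[of "N 0"] diff_l2] by simp
  have "(\<lambda>n. nrm M (\<lambda>x. u n x - v x)) \<longlonglongrightarrow> 0"
  proof (rule LIMSEQ_I)
    fix e :: real assume e: "e > 0"
    obtain k where k: "(1/2::real)^k < e" using real_arch_pow_inv[OF e, of "1/2"] by auto
    have "norm (nrm M (\<lambda>x. u n x - v x) - 0) < e" if n: "n \<ge> N k" for n
    proof -
      have "ennreal ((nrm M (\<lambda>x. u n x - v x))\<^sup>2) \<le> ennreal (((1/2)^k)\<^sup>2)"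
        using key[OF n] u v by (subst nn_integral_nrm[symmetric]) auto
      then have "(nrm M (\<lambda>x. u n x - v x))\<^sup>2 \<le> ((1/2)^k)\<^sup>2" by (simp add: ennreal_le_iff)
      then have "nrm M (\<lambda>x. u n x - v x) \<le> (1/2)^k" by (rule power2_le_imp_le) simp
      then show ?thesis using k by simp
    qed
    then show "\<exists>no. \<forall>n\<ge>no. norm (nrm M (\<lambda>x. u n x - v x) - 0) < e" by blast
  qed
  then show ?thesis using v by blast
qed


section \<open>Orthonormal systems, Bessel and Parseval\<close>

definition orthonormal :: "'a measure \<Rightarrow> ('k \<Rightarrow> 'a \<Rightarrow> complex) \<Rightarrow> bool" where
  "orthonormal M e \<longleftrightarrow> (\<forall>k. e k \<in> l2 M) \<and> (\<forall>k l. ip M (e k) (e l) = (if k = l then 1 else 0))"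

text \<open>Completeness is expressed by a trivial orthogonal complement because both the waves and
  the eigenfunctions deliver it in this form. The index type is free: the waves are indexed by the
  integer lattice, the eigenfunctions by \<open>nat\<close>.\<close>

definition total :: "'a measure \<Rightarrow> ('k \<Rightarrow> 'a \<Rightarrow> complex) \<Rightarrow> bool" where
  "total M e \<longleftrightarrow> (\<forall>g\<in>l2 M. (\<forall>k. ip M (e k) g = 0) \<longrightarrow> (AE x in M. g x = 0))"

lemma orthonormal_l2: "orthonormal M e \<Longrightarrow> e k \<in> l2 M"
  by (simp add: orthonormal_def)

lemma orthonormal_ip: "orthonormal M e \<Longrightarrow> ip M (e k) (e l) = (if k = l then 1 else 0)"
  by (simp add: orthonormal_def)

context
  fixes M :: "'a measure" and e :: "'k \<Rightarrow> 'a \<Rightarrow> complex"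
  assumes orth: "orthonormal M e"
begin

lemma ip_basis_sum:
  assumes "finite K"
  shows "ip M (e k) (\<lambda>x. \<Sum>l\<in>K. c l * e l x) = (if k \<in> K then c k else 0)"
proof -
  have "ip M (e k) (\<lambda>x. \<Sum>l\<in>K. c l * e l x) = (\<Sum>l\<in>K. c l * (if k = l then 1 else 0))"
    by (simp add: ip_sum_right ip_cmult_right orthonormal_l2[OF orth] orthonormal_ip[OF orth])
  also have "\<dots> = (if k \<in> K then c k else 0)" using assms
      by (simp add: if_distrib sum.delta cong: if_cong)
  finally show ?thesis .
qed

lemma basis_sum_l2: "(\<lambda>x. \<Sum>l\<in>K. c l * e l x) \<in> l2 M"
  by (simp add: orthonormal_l2[OF orth])

lemma nrm_basis_sum:
  assumes "finite K"
  shows "(nrm M (\<lambda>x. \<Sum>l\<in>K. c l * e l x))\<^sup>2 = (\<Sum>l\<in>K. (cmod (c l))\<^sup>2)"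
proof -
  have "complex_of_real ((nrm M (\<lambda>x. \<Sum>l\<in>K. c l * e l x))\<^sup>2) = (\<Sum>k\<in>K. cnj (c k) * c k)"
    unfolding ip_self[symmetric]
    by (subst ip_sum_left) (auto simp: basis_sum_l2 orthonormal_l2[OF orth] ip_cmult_left
        ip_basis_sum[OF assms])
  also have "\<dots> = of_real (\<Sum>l\<in>K. (cmod (c l))\<^sup>2)"
    unfolding of_real_sum complex_norm_square by (simp add: mult.commute)
  finally show ?thesis unfolding of_real_eq_iff .
qed

lemma nrm_basis: "nrm M (e k) = 1"
proof -
  have "complex_of_real ((nrm M (e k))\<^sup>2) = of_real 1" unfolding ip_self[symmetric]
      by (simp add: orthonormal_ip[OF orth])
  then have "(nrm M (e k))\<^sup>2 = 1\<^sup>2" unfolding of_real_eq_iff by simp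
  then show ?thesis by (rule power2_eq_imp_eq) auto
qed

text \<open>Pythagoras for the projection onto the span of \<open>K\<close>. Bessel's inequality is
  nonnegativity of the left side, Parseval's identity its convergence to zero.\<close>

lemma projection_error:
  assumes g: "g \<in> l2 M" and K: "finite K"
  shows "(nrm M (\<lambda>x. g x - (\<Sum>l\<in>K. ip M (e l) g * e l x)))\<^sup>2
      = (nrm M g)\<^sup>2 - (\<Sum>l\<in>K. (cmod (ip M (e l) g))\<^sup>2)"
proof -
  have "ip M (\<lambda>x. \<Sum>l\<in>K. ip M (e l) g * e l x) g = (\<Sum>l\<in>K. cnj (ip M (e l) g) * ip M (e l) g)"
    using g by (subst ip_sum_left) (auto simp: orthonormal_l2[OF orth] ip_cmult_left)
  also have "\<dots> = of_real (\<Sum>l\<in>K. (cmod (ip M (e l) g))\<^sup>2)"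
    unfolding of_real_sum complex_norm_square by (simp add: mult.commute)
  finally have "Re (ip M (\<lambda>x. \<Sum>l\<in>K. ip M (e l) g * e l x) g) = (\<Sum>l\<in>K. (cmod (ip M (e l) g))\<^sup>2)"
    by simp
  then show ?thesis using g by (subst nrm_sq_diff) (auto simp: basis_sum_l2 nrm_basis_sum[OF K])
qed

lemma bessel_finite:
  assumes "g \<in> l2 M" "finite K"
  shows "(\<Sum>l\<in>K. (cmod (ip M (e l) g))\<^sup>2) \<le> (nrm M g)\<^sup>2"
  using projection_error[OF assms] zero_le_power2[of "nrm M (\<lambda>x. g x - (\<Sum>l\<in>K. ip M (e l) g * e l x))"]
  by linarith

lemma bessel_summable: "g \<in> l2 M \<Longrightarrow> (\<lambda>l. (cmod (ip M (e l) g))\<^sup>2) summable_on UNIV"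
  by (rule nonneg_bdd_above_summable_on) (auto intro!: bdd_aboveI2 bessel_finite)

text \<open>No enumeration of the index type is available here, so the expansion runs along finite
  sets \<open>G n\<close> that carry the Bessel sum up to \<open>(1/2)^n\<close>. The partial sums
  are Cauchy, their limit \<open>v\<close> has the coefficients of \<open>g\<close>, and totality
  identifies \<open>v\<close> with \<open>g\<close> almost everywhere.\<close>

lemma parseval:
  assumes tot: "total M e" and g: "g \<in> l2 M"
  shows "((\<lambda>l. (cmod (ip M (e l) g))\<^sup>2) has_sum (nrm M g)\<^sup>2) UNIV"
proof -
  define a where "a l = (cmod (ip M (e l) g))\<^sup>2" for l
  have sm: "a summable_on UNIV" unfolding a_def by (rule bessel_summable[OF g])
  then obtain S where S: "(a has_sum S) UNIV" by (auto simp: summable_on_def)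
  have a0: "a l \<ge> 0" for l by (simp add: a_def)
  have le_S: "sum a K \<le> S" if "finite K" for K
    using has_sum_mono_neutral[OF has_sum_finite[OF that, of a] S] a0 by auto
  have "\<exists>K. finite K \<and> S - sum a K < (1/2)^n" for n
  proof -
    have "\<forall>\<^sub>F K in finite_subsets_at_top UNIV. dist (sum a K) S < (1/2)^n"
      using S by (intro tendstoD) (auto simp: has_sum_def)
    then obtain K where "finite K" "dist (sum a K) S < (1/2)^n"
      unfolding eventually_finite_subsets_at_top by blast
    then show ?thesis by (auto simp: dist_real_def intro!: exI[of _ K])
  qed
  then obtain F where F: "\<And>n. finite (F n)" "\<And>n. S - sum a (F n) < (1/2)^n" by metis
  define G where "G n = (\<Union>i\<le>n. F i)" for n
  have G: "finite (G n)" "F n \<subseteq> G n" for n by (auto simp: G_def F)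
  have G_mono: "m \<le> n \<Longrightarrow> G m \<subseteq> G n" for m n unfolding G_def by (intro UN_mono) auto
  have GS: "S - sum a (G n) < (1/2)^n" for n
    using F(2)[of n] sum_mono2[OF G(1) G(2)[of n], of a] a0 by fastforce
  define s where "s n x = (\<Sum>l\<in>G n. ip M (e l) g * e l x)" for n x
  have s: "s n \<in> l2 M" for n unfolding s_def by (rule basis_sum_l2)
  have diff: "(nrm M (\<lambda>x. s n x - s m x))\<^sup>2 \<le> (1/2)^m" if "m \<le> n" for m n
  proof -
    have "s n x - s m x = (\<Sum>l\<in>G n - G m. ip M (e l) g * e l x)" for x
      unfolding s_def by (simp add: sum_diff G G_mono that)
    then have "(nrm M (\<lambda>x. s n x - s m x))\<^sup>2 = sum a (G n - G m)"
      by (simp add: nrm_basis_sum G a_def)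
    also have "\<dots> = sum a (G n) - sum a (G m)" by (simp add: sum_diff G G_mono that)
    also have "\<dots> \<le> S - sum a (G m)" using le_S[OF G(1)[of n]] by simp
    also have "\<dots> \<le> (1/2)^m" using GS[of m] by simp
    finally show ?thesis .
  qed
  have "\<exists>v\<in>l2 M. (\<lambda>n. nrm M (\<lambda>x. s n x - v x)) \<longlonglongrightarrow> 0"
  proof (rule l2_complete[OF s])
    fix r :: real assume r: "r > 0"
    obtain N where N: "(1/2::real)^N < r\<^sup>2" using real_arch_pow_inv[of "r\<^sup>2" "1/2"] r by auto
    have "nrm M (\<lambda>x. s n x - s m x) < r" if "N \<le> m" "m \<le> n" for m n
    proof -
      have "(nrm M (\<lambda>x. s n x - s m x))\<^sup>2 \<le> (1/2)^m" using diff that by simp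
      also have "(1/2::real)^m \<le> (1/2)^N" using that by (intro power_decreasing) auto
      also have "\<dots> < r\<^sup>2" by (rule N)
      finally show ?thesis by (rule power2_less_imp_less) (use r in simp)
    qed
    then have "\<forall>m\<ge>N. \<forall>n\<ge>N. nrm M (\<lambda>x. s m x - s n x) < r"
      by (metis nle_le nrm_minus_commute)
    then show "\<exists>N. \<forall>m\<ge>N. \<forall>n\<ge>N. nrm M (\<lambda>x. s m x - s n x) < r" by blast
  qed
  then obtain v where v: "v \<in> l2 M" and lim: "(\<lambda>n. nrm M (\<lambda>x. s n x - v x)) \<longlonglongrightarrow> 0" by blast
  have ipv: "ip M (e k) g = ip M (e k) v" for k
  \<comment> \<open>An index of positive weight lies in every late \<open>G n\<close>, since
    otherwise its weight would be missing from a sum within \<open>(1/2)^n\<close> of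
    \<open>S\<close>. An index of weight zero may never be reached; its coefficient in
    \<open>v\<close> is zero because it is zero in every partial sum.\<close>
  proof (cases "a k = 0")
    case False
    have "\<exists>N. (1/2)^N < a k" using real_arch_pow_inv[of "a k" "1/2"] False a0[of k] by auto
    then obtain N where N: "(1/2)^N < a k" by blast
    have kG: "k \<in> G n" if "n \<ge> N" for n
    proof (rule ccontr)
      assume "k \<notin> G n"
      then have "sum a (G n) + a k \<le> S" using le_S[of "insert k (G n)"] G by simp
      moreover have "(1/2::real)^n \<le> (1/2)^N" using that by (intro power_decreasing) auto
      ultimately show False using GS[of n] N by linarith
    qed
    have "(\<lambda>n. ip M (e k) (\<lambda>x. s n x - v x)) \<longlonglongrightarrow> 0"
    proof (rule Lim_null_comparison[OF _ lim])
      show "\<forall>\<^sub>F n in sequentially. norm (ip M (e k) (\<lambda>x. s n x - v x)) \<le> nrm M (\<lambda>x. s n x - v x)"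
      proof (intro always_eventually allI)
        fix n
        show "norm (ip M (e k) (\<lambda>x. s n x - v x)) \<le> nrm M (\<lambda>x. s n x - v x)"
          using cauchy_schwarz[of "e k" M "\<lambda>x. s n x - v x"] s v orthonormal_l2[OF orth]
              by (simp add: nrm_basis)
      qed
    qed
    moreover have "\<forall>\<^sub>F n in sequentially. ip M (e k) (\<lambda>x. s n x - v x) = ip M (e k) g - ip M (e k) v"
      using eventually_ge_at_top[of N]
    proof eventually_elim
      case (elim n)
      have "ip M (e k) (s n) = ip M (e k) g" unfolding s_def using kG[OF elim]
          by (simp add: ip_basis_sum G)
      then show ?case using s v orthonormal_l2[OF orth] by (simp add: ip_diff_right)
    qed
    ultimately have "(\<lambda>n. ip M (e k) g - ip M (e k) v) \<longlonglongrightarrow> 0" by (rule Lim_transform_eventually)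
    then show ?thesis by (simp add: LIMSEQ_const_iff)
  next
    case True
    then have z: "ip M (e k) g = 0" by (simp add: a_def)
    have sz: "ip M (e k) (s n) = 0" for n unfolding s_def using z by (simp add: ip_basis_sum G)
    have "norm (ip M (e k) v) \<le> 0"
    proof (rule LIMSEQ_le[OF tendsto_const])
      show "(\<lambda>n. nrm M (e k) * nrm M (\<lambda>x. s n x - v x)) \<longlonglongrightarrow> 0" using tendsto_mult_right_zero[OF lim] .
      have "norm (ip M (e k) v) \<le> nrm M (e k) * nrm M (\<lambda>x. s n x - v x)" for n
        using cauchy_schwarz[of "e k" M "\<lambda>x. s n x - v x"] s v orthonormal_l2[OF orth] sz
            by (simp add: ip_diff_right)
      then show "\<exists>N. \<forall>n\<ge>N. norm (ip M (e k) v) \<le> nrm M (e k) * nrm M (\<lambda>x. s n x - v x)" by blast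
    qed
    then show ?thesis using z by simp
  qed
  have "AE x in M. g x - v x = 0"
    using tot[unfolded total_def, rule_format, of "\<lambda>x. g x - v x"] g v ipv
    by (simp add: ip_diff_right orthonormal_l2[OF orth])
  then have gv: "nrm M (\<lambda>x. g x - v x) = 0" using g v by (simp add: nrm_eq_0_iff)
  have "(\<lambda>n. nrm M (\<lambda>x. g x - s n x)) \<longlonglongrightarrow> 0"
  proof (rule tendsto_sandwich[OF _ _ tendsto_const lim])
    show "\<forall>\<^sub>F n in sequentially. nrm M (\<lambda>x. g x - s n x) \<le> nrm M (\<lambda>x. s n x - v x)"
      using nrm_triangle_mid[OF g v s] gv by (simp add: nrm_minus_commute)
  qed simp
  then have "(\<lambda>n. (nrm M (\<lambda>x. g x - s n x))\<^sup>2) \<longlonglongrightarrow> 0" by (intro tendsto_eq_intros) auto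
  then have "(\<lambda>n. (nrm M g)\<^sup>2 - sum a (G n)) \<longlonglongrightarrow> 0"
    unfolding s_def by (simp add: projection_error[OF g G(1)] a_def)
  moreover have "(\<lambda>n. sum a (G n)) \<longlonglongrightarrow> S"
  proof (rule tendsto_sandwich[OF _ _ _ tendsto_const])
    show "(\<lambda>n. S - (1/2)^n) \<longlonglongrightarrow> S"
      by (rule tendsto_eq_intros tendsto_const LIMSEQ_realpow_zero refl | simp)+
    show "\<forall>\<^sub>F n in sequentially. S - (1/2)^n \<le> sum a (G n)" using GS
        by (intro always_eventually allI) (smt (verit))
  qed (use le_S G in auto)
  ultimately have "(\<lambda>n. (nrm M g)\<^sup>2 - sum a (G n) + sum a (G n)) \<longlonglongrightarrow> 0 + S" by (intro tendsto_add)
  then have "(nrm M g)\<^sup>2 = S" by (simp add: LIMSEQ_const_iff)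
  then show ?thesis using S by (simp add: a_def[abs_def])
qed

lemma projection_tendsto:
  assumes tot: "total M e" and g: "g \<in> l2 M"
  shows "((\<lambda>K. nrm M (\<lambda>x. g x - (\<Sum>l\<in>K. ip M (e l) g * e l x))) \<longlongrightarrow> 0) (finite_subsets_at_top UNIV)"
proof -
  have "((\<lambda>K. (\<Sum>l\<in>K. (cmod (ip M (e l) g))\<^sup>2)) \<longlongrightarrow> (nrm M g)\<^sup>2) (finite_subsets_at_top UNIV)"
    using parseval[OF assms] by (simp add: has_sum_def)
  then have "((\<lambda>K. sqrt ((nrm M g)\<^sup>2 - (\<Sum>l\<in>K. (cmod (ip M (e l) g))\<^sup>2))) \<longlongrightarrow> 0) (finite_subsets_at_top
      UNIV)"
    by (auto intro!: tendsto_eq_intros)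
  moreover have "\<forall>\<^sub>F K in finite_subsets_at_top UNIV.
     sqrt ((nrm M g)\<^sup>2 - (\<Sum>l\<in>K. (cmod (ip M (e l) g))\<^sup>2))
         = nrm M (\<lambda>x. g x - (\<Sum>l\<in>K. ip M (e l) g * e l x))"
    by (rule eventually_finite_subsets_at_top_weakI) (simp flip: projection_error[OF g])
  ultimately show ?thesis by (rule Lim_transform_eventually)
qed

lemma parseval_ip:
  assumes tot: "total M e" and f: "f \<in> l2 M" and g: "g \<in> l2 M"
  shows "((\<lambda>l. cnj (ip M (e l) f) * ip M (e l) g) has_sum ip M f g) UNIV"
  unfolding has_sum_def
proof (rule LIM_zero_cancel, rule Lim_null_comparison)
  show "((\<lambda>K. nrm M f * nrm M (\<lambda>x. g x - (\<Sum>l\<in>K. ip M (e l) g * e l x))) \<longlongrightarrow> 0) (finite_subsets_at_top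
      UNIV)"
    by (rule tendsto_mult_right_zero[OF projection_tendsto[OF tot g]])
  show "\<forall>\<^sub>F K in finite_subsets_at_top UNIV. norm ((\<Sum>l\<in>K. cnj (ip M (e l) f) * ip M (e l) g) - ip M f g)
     \<le> nrm M f * nrm M (\<lambda>x. g x - (\<Sum>l\<in>K. ip M (e l) g * e l x))"
  proof (rule eventually_finite_subsets_at_top_weakI)
    fix K :: "'k set" assume "finite K"
    have "ip M f (\<lambda>x. g x - (\<Sum>l\<in>K. ip M (e l) g * e l x))
        = ip M f g - (\<Sum>l\<in>K. cnj (ip M (e l) f) * ip M (e l) g)"
      using f g by (simp add: ip_simps basis_sum_l2 orthonormal_l2[OF orth] ip_cnj) (simp only:
          mult.commute)
    then show "norm ((\<Sum>l\<in>K. cnj (ip M (e l) f) * ip M (e l) g) - ip M f g)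
       \<le> nrm M f * nrm M (\<lambda>x. g x - (\<Sum>l\<in>K. ip M (e l) g * e l x))"
      using cauchy_schwarz[OF f, of "\<lambda>x. g x - (\<Sum>l\<in>K. ip M (e l) g * e l x)"] f g
      by (simp add: basis_sum_l2 norm_minus_commute)
  qed
qed

end

section \<open>Eigenfunction expansions\<close>

text \<open>Abstract periodic Laplacian: a complete system of eigenvectors with nonnegative
  eigenvalues. \<open>finite_nu\<close> encodes compactness of the resolvent, and
  \<open>infinite_index\<close> guarantees that the construction of eigenvectors never runs out of
  directions.\<close>

locale spectral_basis =
  fixes M :: "'a measure" and e :: "'k \<Rightarrow> 'a \<Rightarrow> complex" and nu :: "'k \<Rightarrow> real"
  assumes orth: "orthonormal M e" and tot: "total M e" and nu_nonneg: "0 \<le> nu k"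
    and finite_nu: "finite {k. nu k \<le> c}" and infinite_index: "infinite (UNIV :: 'k set)"
begin

lemma e_l2 [simp]: "e k \<in> l2 M"
  by (rule orthonormal_l2[OF orth])

text \<open>The graph of the operator with eigenvalues \<open>nu\<close>. It is a relation because
  the image is determined only up to a null set; requiring a square-integrable \<open>w\<close>
  replaces the summability condition on the coefficients of \<open>u\<close>.\<close>

definition D :: "('a \<Rightarrow> complex) \<Rightarrow> ('a \<Rightarrow> complex) \<Rightarrow> bool" where
  "D u w \<longleftrightarrow> u \<in> l2 M \<and> w \<in> l2 M \<and> (\<forall>k. ip M (e k) w = of_real (nu k) * ip M (e k) u)"

lemma D_l2: "D u w \<Longrightarrow> u \<in> l2 M" "D u w \<Longrightarrow> w \<in> l2 M"
  by (auto simp: D_def)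

lemma D_ip: "D u w \<Longrightarrow> ip M (e k) w = of_real (nu k) * ip M (e k) u"
  by (auto simp: D_def)

lemma D_symmetric:
  assumes "D u w" "D u' w'" shows "ip M u w' = ip M w u'"
proof -
  have "((\<lambda>k. cnj (ip M (e k) u) * ip M (e k) w') has_sum ip M u w') UNIV"
    by (rule parseval_ip[OF orth tot]) (use assms in \<open>auto dest: D_l2\<close>)
  moreover have "((\<lambda>k. cnj (ip M (e k) w) * ip M (e k) u') has_sum ip M w u') UNIV"
    by (rule parseval_ip[OF orth tot]) (use assms in \<open>auto dest: D_l2\<close>)
  moreover have "cnj (ip M (e k) u) * ip M (e k) w' = cnj (ip M (e k) w) * ip M (e k) u'" for k
    by (simp add: D_ip[OF assms(1)] D_ip[OF assms(2)])
  ultimately show ?thesis by (simp add: has_sum_unique)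
qed

lemma D_energy:
  assumes "D u w" shows "((\<lambda>k. nu k * (cmod (ip M (e k) u))\<^sup>2) has_sum Re (ip M u w)) UNIV"
proof -
  have "((\<lambda>k. cnj (ip M (e k) u) * ip M (e k) w) has_sum ip M u w) UNIV"
    by (rule parseval_ip[OF orth tot]) (use assms in \<open>auto dest: D_l2\<close>)
  then have "((\<lambda>k. Re (cnj (ip M (e k) u) * ip M (e k) w)) has_sum Re (ip M u w)) UNIV"
    by (rule has_sum_Re)
  moreover have "Re (cnj (ip M (e k) u) * ip M (e k) w) = nu k * (cmod (ip M (e k) u))\<^sup>2" for k
    by (simp add: D_ip[OF assms] cmod_power2) (simp add: power2_eq_square algebra_simps)
  ultimately show ?thesis by simp
qed

lemma D_energy_nonneg: "D u w \<Longrightarrow> 0 \<le> Re (ip M u w)"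
  by (rule has_sum_nonneg[OF D_energy]) (auto intro!: mult_nonneg_nonneg nu_nonneg)

lemma countable_index: "countable (UNIV :: 'k set)"
proof -
  have "(UNIV :: 'k set) = (\<Union>n::nat. {k. nu k \<le> real n})" using real_arch_simple by auto
  then show ?thesis by (metis countable_UN uncountable_infinite finite_nu countableI_type)
qed

text \<open>Rellich compactness. Bounded energy makes the modes with \<open>nu k > c\<close>
  contribute at most a multiple of \<open>C / c\<close>, uniformly in the sequence, while the
  finitely many remaining coefficients converge along a diagonal subsequence.\<close>

lemma energy_compact:
  fixes u w :: "nat \<Rightarrow> 'a \<Rightarrow> complex"
  assumes D: "\<And>n. D (u n) (w n)" and n1: "\<And>n. nrm M (u n) \<le> 1" and C: "\<And>n. Re (ip M (u n) (w n)) \<le> C"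
  shows "\<exists>r v. strict_mono (r :: nat \<Rightarrow> nat) \<and> v \<in> l2 M \<and> (\<lambda>n. nrm M (\<lambda>x. u (r n) x - v x)) \<longlonglongrightarrow> 0"
proof -
  note u = D_l2(1)[OF D]
  have "norm (ip M (e k) (u n)) \<le> 1" for n k
    using cauchy_schwarz[of "e k" M "u n"] u n1[of n] nrm_basis[OF orth, of k] by auto
  then obtain r where r: "strict_mono (r :: nat \<Rightarrow> nat)" and "\<And>k. \<exists>l. (\<lambda>n. ip M (e k) (u (r n))) \<longlonglongrightarrow> l"
    using function_convergent_subsequence[OF countable_index, of "\<lambda>n k. ip M (e k) (u n)" 1]
        by (metis UNIV_I)
  then obtain l where l: "\<And>k. (\<lambda>n. ip M (e k) (u (r n))) \<longlonglongrightarrow> l k" by metis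
  have C0: "C \<ge> 0" using C[of 0] D_energy_nonneg[OF D[of 0]] by linarith
  have bound: "(nrm M (\<lambda>x. u m x - u n x))\<^sup>2 \<le>
      (\<Sum>k | nu k \<le> c. (cmod (ip M (e k) (u m) - ip M (e k) (u n)))\<^sup>2) + 4 * C / c" if c: "c > 0"
          for m n c
  proof -
    define a where "a k = ip M (e k) (u m) - ip M (e k) (u n)" for k
    have a: "ip M (e k) (\<lambda>x. u m x - u n x) = a k" for k unfolding a_def using u by (simp add: ip_simps)
    have "((\<lambda>k. (cmod (a k))\<^sup>2) has_sum (nrm M (\<lambda>x. u m x - u n x))\<^sup>2) UNIV"
      using parseval[OF orth tot, of "\<lambda>x. u m x - u n x"] u by (simp add: a)
    moreover have "((\<lambda>k. (if nu k \<le> c then (cmod (a k))\<^sup>2 else 0)) has_sum (\<Sum>k | nu k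
        \<le> c. (cmod (a k))\<^sup>2)) UNIV"
    proof -
      have "((\<lambda>k. (cmod (a k))\<^sup>2) has_sum (\<Sum>k | nu k \<le> c. (cmod (a k))\<^sup>2)) {k. nu k \<le> c}"
        by (rule has_sum_finite) (rule finite_nu)
      then show ?thesis by (rule has_sum_cong_neutral[THEN iffD1, rotated 3]) auto
    qed
    moreover have "((\<lambda>k. (2 / c) * (nu k * (cmod (ip M (e k) (u m)))\<^sup>2)
        + (2 / c) * (nu k * (cmod (ip M (e k) (u n)))\<^sup>2)) has_sum
        ((2/c) * Re (ip M (u m) (w m)) + (2/c) * Re (ip M (u n) (w n)))) UNIV"
      by (intro has_sum_add has_sum_cmult_right D_energy D)
    ultimately have "(nrm M (\<lambda>x. u m x - u n x))\<^sup>2 \<le>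
        (\<Sum>k | nu k \<le> c. (cmod (a k))\<^sup>2) + ((2/c) * Re (ip M (u m) (w m))
            + (2/c) * Re (ip M (u n) (w n)))"
    proof (rule has_sum_mono[OF _ has_sum_add])
      fix k
      have "(cmod (a k))\<^sup>2 \<le> (2 / c) * (nu k * (cmod (ip M (e k) (u m)))\<^sup>2)
          + (2 / c) * (nu k * (cmod (ip M (e k) (u n)))\<^sup>2)"
        if "nu k > c"
      proof -
        have "(cmod (a k))\<^sup>2 \<le> 2 * (cmod (ip M (e k) (u m)))\<^sup>2 + 2 * (cmod (ip M (e k) (u n)))\<^sup>2"
          unfolding a_def using sum_sq_le[of "ip M (e k) (u m)" "- ip M (e k) (u n)"] by simp
        also have "\<dots> \<le> (nu k / c) * (2 * (cmod (ip M (e k) (u m)))\<^sup>2 + 2 * (cmod (ip M (e k) (u n)))\<^sup>2)"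
          using that c
            mult_right_mono[of 1 "nu k / c" "2 * (cmod (ip M (e k) (u m)))\<^sup>2
                + 2 * (cmod (ip M (e k) (u n)))\<^sup>2"] by simp
        finally show ?thesis by (simp add: field_simps add_divide_distrib)
      qed
      then show "(cmod (a k))\<^sup>2 \<le> (if nu k \<le> c then (cmod (a k))\<^sup>2 else 0) +
         ((2 / c) * (nu k * (cmod (ip M (e k) (u m)))\<^sup>2)
             + (2 / c) * (nu k * (cmod (ip M (e k) (u n)))\<^sup>2))"
        using c nu_nonneg[of k] by (auto intro!: add_nonneg_nonneg)
    qed
    moreover have "(2/c) * Re (ip M (u m) (w m)) + (2/c) * Re (ip M (u n) (w n))
        \<le> (2/c) * C + (2/c) * C"
      using C c by (intro add_mono mult_left_mono) auto
    ultimately show ?thesis by (simp add: a_def)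
  qed
  have "\<exists>v\<in>l2 M. (\<lambda>n. nrm M (\<lambda>x. u (r n) x - v x)) \<longlonglongrightarrow> 0"
  proof (rule l2_complete)
    fix \<epsilon> :: real assume eps: "\<epsilon> > 0"
    \<comment> \<open>This \<open>c\<close> makes the contribution \<open>4 * C / c\<close> of the
      high modes less than half of \<open>\<epsilon>\<^sup>2\<close>. The tolerance
      \<open>\<epsilon>\<^sup>2 / 8\<close> for \<open>g\<close> then leaves
      \<open>2 * g m + 2 * g n\<close> below the other half.\<close>
    define c where "c = 8 * C / \<epsilon>\<^sup>2 + 1"
    have c: "c > 0" unfolding c_def using C0 eps by (intro add_nonneg_pos) auto
    have "8 * C < c * \<epsilon>\<^sup>2" using eps by (simp add: c_def field_simps)
    then have c4: "4 * C / c < \<epsilon>\<^sup>2 / 2" using c by (simp add: field_simps)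
    define g where "g n = (\<Sum>k | nu k \<le> c. (cmod (ip M (e k) (u (r n)) - l k))\<^sup>2)" for n
    have "g \<longlonglongrightarrow> (\<Sum>k | nu k \<le> c. (cmod (l k - l k))\<^sup>2)"
      unfolding g_def by (intro tendsto_intros l)
    then have "\<forall>\<^sub>F n in sequentially. g n < \<epsilon>\<^sup>2 / 8"
      by (rule order_tendstoD) (use eps in auto)
    then obtain N where N: "\<And>n. n \<ge> N \<Longrightarrow> g n < \<epsilon>\<^sup>2 / 8" by (auto simp: eventually_sequentially)
    have "nrm M (\<lambda>x. u (r m) x - u (r n) x) < \<epsilon>" if "m \<ge> N" "n \<ge> N" for m n
    proof -
      have "(\<Sum>k | nu k \<le> c. (cmod (ip M (e k) (u (r m)) - ip M (e k) (u (r n))))\<^sup>2) \<le> 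
         (\<Sum>k | nu k \<le> c. 2 * (cmod (ip M (e k) (u (r m)) - l k))\<^sup>2
             + 2 * (cmod (ip M (e k) (u (r n)) - l k))\<^sup>2)"
      proof (rule sum_mono)
        fix k
        show "(cmod (ip M (e k) (u (r m)) - ip M (e k) (u (r n))))\<^sup>2
            \<le> 2 * (cmod (ip M (e k) (u (r m)) - l k))\<^sup>2 + 2 * (cmod (ip M (e k) (u (r n)) - l k))\<^sup>2"
          using sum_sq_le[of "ip M (e k) (u (r m)) - l k" "l k - ip M (e k) (u (r n))"]
          by (simp add: norm_minus_commute)
      qed
      also have "\<dots> = 2 * g m + 2 * g n" by (simp add: g_def sum.distrib sum_distrib_left)
      finally have "(nrm M (\<lambda>x. u (r m) x - u (r n) x))\<^sup>2 < \<epsilon>\<^sup>2"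
        using bound[OF c, of "r m" "r n"] c4 N[OF that(1)] N[OF that(2)] by linarith
      then show ?thesis by (rule power2_less_imp_less) (use eps in simp)
    qed
    then show "\<exists>N. \<forall>m\<ge>N. \<forall>n\<ge>N. nrm M (\<lambda>x. u (r m) x - u (r n) x) < \<epsilon>" by blast
  qed (rule u)
  with r show ?thesis by blast
qed

end

section \<open>Bounded potentials and the variational construction of eigenfunctions\<close>

locale schroedinger = spectral_basis M e nu
  for M :: "'a measure" and e :: "'k \<Rightarrow> 'a \<Rightarrow> complex" and nu :: "'k \<Rightarrow> real" +
  fixes W :: "'a \<Rightarrow> real" and b :: real
  assumes W_meas [measurable]: "W \<in> borel_measurable M" and W_bound: "\<And>x. x \<in> space M \<Longrightarrow> \<bar>W x\<bar> \<le> b"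
    and b_nonneg: "0 \<le> b"
begin

lemma W_l2 [simp]: "f \<in> l2 M \<Longrightarrow> (\<lambda>x. of_real (W x) * f x) \<in> l2 M"
  by (rule l2_mult_bounded[where b = b]) (auto simp: W_bound)

lemma W_nrm: "f \<in> l2 M \<Longrightarrow> nrm M (\<lambda>x. of_real (W x) * f x) \<le> b * nrm M f"
  by (rule nrm_mult_bounded) (auto simp: W_bound b_nonneg)

lemma W_ip: "ip M (\<lambda>x. of_real (W x) * f x) g = ip M f (\<lambda>x. of_real (W x) * g x)"
  unfolding ip_def by (simp add: ac_simps)

lemma W_ip_bound: "f \<in> l2 M \<Longrightarrow> \<bar>Re (ip M f (\<lambda>x. of_real (W x) * f x))\<bar> \<le> b * (nrm M f)\<^sup>2"
proof -
  assume f: "f \<in> l2 M"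
  have "\<bar>Re (ip M f (\<lambda>x. of_real (W x) * f x))\<bar> \<le> nrm M f * (b * nrm M f)"
    using cauchy_schwarz[OF f W_l2[OF f]] mult_left_mono[OF W_nrm[OF f] nrm_nonneg[of M f]]
      abs_Re_le_cmod[of "ip M f (\<lambda>x. of_real (W x) * f x)"] by linarith
  then show ?thesis by (simp add: power2_eq_square ac_simps)
qed

text \<open>\<open>H u h\<close> says that \<open>u\<close> lies in the domain of the operator with potential \<open>W\<close>,
  which maps it to \<open>h\<close>.\<close>

definition H :: "('a \<Rightarrow> complex) \<Rightarrow> ('a \<Rightarrow> complex) \<Rightarrow> bool" where
  "H u h \<longleftrightarrow> u \<in> l2 M \<and> h \<in> l2 M \<and>
     (\<forall>k. ip M (e k) h = of_real (nu k) * ip M (e k) u + ip M (e k) (\<lambda>x. of_real (W x) * u x))"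

lemma H_l2: "H u h \<Longrightarrow> u \<in> l2 M" "H u h \<Longrightarrow> h \<in> l2 M"
  by (auto simp: H_def)

lemma H_iff_D: "u \<in> l2 M \<Longrightarrow> h \<in> l2 M \<Longrightarrow> H u h \<longleftrightarrow> D u (\<lambda>x. h x - of_real (W x) * u x)"
  by (auto simp: H_def D_def ip_diff_right diff_eq_eq)

lemma H_add: "H u h \<Longrightarrow> H u' h' \<Longrightarrow> H (\<lambda>x. u x + u' x) (\<lambda>x. h x + h' x)"
  by (auto simp: H_def ip_simps ring_distribs)

lemma H_cmult: 
  assumes "H u h" shows "H (\<lambda>x. c * u x) (\<lambda>x. c * h x)"
proof -
  have "(\<lambda>x. of_real (W x) * (c * u x)) = (\<lambda>x. c * (of_real (W x) * u x))" by (auto simp: ac_simps)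
  then show ?thesis using assms by (auto simp: H_def ip_cmult_right algebra_simps)
qed

lemma H_diff: "H u h \<Longrightarrow> H u' h' \<Longrightarrow> H (\<lambda>x. u x - u' x) (\<lambda>x. h x - h' x)"
  using H_add[of u h "\<lambda>x. -1 * u' x" "\<lambda>x. -1 * h' x"] H_cmult[of u' h' "-1"] by simp

lemma H_zero: "H (\<lambda>x. 0) (\<lambda>x. 0)"
  by (simp add: H_def)

lemma H_sum: "(\<And>i. i \<in> I \<Longrightarrow> H (u i) (h i)) \<Longrightarrow> H (\<lambda>x. \<Sum>i\<in>I. u i x) (\<lambda>x. \<Sum>i\<in>I. h i x)"
  by (induction I rule: infinite_finite_induct) (auto simp: H_zero H_add)

lemma H_symmetric:
  assumes "H u h" "H u' h'" shows "ip M u h' = ip M h u'"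
proof -
  have "D u (\<lambda>x. h x - of_real (W x) * u x)" "D u' (\<lambda>x. h' x - of_real (W x) * u' x)"
    using assms H_iff_D H_l2 by blast+
  then have "ip M u (\<lambda>x. h' x - of_real (W x) * u' x) = ip M (\<lambda>x. h x - of_real (W x) * u x) u'"
    by (rule D_symmetric)
  then show ?thesis using assms[THEN H_l2(1)] assms[THEN H_l2(2)] by (simp add: ip_simps W_ip)
qed

lemma H_basis: "H (e k) (\<lambda>x. of_real (nu k) * e k x + of_real (W x) * e k x)"
  by (auto simp: H_def ip_simps orthonormal_ip[OF orth])

text \<open>A potential bounded by \<open>b\<close> changes the form by at most
  \<open>b * (nrm M u)\<^sup>2\<close>, so control of the form of \<open>H\<close> yields the
  kinetic bound that \<open>energy_compact\<close> requires.\<close>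

lemma H_energy:
  assumes "H u h"
  shows "D u (\<lambda>x. h x - of_real (W x) * u x)"
    "Re (ip M u (\<lambda>x. h x - of_real (W x) * u x)) \<le> Re (ip M u h) + b * (nrm M u)\<^sup>2"
proof -
  show "D u (\<lambda>x. h x - of_real (W x) * u x)" using assms H_iff_D H_l2 by blast
  show "Re (ip M u (\<lambda>x. h x - of_real (W x) * u x)) \<le> Re (ip M u h) + b * (nrm M u)\<^sup>2"
    using W_ip_bound[OF H_l2(1)[OF assms]] H_l2[OF assms] by (simp add: ip_simps)
qed

lemma H_lower: "H u h \<Longrightarrow> - b * (nrm M u)\<^sup>2 \<le> Re (ip M u h)"
  using H_energy[of u h] D_energy_nonneg[of u] by fastforce


text \<open>The quadratic form is minimized over unit vectors orthogonal to the earlier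
  eigenvectors. \<open>energy_compact\<close> gives a strong limit \<open>v\<close> of a minimizing
  sequence, but \<open>v\<close> is not yet known to lie in the domain. The stationarity condition
  is therefore derived for the minimizing sequence against test vectors from the domain and passed
  to the limit there; the resulting weak equation, tested against all \<open>e k\<close>, is exactly
  what \<open>H\<close> demands.\<close>

lemma next_eigenvector:
  fixes \<psi> :: "nat \<Rightarrow> 'a \<Rightarrow> complex" and E :: "nat \<Rightarrow> real"
  assumes eig: "\<And>j. j < n \<Longrightarrow> H (\<psi> j) (\<lambda>x. of_real (E j) * \<psi> j x)"
    and on: "\<And>i j. i < n \<Longrightarrow> j < n \<Longrightarrow> ip M (\<psi> i) (\<psi> j) = (if i = j then 1 else 0)"
  shows "\<exists>p \<mu>. H p (\<lambda>x. of_real \<mu> * p x) \<and> nrm M p = 1 \<and> (\<forall>j<n. ip M (\<psi> j) p = 0) \<and>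
     (\<forall>u h. H u h \<longrightarrow> (\<forall>j<n. ip M (\<psi> j) u = 0) \<longrightarrow> \<mu> * (nrm M u)\<^sup>2 \<le> Re (ip M u h))"
proof -
  have psi [simp]: "\<psi> j \<in> l2 M" if "j < n" for j using H_l2(1)[OF eig[OF that]] .
  have psi_sum_l2 [simp]: "(\<lambda>x. \<Sum>j<n. a j * \<psi> j x) \<in> l2 M" for a
    by (rule l2_sum) simp
  have ip_psi_sum: "ip M f (\<lambda>x. \<Sum>j<n. a j * \<psi> j x) = (\<Sum>j<n. a j * ip M f (\<psi> j))"
    "ip M (\<lambda>x. \<Sum>j<n. a j * \<psi> j x) f = (\<Sum>j<n. cnj (a j) * ip M (\<psi> j) f)" if "f \<in> l2 M" for f a
    by (subst ip_sum_right ip_sum_left; use that in \<open>simp add: ip_cmult_left ip_cmult_right\<close>)+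
  have psi_n: "(nrm M (\<psi> j))\<^sup>2 = 1" if "j < n" for j
  proof -
    have "complex_of_real ((nrm M (\<psi> j))\<^sup>2) = of_real 1"
      unfolding ip_self[symmetric] using on[OF that that] by simp
    then show ?thesis unfolding of_real_eq_iff .
  qed
  define c where "c k j = ip M (\<psi> j) (e k)" for k j
  \<comment> \<open>The basis vectors need not be orthogonal to the earlier eigenvectors, so their
    components in the orthogonal complement serve as test vectors; \<open>q k\<close> is the image
    of \<open>g k\<close> under the operator.\<close>
  define g where "g k x = e k x - (\<Sum>j<n. c k j * \<psi> j x)" for k x
  define q where "q k x = (of_real (nu k) * e k x
      + of_real (W x) * e k x) - (\<Sum>j<n. c k j * (of_real (E j) * \<psi> j x))" for k x
  have Hg: "H (g k) (q k)" for k unfolding g_def q_def by (intro H_diff H_basis H_sum H_cmult eig) simp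
  have g_l2 [simp]: "g k \<in> l2 M" for k using H_l2[OF Hg] by simp
  have g_orth: "ip M (\<psi> j) (g k) = 0" if "j < n" for j k
  proof -
    have "ip M (\<psi> j) (g k) = c k j - (\<Sum>i<n. c k i * (if j = i then 1 else 0))"
      unfolding g_def using that by (simp add: ip_diff_right ip_psi_sum psi_sum_l2 on) (simp add: c_def)
    also have "\<dots> = 0" using that by (simp add: if_distrib sum.delta cong: if_cong)
    finally show ?thesis .
  qed
  have g_orth': "ip M (g k) (\<psi> j) = 0" if "j < n" for j k
    using g_orth[OF that, of k] ip_cnj[of M "\<psi> j" "g k"] by simp
  \<comment> \<open>If every \<open>g k\<close> were null, \<open>n + 1\<close> orthonormal vectors
    would lie in the span of \<open>n\<close> vectors. Summing the squared coefficients by rows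
    gives \<open>n + 1\<close>, by columns at most \<open>n\<close> by Bessel.\<close>
  have ex_g: "\<exists>k. nrm M (g k) \<noteq> 0"
  proof (rule ccontr)
    assume "\<nexists>k. nrm M (g k) \<noteq> 0"
    then have nz: "nrm M (g k) = 0" for k by blast
    have one: "(\<Sum>j<n. (cmod (c k j))\<^sup>2) = 1" for k
    proof -
      have "ip M (g k) (e k) = 0" using cauchy_schwarz[OF g_l2[of k] e_l2[of k]] nz[of k] by simp
      moreover have "ip M (g k) (e k) = 1 - (\<Sum>j<n. cnj (c k j) * c k j)"
        unfolding g_def by (simp add: ip_diff_left ip_psi_sum orthonormal_ip[OF orth]) (simp add: c_def)
      moreover have "(\<Sum>j<n. cnj (c k j) * c k j) = of_real (\<Sum>j<n. (cmod (c k j))\<^sup>2)"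
        unfolding of_real_sum complex_norm_square by (simp only: mult.commute)
      ultimately have "complex_of_real (\<Sum>j<n. (cmod (c k j))\<^sup>2) = of_real 1"
        by (simp only: right_minus_eq of_real_1 eq_commute[of 0 "1 - _"] eq_commute[of 1 "of_real _"])
      then show ?thesis unfolding of_real_eq_iff .
    qed
    obtain K :: "'k set" where K: "finite K" "card K = Suc n"
      using infinite_arbitrarily_large[OF infinite_index, where n = "Suc n"] by auto
    have "real (Suc n) = (\<Sum>k\<in>K. \<Sum>j<n. (cmod (c k j))\<^sup>2)" using K by (simp add: one)
    also have "\<dots> = (\<Sum>j<n. \<Sum>k\<in>K. (cmod (c k j))\<^sup>2)" by (rule sum.swap)
    also have "\<dots> \<le> (\<Sum>j<n. 1)"
    proof (rule sum_mono)
      fix j assume "j \<in> {..<n}"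
      then have j: "j < n" by simp
      have "cmod (c k j) = cmod (ip M (e k) (\<psi> j))" for k
        unfolding c_def by (subst ip_cnj[symmetric]) (rule complex_mod_cnj)
      then show "(\<Sum>k\<in>K. (cmod (c k j))\<^sup>2) \<le> 1"
        using bessel_finite[OF orth psi[OF j] K(1)] psi_n[OF j] by simp
    qed
    finally show False by simp
  qed
  define S where "S = {(u, h). H u h \<and> nrm M u = 1 \<and> (\<forall>j<n. ip M (\<psi> j) u = 0)}"
  \<comment> \<open>A genuine infimum: \<open>S\<close> is nonempty by \<open>ex_g\<close>, and the
    form is bounded below by \<open>- b\<close> on unit vectors.\<close>
  define \<mu> where "\<mu> = (INF (u, h)\<in>S. Re (ip M u h))"
  have normalize: "(\<lambda>x. of_real (1 / nrm M u) * u x, \<lambda>x. of_real (1 / nrm M u) * h x) \<in> S"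
    if "H u h" "\<forall>j<n. ip M (\<psi> j) u = 0" "nrm M u \<noteq> 0" for u h
    using that by (auto simp: S_def H_cmult nrm_cmult ip_cmult_right norm_divide simp del:
        of_real_divide)
  obtain k0 where k0: "nrm M (g k0) \<noteq> 0" using ex_g by blast
  have S_ne: "S \<noteq> {}" using normalize[OF Hg _ k0] g_orth by blast
  have bdd: "bdd_below ((\<lambda>(u, h). Re (ip M u h)) ` S)"
    by (rule bdd_belowI[of _ "-b"]) (auto simp: S_def dest: H_lower)
  have min: "\<mu> * (nrm M u)\<^sup>2 \<le> Re (ip M u h)" if "H u h" "\<forall>j<n. ip M (\<psi> j) u = 0" for u h
  proof (cases "nrm M u = 0")
    case True
    then have "cmod (ip M u h) \<le> 0" using cauchy_schwarz[of u M h] H_l2[OF that(1)] by simp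
    then show ?thesis using True by simp
  next
    case False
    have "\<mu> \<le> Re (ip M (\<lambda>x. of_real (1 / nrm M u) * u x) (\<lambda>x. of_real (1 / nrm M u) * h x))"
      unfolding \<mu>_def using cINF_lower[OF bdd normalize[OF that False]] by simp
    also have "\<dots> = Re (ip M u h) / (nrm M u)\<^sup>2"
      unfolding ip_cmult_left ip_cmult_right by (simp add: power2_eq_square)
    finally show ?thesis using False by (simp add: field_simps)
  qed
  have "\<exists>p\<in>S. Re (ip M (fst p) (snd p)) < \<mu> + 1 / Suc m" for m
    using cINF_less_iff[OF S_ne bdd, of "\<mu> + 1 / Suc m"] by (auto simp: \<mu>_def split_beta)
  then obtain P where P: "\<And>m. P m \<in> S" "\<And>m. Re (ip M (fst (P m)) (snd (P m))) < \<mu> + 1 / Suc m" by metis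
  define u where "u m = fst (P m)" for m
  define h where "h m = snd (P m)" for m
  have u: "H (u m) (h m)" "nrm M (u m) = 1" "j < n
      \<Longrightarrow> ip M (\<psi> j) (u m) = 0" "Re (ip M (u m) (h m)) < \<mu> + 1 / Suc m" for m j
    using P[of m] by (auto simp: S_def u_def h_def split_beta)
  note uh [simp] = H_l2[OF u(1)]
  have "\<exists>r v. strict_mono (r :: nat \<Rightarrow> nat) \<and> v \<in> l2 M \<and> (\<lambda>n. nrm M (\<lambda>x. u (r n) x - v x)) \<longlonglongrightarrow> 0"
  proof (rule energy_compact)
    show "D (u m) (\<lambda>x. h m x - of_real (W x) * u m x)" for m by (rule H_energy(1)[OF u(1)])
    show "nrm M (u m) \<le> 1" for m using u(2)[of m] by simp
    show "Re (ip M (u m) (\<lambda>x. h m x - of_real (W x) * u m x)) \<le> \<mu> + 1 + b" for m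
    proof -
      have "1 / real (Suc m) \<le> 1" by simp
      then show ?thesis using H_energy(2)[OF u(1)[of m]] u(2)[of m] u(4)[of m]
        by (simp only: power_one mult_1_right)
    qed
  qed
  then obtain r v where r: "strict_mono (r :: nat \<Rightarrow> nat)" and v [simp]: "v \<in> l2 M"
    and lim: "(\<lambda>n. nrm M (\<lambda>x. u (r n) x - v x)) \<longlonglongrightarrow> 0" by blast
  have ip_lim: "(\<lambda>n. ip M f (u (r n))) \<longlonglongrightarrow> ip M f v" if f: "f \<in> l2 M" for f
  proof (rule LIM_zero_cancel, rule Lim_null_comparison)
    show "\<forall>\<^sub>F n in sequentially. norm (ip M f (u (r n)) - ip M f v)
        \<le> nrm M f * nrm M (\<lambda>x. u (r n) x - v x)"
      using cauchy_schwarz[OF f l2_diff[OF uh(1) v]] f by (simp add: ip_diff_right)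
    show "(\<lambda>n. nrm M f * nrm M (\<lambda>x. u (r n) x - v x)) \<longlonglongrightarrow> 0" by (rule tendsto_mult_right_zero[OF lim])
  qed
  have v_orth: "ip M (\<psi> j) v = 0" if "j < n" for j
    using ip_lim[OF psi[OF that]] u(3)[OF that] by (simp add: LIMSEQ_const_iff)
  have v_n: "nrm M v = 1"
  proof -
    have "norm (nrm M (u (r n)) - nrm M v) \<le> nrm M (\<lambda>x. u (r n) x - v x)" for n
      using nrm_triangle[of "\<lambda>x. u (r n) x - v x" M v] nrm_triangle[of "\<lambda>x. v x
          - u (r n) x" M "u (r n)"]
      by (auto simp: nrm_minus_commute[of M v])
    then have "(\<lambda>n. nrm M (u (r n)) - nrm M v) \<longlonglongrightarrow> 0"
      by (intro Lim_null_comparison[OF _ lim] always_eventually allI)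
    then show ?thesis by (simp add: u(2) LIMSEQ_const_iff)
  qed
  \<comment> \<open>At an almost minimizer the first variation \<open>B m\<close> along
    \<open>g'\<close> must be small, because \<open>u m\<close> exceeds the infimum by less than
    \<open>1 / Suc m\<close>. As \<open>h m\<close> need not converge, \<open>B_eq\<close> moves the
    operator onto \<open>g'\<close>, leaving only the convergent \<open>u m\<close>.\<close>
  have stationary: "ip M (\<lambda>x. q' x - of_real \<mu> * g' x) v = 0"
      if g': "H g' q'" "\<forall>j<n. ip M (\<psi> j) g' = 0" for g' q'
  proof -
    note gq [simp] = H_l2[OF g'(1)]
    define Q where "Q = Re (ip M g' q') - \<mu> * (nrm M g')\<^sup>2"
    have Q: "Q \<ge> 0" using min[OF g'] by (simp add: Q_def)
    define B where "B m = ip M g' (\<lambda>x. h m x - of_real \<mu> * u m x)" for m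
    have B_eq: "B m = ip M (\<lambda>x. q' x - of_real \<mu> * g' x) (u m)" for m
      unfolding B_def using H_symmetric[OF g'(1) u(1)[of m]] by (simp add: ip_simps)
    have B_le: "(cmod (B m))\<^sup>2 \<le> (Q + 1) * (1 / Suc m)" for m
    proof -
      \<comment> \<open>With the step length \<open>1 / (Q + 1)\<close> the second-order term is at
        most half of the gain \<open>2 * t * (cmod (B m))\<^sup>2\<close>, so that
        \<open>t * (cmod (B m))\<^sup>2\<close> is at most \<open>1 / Suc m\<close>. The phase of
        \<open>\<tau>\<close> makes both cross terms real and nonpositive.\<close>
      define t where "t = 1 / (Q + 1)"
      define \<tau> where "\<tau> = - of_real t * B m"
      have "\<mu> * (nrm M (\<lambda>x. u m x + \<tau> * g' x))\<^sup>2
          \<le> Re (ip M (\<lambda>x. u m x + \<tau> * g' x) (\<lambda>x. h m x + \<tau> * q' x))"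
        by (rule min) (use g' u in \<open>auto intro!: H_add H_cmult simp: ip_simps\<close>)
      moreover have "(nrm M (\<lambda>x. u m x + \<tau> * g' x))\<^sup>2
          = Re (ip M (\<lambda>x. u m x + \<tau> * g' x) (\<lambda>x. u m x + \<tau> * g' x))"
        by (subst ip_self) simp
      ultimately have "0 \<le> Re (ip M (\<lambda>x. u m x + \<tau> * g' x) (\<lambda>x. h m x + \<tau> * q' x) 
           - of_real \<mu> * ip M (\<lambda>x. u m x + \<tau> * g' x) (\<lambda>x. u m x + \<tau> * g' x))" by simp
      also have "ip M (\<lambda>x. u m x + \<tau> * g' x) (\<lambda>x. h m x + \<tau> * q' x) 
           - of_real \<mu> * ip M (\<lambda>x. u m x + \<tau> * g' x) (\<lambda>x. u m x + \<tau> * g' x)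
         = (ip M (u m) (h m) - of_real \<mu> * ip M (u m) (u m)) + cnj \<tau> * B m
           + \<tau> * (ip M (u m) q' - of_real \<mu> * ip M (u m) g')
               + \<tau> * cnj \<tau> * (ip M g' q' - of_real \<mu> * ip M g' g')"
        unfolding B_def by (simp add: ip_simps algebra_simps)
      also have "ip M (u m) q' - of_real \<mu> * ip M (u m) g' = cnj (B m)"
        unfolding B_eq ip_cnj by (simp add: ip_simps)
      also have "\<tau> * cnj (B m) = - of_real (t * (cmod (B m))\<^sup>2)"
        unfolding \<tau>_def of_real_mult complex_norm_square by simp
      also have "cnj \<tau> * B m = - of_real (t * (cmod (B m))\<^sup>2)"
        unfolding \<tau>_def of_real_mult complex_norm_square by simp
      also have "\<tau> * cnj \<tau> = of_real (t\<^sup>2 * (cmod (B m))\<^sup>2)"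
        unfolding \<tau>_def of_real_mult complex_norm_square by (simp add: power2_eq_square)
      finally have "0 \<le> (Re (ip M (u m) (h m)) - \<mu>) - 2 * t * (cmod (B m))\<^sup>2 + t\<^sup>2 * (cmod (B m))\<^sup>2 * Q"
        by (simp add: ip_self u(2) Q_def del: of_real_mult of_real_power)
      moreover have "t\<^sup>2 * Q \<le> t"
      proof -
        have "t * Q \<le> 1" "t \<ge> 0" using Q by (simp_all add: t_def)
        then show ?thesis using mult_left_mono[of "t * Q" 1 t]
            by (simp add: power2_eq_square mult.assoc)
      qed
      then have "t\<^sup>2 * (cmod (B m))\<^sup>2 * Q \<le> t * (cmod (B m))\<^sup>2"
        using mult_right_mono[of "t\<^sup>2 * Q" t "(cmod (B m))\<^sup>2"] by (simp add: ac_simps)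
      ultimately have "t * (cmod (B m))\<^sup>2 \<le> 1 / Suc m" using u(4)[of m] by linarith
      then show ?thesis using Q by (simp add: t_def field_simps)
    qed
    have "(\<lambda>m. (Q + 1) * (1 / Suc m)) \<longlonglongrightarrow> (Q + 1) * 0"
      by (intro tendsto_mult tendsto_const) (use LIMSEQ_inverse_real_of_nat in \<open>simp add:
          inverse_eq_divide\<close>)
    then have "(\<lambda>m. (Q + 1) * (1 / Suc m)) \<longlonglongrightarrow> 0" by simp
    moreover have "\<forall>\<^sub>F m in sequentially. norm ((cmod (B m))\<^sup>2) \<le> (Q + 1) * (1 / Suc m)"
      using B_le by (intro always_eventually allI) simp
    ultimately have "(\<lambda>m. (cmod (B m))\<^sup>2) \<longlonglongrightarrow> 0"
      by (rule Lim_null_comparison[rotated])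
    then have "(\<lambda>m. sqrt ((cmod (B m))\<^sup>2)) \<longlonglongrightarrow> sqrt 0" by (rule tendsto_real_sqrt)
    then have "B \<longlonglongrightarrow> 0" by (simp add: tendsto_norm_zero_iff)
    then have "(\<lambda>n. B (r n)) \<longlonglongrightarrow> 0" using r by (rule LIMSEQ_subseq_LIMSEQ[unfolded comp_def])
    then have "(\<lambda>n. ip M (\<lambda>x. q' x - of_real \<mu> * g' x) (u (r n))) \<longlonglongrightarrow> 0" unfolding B_eq .
    moreover have "(\<lambda>n. ip M (\<lambda>x. q' x - of_real \<mu> * g' x) (u (r n))) \<longlonglongrightarrow> ip M (\<lambda>x. q' x
        - of_real \<mu> * g' x) v"
      by (rule ip_lim) simp
    ultimately show ?thesis by (rule LIMSEQ_unique[rotated])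
  qed
  \<comment> \<open>The corrections in \<open>g k\<close> and \<open>q k\<close> are combinations of
    the \<open>\<psi> j\<close>, to which \<open>v\<close> is orthogonal. They drop out, and
    stationarity becomes the \<open>k\<close>-th coefficient of the eigenvalue equation.\<close>
  have "H v (\<lambda>x. of_real \<mu> * v x)"
    unfolding H_def
  proof (intro conjI allI)
    fix k
    have "0 = ip M (\<lambda>x. q k x - of_real \<mu> * g k x) v" using stationary[OF Hg] g_orth by simp
    also have "\<dots> = ip M (q k) v - of_real \<mu> * ip M (g k) v" using H_l2[OF Hg] by (simp add: ip_simps)
    also have "ip M (q k) v = of_real (nu k) * ip M (e k) v + ip M (\<lambda>x. of_real (W x) * e k x) v"
    proof -
      have "q k x = (of_real (nu k) * e k x + of_real (W x) * e k x)
          - (\<Sum>j<n. (c k j * of_real (E j)) * \<psi> j x)" for x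
        by (simp add: q_def mult.assoc)
      then have "q k = (\<lambda>x. (of_real (nu k) * e k x
          + of_real (W x) * e k x) - (\<Sum>j<n. (c k j * of_real (E j)) * \<psi> j x))" ..
      then show ?thesis by (simp add: ip_diff_left ip_add_left ip_cmult_left ip_psi_sum v_orth)
    qed
    also have "ip M (g k) v = ip M (e k) v" unfolding g_def
        by (simp add: ip_diff_left ip_psi_sum v_orth)
    finally show "ip M (e k) (\<lambda>x. of_real \<mu> * v x)
        = of_real (nu k) * ip M (e k) v + ip M (e k) (\<lambda>x. of_real (W x) * v x)"
      by (simp add: W_ip ip_cmult_right)
  qed simp_all
  then show ?thesis using v_n v_orth min by blast
qed


text \<open>Completeness of the eigenfunctions: the component \<open>g\<close> of \<open>e k\<close> orthogonal to the first \<open>n\<close> of them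
  satisfies \<open>E n * |g|\<^sup>2 \<le> (g, H (e k)) \<le> C * |g|\<close>, and \<open>E\<close> is unbounded by compactness.\<close>

lemma eigenbasis:
  shows "\<exists>(E :: nat \<Rightarrow> real) \<psi>. (\<forall>n. H (\<psi> n) (\<lambda>x. of_real (E n) * \<psi> n x)) \<and> orthonormal M \<psi> \<and> total M \<psi>"
proof -
  define P where "P f n r \<longleftrightarrow> H (fst r) (\<lambda>x. of_real (snd r) * fst r x) \<and> nrm M (fst r) = 1 \<and>
     (\<forall>j<n. ip M (fst (f j)) (fst r) = 0) \<and>
     (\<forall>u h. H u h \<longrightarrow> (\<forall>j<n. ip M (fst (f j)) u = 0) \<longrightarrow> snd r * (nrm M u)\<^sup>2 \<le> Re (ip M u h))"
    for f :: "nat \<Rightarrow> ('a \<Rightarrow> complex) \<times> real" and n :: nat and r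
  have on: "ip M (fst (f i)) (fst (f j)) = (if i = j then 1 else 0)"
    if f: "P f i (f i)" "P f j (f j)" for f i j
  proof -
    consider "i = j" | "i < j" | "j < i" by linarith
    then show ?thesis
    proof cases
      case 1
      then show ?thesis using f by (simp add: P_def ip_self)
    next
      case 2
      then show ?thesis using f by (simp add: P_def)
    next
      case 3
      then have "ip M (fst (f j)) (fst (f i)) = 0" using f by (simp add: P_def)
      then show ?thesis using 3 ip_cnj[of M "fst (f j)" "fst (f i)"] by simp
    qed
  qed
  have "\<exists>f. \<forall>n. P f n (f n)"
  \<comment> \<open>\<open>P f n\<close> looks at \<open>f\<close> only below \<open>n\<close>, so
    each eigenpair can be chosen from the preceding ones.\<close>
  proof (rule dependent_wellorder_choice)
    fix r :: "('a \<Rightarrow> complex) \<times> real" and f g :: "nat \<Rightarrow> ('a \<Rightarrow> complex) \<times> real" and n :: nat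
    assume "\<And>y. y < n \<Longrightarrow> f y = g y"
    then show "P f n r = P g n r" by (simp add: P_def)
  next
    fix n :: nat and f :: "nat \<Rightarrow> ('a \<Rightarrow> complex) \<times> real"
    assume f: "\<And>y. y < n \<Longrightarrow> P f y (f y)"
    have "\<exists>p \<mu>. H p (\<lambda>x. of_real \<mu> * p x) \<and> nrm M p = 1 \<and> (\<forall>j<n. ip M (fst (f j)) p = 0) \<and>
     (\<forall>u h. H u h \<longrightarrow> (\<forall>j<n. ip M (fst (f j)) u = 0) \<longrightarrow> \<mu> * (nrm M u)\<^sup>2 \<le> Re (ip M u h))"
    proof (rule next_eigenvector)
      show "H (fst (f j)) (\<lambda>x. of_real (snd (f j)) * fst (f j) x)" if "j < n" for j
        using f[OF that] by (simp add: P_def)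
      show "ip M (fst (f i)) (fst (f j)) = (if i = j then 1 else 0)" if "i < n" "j < n" for i j
        using that f by (intro on) auto
    qed
    then obtain p \<mu> where "P f n (p, \<mu>)" unfolding P_def by auto
    then show "\<exists>r. P f n r" by blast
  qed
  then obtain f where f: "\<And>n. P f n (f n)" by blast
  define \<psi> where "\<psi> n = fst (f n)" for n
  define E where "E n = snd (f n)" for n
  have eig: "H (\<psi> n) (\<lambda>x. of_real (E n) * \<psi> n x)" and n1: "nrm M (\<psi> n) = 1" for n
    using f[of n] by (auto simp: P_def \<psi>_def E_def)
  have min: "E n * (nrm M u)\<^sup>2 \<le> Re (ip M u h)" if "H u h" "\<And>j. j < n \<Longrightarrow> ip M (\<psi> j) u = 0" for n u h
    using f[of n] that by (auto simp: P_def \<psi>_def E_def)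
  have psi_on: "ip M (\<psi> i) (\<psi> j) = (if i = j then 1 else 0)" for i j
    unfolding \<psi>_def by (rule on[OF f f])
  note psi [simp] = H_l2(1)[OF eig]
  have onb: "orthonormal M \<psi>" by (simp add: orthonormal_def psi_on)
  \<comment> \<open>Distinct eigenvectors are at distance \<open>sqrt 2\<close>, so no subsequence
    converges; bounded eigenvalues would contradict \<open>energy_compact\<close>.\<close>
  have unbounded: "\<exists>n. E n > C" for C
  proof (rule ccontr)
    assume "\<not> (\<exists>n. E n > C)"
    then have EC: "E n \<le> C" for n by (simp add: not_less)
    have "\<exists>r v. strict_mono (r :: nat \<Rightarrow> nat) \<and> v \<in> l2 M \<and> (\<lambda>n. nrm M (\<lambda>x. \<psi> (r n) x - v x)) \<longlonglongrightarrow> 0"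
    proof (rule energy_compact)
      show "D (\<psi> n) (\<lambda>x. of_real (E n) * \<psi> n x - of_real (W x) * \<psi> n x)" for n
          by (rule H_energy(1)[OF eig])
      show "Re (ip M (\<psi> n) (\<lambda>x. of_real (E n) * \<psi> n x - of_real (W x) * \<psi> n x)) \<le> C + b" for n
      proof -
        have "ip M (\<psi> n) (\<lambda>x. of_real (E n) * \<psi> n x) = of_real (E n)"
            by (simp add: ip_cmult_right psi_on)
        then show ?thesis using H_energy(2)[OF eig[of n]] EC[of n] n1[of n] by simp
      qed
    qed (simp add: n1)
    then obtain r v where r: "strict_mono (r :: nat \<Rightarrow> nat)" and v [simp]: "v \<in> l2 M"
      and lim: "(\<lambda>n. nrm M (\<lambda>x. \<psi> (r n) x - v x)) \<longlonglongrightarrow> 0" by blast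
    have "\<forall>\<^sub>F n in sequentially. nrm M (\<lambda>x. \<psi> (r n) x - v x) < 1/2"
      using lim by (rule order_tendstoD) simp
    then obtain N where N: "\<And>n. n \<ge> N \<Longrightarrow> nrm M (\<lambda>x. \<psi> (r n) x - v x) < 1/2"
        by (auto simp: eventually_sequentially)
    have "r N \<noteq> r (Suc N)" using r by (simp add: strict_mono_eq)
    then have "(nrm M (\<lambda>x. \<psi> (r N) x - \<psi> (r (Suc N)) x))\<^sup>2 = 2"
      by (subst nrm_sq_diff) (auto simp: n1 psi_on)
    moreover have "nrm M (\<lambda>x. \<psi> (r N) x - \<psi> (r (Suc N)) x) \<le> 1"
      using nrm_triangle_mid[of "\<psi> (r N)" M v "\<psi> (r (Suc N))"] N[of N] N[of "Suc N"]
          by (simp add: nrm_minus_commute[of M v])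
    then have "(nrm M (\<lambda>x. \<psi> (r N) x - \<psi> (r (Suc N)) x))\<^sup>2 \<le> 1\<^sup>2" by (intro power_mono) auto
    ultimately show False by simp
  qed
  have "total M \<psi>"
    unfolding total_def
  proof (intro ballI impI)
    fix g assume g [simp]: "g \<in> l2 M" and g0: "\<forall>n. ip M (\<psi> n) g = 0"
    \<comment> \<open>By totality of \<open>e\<close> it suffices to test against basis vectors;
      these lie in the domain of the operator, which an arbitrary \<open>g\<close> need not.\<close>
    have "ip M (e k) g = 0" for k
    proof (rule ccontr)
      assume ne: "ip M (e k) g \<noteq> 0"
      define he where "he = (\<lambda>x. of_real (nu k) * e k x + of_real (W x) * e k x)"
      have He: "H (e k) he" unfolding he_def by (rule H_basis)
      note [simp] = H_l2(2)[OF He]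
      obtain n where n: "E n > nrm M he * nrm M g / cmod (ip M (e k) g)" using unbounded by blast
      then have En: "E n > 0" by (rule le_less_trans[rotated]) simp
      define u where "u x = e k x - (\<Sum>j<n. ip M (\<psi> j) (e k) * \<psi> j x)" for x
      define h where "h x = he x - (\<Sum>j<n. ip M (\<psi> j) (e k) * (of_real (E j) * \<psi> j x))" for x
      have Hu: "H u h" unfolding u_def h_def by (intro H_diff He H_sum H_cmult eig)
      note [simp] = H_l2[OF Hu]
      have u_orth: "ip M (\<psi> j) u = 0" if "j < n" for j
        unfolding u_def using that by (simp add: ip_diff_right basis_sum_l2[OF onb] ip_basis_sum[OF
            onb])
      then have u_orth': "ip M u (\<psi> j) = 0" if "j < n" for j
        using that by (metis ip_cnj complex_cnj_zero)
      have "ip M u h = ip M u he - (\<Sum>j<n. ip M (\<psi> j) (e k) * (of_real (E j) * ip M u (\<psi> j)))"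
        unfolding h_def by (subst ip_diff_right) (auto simp: ip_sum_right ip_cmult_right)
      also have "\<dots> = ip M u he" by (simp add: u_orth')
      finally have "E n * (nrm M u)\<^sup>2 \<le> nrm M u * nrm M he"
        using min[of u h n] Hu u_orth cauchy_schwarz[of u M he] complex_Re_le_cmod[of "ip M u he"]
            by simp
      then have *: "nrm M u = 0 \<or> E n * nrm M u \<le> nrm M he"
        using nrm_nonneg[of M u]
        by (cases "nrm M u = 0") (auto simp: power2_eq_square mult.left_commute[of "E n"]
            mult_le_cancel_left simp del: nrm_nonneg)
      have "ip M u g = ip M (e k) g - (\<Sum>j<n. cnj (ip M (\<psi> j) (e k)) * ip M (\<psi> j) g)"
        unfolding u_def by (subst ip_diff_left) (auto simp: ip_sum_left ip_cmult_left
            basis_sum_l2[OF onb])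
      then have "ip M u g = ip M (e k) g" by (simp add: g0)
      then have le: "cmod (ip M (e k) g) \<le> nrm M u * nrm M g" using cauchy_schwarz[of u M g] by simp
      then have "nrm M u \<noteq> 0" using ne by auto
      with * have "E n * nrm M u * nrm M g \<le> nrm M he * nrm M g" by (intro mult_right_mono) auto
      then have "E n * cmod (ip M (e k) g) \<le> nrm M he * nrm M g"
        using mult_left_mono[OF le, of "E n"] En unfolding mult.assoc by linarith
      then show False using n ne by (simp add: field_simps)
    qed
    then show "AE x in M. g x = 0" using tot g unfolding total_def by blast
  qed
  then show ?thesis using eig onb by blast
qed

text \<open>Finite combinations of the \<open>e k\<close> form a core. The equation is solved
  exactly for a finite eigenfunction expansion \<open>s\<close> of \<open>\<phi>\<close>; then the
  solution \<open>u\<close> and its image \<open>w\<close> under the unperturbed operator are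
  truncated to the same finite set \<open>K\<close>. As the coefficients of \<open>w\<close> are
  \<open>nu k\<close> times those of \<open>u\<close>, the truncated \<open>w\<close> is the image
  of the truncated \<open>u\<close>.\<close>

lemma dense_range:
  assumes phi [simp]: "\<phi> \<in> l2 M" and z: "Im z \<noteq> 0" and eps: "\<epsilon> > 0"
  shows "\<exists>K c. finite K \<and>
    nrm M (\<lambda>x. (\<Sum>k\<in>K. of_real (nu k) * c k * e k x) + of_real (W x) * (\<Sum>k\<in>K. c k * e k x)
       - z * (\<Sum>k\<in>K. c k * e k x) - \<phi> x) < \<epsilon>"
proof -
  obtain E :: "nat \<Rightarrow> real" and \<psi> where eig: "\<And>n. H (\<psi> n) (\<lambda>x. of_real (E n) * \<psi> n x)"
    and onb: "orthonormal M \<psi>" and totb: "total M \<psi>" using eigenbasis by blast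
  define c where "c n = ip M (\<psi> n) \<phi>" for n
  have "\<forall>\<^sub>F J in finite_subsets_at_top UNIV. nrm M (\<lambda>x. \<phi> x - (\<Sum>j\<in>J. c j * \<psi> j x)) < \<epsilon> / 2"
    unfolding c_def by (rule order_tendstoD(2)[OF projection_tendsto[OF onb totb phi]]) (use eps in
        simp)
  then obtain J where J: "finite J" "nrm M (\<lambda>x. \<phi> x - (\<Sum>j\<in>J. c j * \<psi> j x)) < \<epsilon> / 2"
    unfolding eventually_finite_subsets_at_top by blast
  define s where "s x = (\<Sum>j\<in>J. c j * \<psi> j x)" for x
  have s [simp]: "s \<in> l2 M" unfolding s_def by (rule basis_sum_l2[OF onb])
  have Ez: "of_real (E j) - z \<noteq> 0" for j using z by (auto simp: complex_eq_iff)
  define u where "u x = (\<Sum>j\<in>J. (c j / (of_real (E j) - z)) * \<psi> j x)" for x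
  define h where "h x = (\<Sum>j\<in>J. (c j / (of_real (E j) - z)) * (of_real (E j) * \<psi> j x))" for x
  have Hu: "H u h" unfolding u_def h_def by (intro H_sum H_cmult eig)
  define w where "w x = h x - of_real (W x) * u x" for x
  have Du: "D u w" unfolding w_def[abs_def] by (rule H_energy(1)[OF Hu])
  note [simp] = D_l2[OF Du]
  have s_eq: "w x + of_real (W x) * u x - z * u x = s x" for x
  proof -
    have "w x + of_real (W x) * u x - z * u x
        = (\<Sum>j\<in>J. (c j / (of_real (E j) - z)) * (of_real (E j) - z) * \<psi> j x)"
    proof -
      have "w x + of_real (W x) * u x - z * u x = h x - z * u x" by (simp add: w_def)
      also have "\<dots> = (\<Sum>j\<in>J. (c j / (of_real (E j) - z)) * (of_real (E j) * \<psi> j x)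
          - z * ((c j / (of_real (E j) - z)) * \<psi> j x))"
        by (simp add: h_def u_def sum_distrib_left sum_subtractf)
      also have "\<dots> = (\<Sum>j\<in>J. (c j / (of_real (E j) - z)) * (of_real (E j) - z) * \<psi> j x)"
        by (intro sum.cong refl) (simp only: ring_distribs mult.assoc mult.left_commute)
      finally show ?thesis .
    qed
    then show ?thesis using Ez by (simp add: s_def)
  qed
  \<comment> \<open>An error in \<open>w\<close> enters the residual with weight one, an error in
    \<open>u\<close> with weight at most \<open>b + cmod z\<close>.\<close>
  define \<delta> where "\<delta> = \<epsilon> / (2 * (1 + b + cmod z))"
  have pos: "1 + b + cmod z > 0" using b_nonneg norm_ge_zero[of z] by linarith
  have \<delta>: "\<delta> > 0" using eps pos by (simp add: \<delta>_def)
  have "\<forall>\<^sub>F K in finite_subsets_at_top UNIV. nrm M (\<lambda>x. u x - (\<Sum>k\<in>K. ip M (e k) u * e k x)) < \<delta> \<and>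
      nrm M (\<lambda>x. w x - (\<Sum>k\<in>K. ip M (e k) w * e k x)) < \<delta>"
    by (intro eventually_conj order_tendstoD(2)[OF projection_tendsto[OF orth tot]]) (use \<delta> in simp_all)
  then obtain K where K: "finite K" "nrm M (\<lambda>x. u x - (\<Sum>k\<in>K. ip M (e k) u * e k x)) < \<delta>"
      "nrm M (\<lambda>x. w x - (\<Sum>k\<in>K. ip M (e k) w * e k x)) < \<delta>"
    unfolding eventually_finite_subsets_at_top by blast
  define t where "t x = (\<Sum>k\<in>K. ip M (e k) u * e k x)" for x
  define wt where "wt x = (\<Sum>k\<in>K. of_real (nu k) * ip M (e k) u * e k x)" for x
  have [simp]: "t \<in> l2 M" "wt \<in> l2 M" unfolding t_def wt_def by (rule basis_sum_l2[OF orth])+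
  have tn: "nrm M (\<lambda>x. u x - t x) < \<delta>" "nrm M (\<lambda>x. w x - wt x) < \<delta>"
    using K by (simp_all add: t_def wt_def D_ip[OF Du])
  define d where "d x = u x - t x" for x
  have [simp]: "d \<in> l2 M" unfolding d_def by simp
  have "nrm M (\<lambda>x. s x - (wt x + of_real (W x) * t x - z * t x))
      = nrm M (\<lambda>x. (w x - wt x) + (of_real (W x) * d x - z * d x))"
    unfolding s_eq[symmetric] d_def by (simp add: algebra_simps)
  also have "\<dots> \<le> nrm M (\<lambda>x. w x - wt x) + nrm M (\<lambda>x. of_real (W x) * d x - z * d x)"
    by (rule nrm_triangle) auto
  also have "nrm M (\<lambda>x. of_real (W x) * d x - z * d x)
      \<le> nrm M (\<lambda>x. of_real (W x) * d x) + nrm M (\<lambda>x. z * d x)"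
    by (rule nrm_triangle_diff) auto
  also have "\<dots> \<le> b * nrm M d + cmod z * nrm M d" using W_nrm[of d] by (simp add: nrm_cmult)
  also have "\<dots> \<le> b * \<delta> + cmod z * \<delta>"
    using tn b_nonneg unfolding d_def by (intro add_mono mult_left_mono) auto
  finally have "nrm M (\<lambda>x. s x - (wt x + of_real (W x) * t x - z * t x)) < (1 + b + cmod z) * \<delta>"
    using tn(2) by (simp add: algebra_simps)
  also have "\<dots> = \<epsilon> / 2"
  proof -
    have "p * (\<epsilon> / (2 * p)) = \<epsilon> / 2" if "p > 0" for p :: real using that by simp
    then show ?thesis unfolding \<delta>_def using pos by blast
  qed
  finally have "nrm M (\<lambda>x. (wt x + of_real (W x) * t x - z * t x) - \<phi> x) < \<epsilon>"
    using nrm_triangle_mid[of "\<lambda>x. wt x + of_real (W x) * t x - z * t x" M s \<phi>] J(2)[folded s_def]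
      nrm_minus_commute[of M s \<phi>] nrm_minus_commute[of M s "\<lambda>x. wt x + of_real (W x) * t x - z * t x"]
    by simp
  then show ?thesis using K(1) unfolding t_def wt_def
    by (intro exI[of _ K] exI[of _ "\<lambda>k. ip M (e k) u"] conjI)
qed

text \<open>Both bounds come from pairing the residual with \<open>t\<close>. The imaginary part
  sees only \<open>z\<close> and gives the resolvent bound; the real part isolates the kinetic
  energy, that is, the squared gradient norm of \<open>t\<close> in the application to
  waves.\<close>

lemma residual_bounds:
  fixes c :: "'k \<Rightarrow> complex" and z :: complex
  assumes K: "finite K"
  defines "t \<equiv> \<lambda>x. \<Sum>k\<in>K. c k * e k x" and "w \<equiv> \<lambda>x. \<Sum>k\<in>K. of_real (nu k) * c k * e k x"
  defines "r \<equiv> nrm M (\<lambda>x. w x + of_real (W x) * t x - z * t x)"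
  shows "\<bar>Im z\<bar> * nrm M t \<le> r"
    and "(\<Sum>k\<in>K. nu k * (cmod (c k))\<^sup>2) \<le> nrm M t * r + (b + cmod z) * (nrm M t)\<^sup>2"
proof -
  have [simp]: "t \<in> l2 M" "w \<in> l2 M" unfolding t_def w_def by (rule basis_sum_l2[OF orth])+
  have tw: "ip M t w = of_real (\<Sum>k\<in>K. nu k * (cmod (c k))\<^sup>2)"
  proof -
    have "ip M t w = (\<Sum>k\<in>K. cnj (c k) * (of_real (nu k) * c k))"
      unfolding t_def by (subst ip_sum_left) (auto simp: ip_cmult_left w_def ip_basis_sum[OF orth K]
          basis_sum_l2[OF orth])
    also have "\<dots> = of_real (\<Sum>k\<in>K. nu k * (cmod (c k))\<^sup>2)"
      unfolding of_real_sum of_real_mult complex_norm_square by (simp add: ac_simps)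
    finally show ?thesis .
  qed
  have wim: "Im (ip M t (\<lambda>x. of_real (W x) * t x)) = 0"
    using W_ip[of t t] ip_cnj[of M "\<lambda>x. of_real (W x) * t x" t] by (metis cnj.simps(2) equal_neg_zero)
  define \<rho> where "\<rho> = ip M t (\<lambda>x. w x + of_real (W x) * t x - z * t x)"
  have rho: "\<rho> = ip M t w + ip M t (\<lambda>x. of_real (W x) * t x) - z * of_real ((nrm M t)\<^sup>2)"
    unfolding \<rho>_def by (simp add: ip_simps ip_self)
  have rho_le: "cmod \<rho> \<le> nrm M t * r" unfolding \<rho>_def r_def by (rule cauchy_schwarz) auto
  have "Im \<rho> = - (Im z * (nrm M t)\<^sup>2)" unfolding rho
      by (simp add: tw wim del: of_real_power of_real_sum)
  then have "\<bar>Im z\<bar> * (nrm M t)\<^sup>2 \<le> nrm M t * r"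
    using abs_Im_le_cmod[of \<rho>] rho_le by (simp add: abs_mult)
  then have "nrm M t * (\<bar>Im z\<bar> * nrm M t) \<le> nrm M t * r" by (simp add: power2_eq_square ac_simps)
  moreover have "r \<ge> 0" by (simp add: r_def)
  ultimately show "\<bar>Im z\<bar> * nrm M t \<le> r"
  proof (cases "nrm M t = 0")
    case False
    then have "0 < nrm M t" using nrm_nonneg[of M t] by linarith
    with \<open>nrm M t * (\<bar>Im z\<bar> * nrm M t) \<le> nrm M t * r\<close> show ?thesis by (rule mult_left_le_imp_le)
  qed simp
  have "(\<Sum>k\<in>K. nu k * (cmod (c k))\<^sup>2) = Re \<rho> - Re (ip M t (\<lambda>x. of_real (W x) * t x))
      + Re z * (nrm M t)\<^sup>2"
    unfolding rho by (simp add: tw del: of_real_power of_real_sum)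
  also have "\<dots> \<le> nrm M t * r + b * (nrm M t)\<^sup>2 + cmod z * (nrm M t)\<^sup>2"
    using rho_le complex_Re_le_cmod[of \<rho>] W_ip_bound[OF \<open>t \<in> l2 M\<close>] mult_right_mono[OF
        complex_Re_le_cmod[of z] zero_le_power2[of "nrm M t"]]
    by linarith
  finally show "(\<Sum>k\<in>K. nu k * (cmod (c k))\<^sup>2) \<le> nrm M t * r + (b + cmod z) * (nrm M t)\<^sup>2"
    by (simp add: algebra_simps)
qed

end

section \<open>Fourier series on the torus\<close>

text \<open>Restricting the measure, rather than cutting functions off, makes the box an instance of
  the abstract theory.\<close>

abbreviation LB :: "real \<Rightarrow> (real^'n) measure" where
  "LB L \<equiv> lebesgue_on (box_L L)"

definition wave :: "real \<Rightarrow> int^'n \<Rightarrow> real^'n \<Rightarrow> complex" where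
  "wave L k x = exp (2 * complex_of_real pi * \<i> * complex_of_real (dual_pt L k \<bullet> x))"

definition nwave :: "real \<Rightarrow> int^'n \<Rightarrow> real^'n \<Rightarrow> complex" where
  "nwave L k x = of_real (1 / sqrt (L ^ CARD('n))) * wave L k x"

lemma box_L_borel [measurable]: "box_L L \<in> sets (borel :: (real^'n) measure)"
  unfolding box_L_def by measurable

lemma box_L_lebesgue [simp, measurable]: "box_L L \<in> sets (lebesgue :: (real^'n) measure)"
  by simp

lemma space_LB [simp]: "space (LB L :: (real^'n) measure) = box_L L"
  by simp

lemma box_L_subset_cbox: "box_L L \<subseteq> (cbox (\<chi> i. - L / 2) (\<chi> i. L / 2) :: (real^'n) set)"
  by (auto simp: box_L_def mem_box_cart less_imp_le)

lemma bounded_box_L: "bounded (box_L L :: (real^'n) set)"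
  by (rule bounded_subset[OF bounded_cbox box_L_subset_cbox])

lemma finite_measure_LB: "finite_measure (LB L :: (real^'n) measure)"
proof
  have "box_L L \<in> lmeasurable" by (rule bounded_set_imp_lmeasurable[OF bounded_box_L]) simp
  then show "emeasure (LB L) (space (LB L :: (real^'n) measure)) \<noteq> \<infinity>"
    by (simp add: emeasure_restrict_space fmeasurable_def less_top)
qed

lemma borel_imp_LB_measurable: "f \<in> borel_measurable borel
    \<Longrightarrow> f \<in> borel_measurable (LB L :: (real^'n) measure)"
  by (rule measurable_restrict_space1) (simp add: measurable_completion)

lemma ip_L_eq: "ip_L L f g = ip (LB L) f g"
  unfolding ip_L_def ip_def by (subst integral_restrict_space) (simp_all add: set_lebesgue_integral_def)

lemma L2_L_iff: "L2_L L f \<longleftrightarrow> f \<in> l2 (LB L)"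
  by (simp add: L2_L_def l2_def borel_measurable_restrict_space_iff integrable_restrict_space
      set_integrable_def)

lemma cnj_wave: "cnj (wave L k x) = exp (- (2 * complex_of_real pi * \<i> * complex_of_real (dual_pt L
    k \<bullet> x)))"
  unfolding wave_def exp_cnj by simp

text \<open>The operator is defined through unnormalized exponentials; the nonzero factor relating
  the two conventions cancels from the eigenvalue equation.\<close>

lemma fcoef_eq:
  fixes k :: "int^'n"
  assumes "L > 0"
  shows "fcoef L f k = of_real (sqrt (L ^ CARD('n))) * ip (LB L) (nwave L k) f"
proof -
  have "ip (LB L) (nwave L k) f = of_real (1 / sqrt (L ^ CARD('n))) * (LINT x|LB L. cnj (wave L k x)
      * f x)"
    unfolding nwave_def ip_cmult_left[of "LB L"] by (simp add: ip_def)
  also have "(LINT x|LB L. cnj (wave L k x) * f x) = fcoef L f k"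
    unfolding fcoef_def cnj_wave by (subst integral_restrict_space) (simp_all add:
        set_lebesgue_integral_def)
  finally show ?thesis using assms by simp
qed

lemma norm_wave [simp]: "cmod (wave L k x) = 1"
  by (simp add: wave_def)

lemma continuous_on_wave [continuous_intros]: "continuous_on S (wave L k)"
  unfolding wave_def[abs_def] by (intro continuous_intros)

lemma wave_measurable [measurable]: "wave L k \<in> borel_measurable borel"
  by (rule borel_measurable_continuous_onI[OF continuous_on_wave])

lemma wave_mult: "wave L k x * wave L l x = wave L (k + l) x"
  by (simp add: wave_def dual_pt_def inner_vec_def add_divide_distrib flip: exp_add sum.distrib)
     (simp add: algebra_simps sum.distrib sum_distrib_left)

lemma wave_cnj: "cnj (wave L k x) = wave L (- k) x"
  by (simp add: cnj_wave) (simp add: wave_def dual_pt_def inner_vec_def sum_negf)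

lemma l2_bounded_LB:
  assumes "f \<in> borel_measurable (LB L :: (real^'n) measure)" "\<And>x. x \<in> box_L L \<Longrightarrow> cmod (f x) \<le> b"
  shows "f \<in> l2 (LB L)"
proof (rule l2_bound[OF assms(1)])
  interpret finite_measure "LB L :: (real^'n) measure" by (rule finite_measure_LB)
  show "integrable (LB L :: (real^'n) measure) (\<lambda>x. b\<^sup>2)" by simp
qed (use assms in \<open>auto intro!: power_mono\<close>)

lemma nwave_l2: "nwave L k \<in> l2 (LB L)"
proof (rule l2_bounded_LB)
  show "nwave L k \<in> borel_measurable (LB L)"
    unfolding nwave_def[abs_def] by (intro borel_imp_LB_measurable) measurable
  show "cmod (nwave L k x) \<le> cmod (of_real (1 / sqrt (L ^ CARD('a))))" for x :: "real^'a"
    by (simp add: nwave_def norm_mult norm_divide)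
qed

text \<open>Fubini for product integrands. \<open>lborel_eq\<close> presents Lebesgue measure as the
  image of a product measure over \<open>Basis\<close>, and \<open>j\<close> translates basis
  vectors back into coordinate indices.\<close>

lemma integral_lborel_prod_cart:
  fixes f :: "'n::finite \<Rightarrow> real \<Rightarrow> complex"
  assumes "\<And>i. integrable lborel (f i)"
  shows "(LINT x|lborel. (\<Prod>i\<in>UNIV. f i (x $ i))) = (\<Prod>i\<in>UNIV. LINT t|lborel. f i t)"
proof -
  interpret product_sigma_finite "\<lambda>_::real^'n. lborel :: real measure" ..
  have bij: "bij_betw (\<lambda>i. axis i (1::real)) (UNIV :: 'n set) (Basis :: (real^'n) set)"
    by (auto simp: bij_betw_def inj_on_def axis_eq_axis Basis_vec_def)
  define j where "j b = (THE i. b = axis i (1::real))" for b :: "real^'n"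
  have j: "j (axis i 1) = i" for i by (auto simp: j_def axis_eq_axis)
  have fm [measurable]: "f i \<in> borel_measurable borel" for i
      using borel_measurable_integrable[OF assms[of i]] by simp
  have nth: "(\<Sum>b\<in>Basis. g b *\<^sub>R b) $ i = g (axis i 1)" for g :: "real^'n \<Rightarrow> real" and i
  proof -
    have "(\<Sum>b\<in>Basis. g b *\<^sub>R b) $ i = (\<Sum>b\<in>Basis. g b *\<^sub>R b) \<bullet> axis i 1" by (simp add: inner_axis)
    also have "\<dots> = g (axis i 1)" by (rule inner_sum_left_Basis) (auto simp: Basis_vec_def)
    finally show ?thesis .
  qed
  have "(LINT x|lborel. (\<Prod>i\<in>UNIV. f i (x $ i))) =
      (LINT g|Pi\<^sub>M Basis (\<lambda>_. lborel). (\<Prod>i\<in>UNIV. f i ((\<Sum>b\<in>Basis. g b *\<^sub>R b :: real^'n) $ i)))"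
    by (subst lborel_eq) (rule integral_distr; measurable)
  also have "\<dots> = (LINT g|Pi\<^sub>M Basis (\<lambda>_. lborel). (\<Prod>b\<in>Basis. f (j b) (g b)))"
    unfolding nth by (intro Bochner_Integration.integral_cong refl)
      (subst prod.reindex_bij_betw[OF bij, symmetric], simp add: j)
  also have "\<dots> = (\<Prod>b\<in>(Basis :: (real^'n) set). LINT t|lborel. f (j b) t)"
    by (rule product_integral_prod) (auto intro: assms)
  also have "\<dots> = (\<Prod>i\<in>UNIV. LINT t|lborel. f i t)"
    by (subst prod.reindex_bij_betw[OF bij, symmetric]) (simp add: j)
  finally show ?thesis .
qed

lemma integral_exp_period:
  assumes L: "L > 0"
  shows "(LINT t|lborel. indicator {-L/2..<L/2} t *\<^sub>R exp (2 * complex_of_real pi * \<i> * of_real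
      (of_int m / L * t))) = (if m = 0 then of_real L else 0)"
    (is "(LINT t|lborel. _ *\<^sub>R ?f t) = _")
    "integrable lborel (\<lambda>t. indicator {-L/2..<L/2} t *\<^sub>R exp (2 * complex_of_real pi * \<i> * of_real
        (of_int m / L * t)))"
proof -
  have cont: "continuous_on {-L/2..L/2} ?f" by (intro continuous_intros) (use L in auto)
  have "set_integrable lborel {-L/2..L/2} ?f" by (rule borel_integrable_atLeastAtMost') (rule cont)
  then show int: "integrable lborel (\<lambda>t. indicator {-L/2..<L/2} t *\<^sub>R ?f t)"
    unfolding set_integrable_def[symmetric] by (rule set_integrable_subset) auto
  have eq: "(LINT t|lborel. indicator {-L/2..<L/2} t *\<^sub>R ?f t)
      = (LINT t|lborel. indicator {-L/2..L/2} t *\<^sub>R ?f t)"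
  proof (rule integral_cong_AE)
    show "AE t in lborel. indicator {-L/2..<L/2} t *\<^sub>R ?f t = indicator {-L/2..L/2} t *\<^sub>R ?f t"
      using AE_lborel_singleton[of "L/2"] by eventually_elim (auto simp: indicator_def)
  qed measurable
  show "(LINT t|lborel. indicator {-L/2..<L/2} t *\<^sub>R ?f t) = (if m = 0 then of_real L else 0)"
  proof (cases "m = 0")
    case True
    have "(LINT t|lborel. indicator {-L/2..L/2} t *\<^sub>R ?f t)
        = (LINT t|lborel. indicator {-L/2..L/2} t *\<^sub>R (1::complex))"
      using True by simp
    also have "\<dots> = of_real L" using L by (simp add: scaleR_conv_of_real)
    finally show ?thesis using True eq by simp
  next
    case False
    define c where "c = 2 * complex_of_real pi * \<i> * of_real (of_int m / L)"
    have c: "c \<noteq> 0" using False L by (simp add: c_def)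
    have f: "?f t = exp (c * of_real t)" for t by (simp add: c_def mult.assoc)
    have "(LINT t|lborel. indicator {-L/2..L/2} t *\<^sub>R ?f t)
        = exp (c * of_real (L/2)) / c - exp (c * of_real (-L/2)) / c"
      unfolding f
    proof (rule integral_FTC_Icc)
      show "((\<lambda>t. exp (c * of_real t) / c) has_vector_derivative exp (c * of_real t)) (at t within
          {-L/2..L/2})" for t
        using c by (auto intro!: derivative_eq_intros has_vector_derivative_real_field)
    qed (use L in \<open>auto intro!: continuous_intros\<close>)
    also have "exp (c * of_real (L/2)) = exp (c * of_real (-L/2) + 2 * of_int m * of_real pi * \<i>)"
      using L by (simp add: c_def field_simps)
    also have "\<dots> = exp (c * of_real (-L/2))"
      unfolding exp_add using exp_eq_1[of "2 * of_int m * of_real pi * \<i>"]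
          by (simp add: exp_integer_2pi mult.commute mult.left_commute)
    finally show ?thesis using False eq by simp
  qed
qed

lemma integral_wave:
  fixes k :: "int^'n"
  assumes L: "L > 0"
  shows "(LINT x|LB L. wave L k x) = (if k = 0 then of_real (L ^ CARD('n)) else 0)"
proof -
  let ?f = "\<lambda>i t. indicator {-L/2..<L/2} t *\<^sub>R exp (2 * complex_of_real pi * \<i> * of_real (of_int (k
      $ i) / L * t))"
  have "(LINT x|LB L. wave L k x) = (LINT x|lebesgue. indicator (box_L L) x *\<^sub>R wave L k x)"
    by (subst integral_restrict_space) (simp_all add: set_lebesgue_integral_def)
  also have "\<dots> = (LINT x|lborel. indicator (box_L L) x *\<^sub>R wave L k x)"
    by (rule integral_completion) measurable
  also have "\<dots> = (LINT x|lborel. (\<Prod>i\<in>UNIV. ?f i (x $ i)))"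
  proof (intro Bochner_Integration.integral_cong refl)
    fix x :: "real^'n"
    have "indicator (box_L L) x = (\<Prod>i\<in>UNIV. indicator {-L/2..<L/2} (x $ i) :: real)"
      by (auto simp: box_L_def indicator_def prod_zero_iff)
    moreover have "wave L k x = (\<Prod>i\<in>UNIV. exp (2 * complex_of_real pi * \<i> * of_real (of_int (k $ i)
        / L * x $ i)))"
      by (simp add: wave_def dual_pt_def inner_vec_def sum_distrib_left flip: exp_sum)
    ultimately show "indicator (box_L L) x *\<^sub>R wave L k x = (\<Prod>i\<in>UNIV. ?f i (x $ i))"
      by (simp add: scaleR_conv_of_real prod.distrib)
  qed
  also have "\<dots> = (\<Prod>i\<in>UNIV. LINT t|lborel. ?f i t)"
    by (rule integral_lborel_prod_cart) (rule integral_exp_period(2)[OF L])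
  also have "\<dots> = (\<Prod>i\<in>UNIV. if k $ i = 0 then of_real L else 0)"
    by (simp only: integral_exp_period(1)[OF L])
  also have "\<dots> = (if k = 0 then of_real (L ^ CARD('n)) else 0)"
    by (auto simp: vec_eq_iff intro!: prod_zero)
  finally show ?thesis .
qed

lemma orthonormal_nwave:
  assumes L: "L > 0" shows "orthonormal (LB L) (nwave L :: int^'n \<Rightarrow> _)"
  unfolding orthonormal_def
proof (intro conjI allI)
  fix k l :: "int^'n"
  have "ip (LB L) (nwave L k) (nwave L l) = of_real (1 / sqrt (L ^ CARD('n))) * (of_real (1 / sqrt
      (L ^ CARD('n))) * ip (LB L) (wave L k) (wave L l))"
    unfolding nwave_def ip_cmult_left ip_cmult_right by simp
  also have "of_real (1 / sqrt (L ^ CARD('n))) * (of_real (1 / sqrt (L ^ CARD('n))) * ip (LB L)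
      (wave L k) (wave L l))
      = of_real (1 / L ^ CARD('n)) * ip (LB L) (wave L k) (wave L l)"
    unfolding mult.assoc[symmetric] of_real_mult[symmetric] using L
        by (simp add: real_sqrt_mult_self flip: real_sqrt_mult)
  also have "ip (LB L) (wave L k) (wave L l) = (if l - k = 0 then of_real (L ^ CARD('n)) else 0)"
    unfolding ip_def wave_cnj wave_mult using integral_wave[OF L, of "l - k"] by simp
  finally show "ip (LB L) (nwave L k) (nwave L l) = (if k = l then 1 else 0)" using L by auto
qed (rule nwave_l2)


section \<open>Trigonometric polynomials and completeness of the waves\<close>

inductive trig :: "real \<Rightarrow> (real^'n \<Rightarrow> complex) \<Rightarrow> bool" for L where
  trig_wave: "trig L (\<lambda>x. c * wave L k x)"
| trig_add: "trig L f \<Longrightarrow> trig L g \<Longrightarrow> trig L (\<lambda>x. f x + g x)"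

lemma trig_const: "trig L (\<lambda>x :: real^'n. c)"
proof -
  have "wave L 0 x = 1" for x :: "real^'n" by (simp add: wave_def dual_pt_def inner_vec_def)
  then show ?thesis using trig_wave[of L c "0 :: int^'n"] by simp
qed

lemma trig_sum: "finite I \<Longrightarrow> (\<And>i. i \<in> I \<Longrightarrow> trig L (f i)) \<Longrightarrow> trig L (\<lambda>x. \<Sum>i\<in>I. f i x)"
  by (induction I rule: finite_induct) (auto intro: trig_add trig_const)

lemma trig_mult:
  assumes "trig L f" "trig L g" shows "trig L (\<lambda>x. f x * g x)"
  using assms
proof (induction rule: trig.induct)
  case (trig_wave c k)
  then show ?case
  proof (induction rule: trig.induct)
    case (trig_wave d l)
    have "(\<lambda>x. c * wave L k x * (d * wave L l x)) = (\<lambda>x. (c * d) * wave L (k + l) x)"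
      unfolding wave_mult[symmetric] by (simp add: ac_simps)
    then show ?case using trig.trig_wave[of L "c * d" "k + l"] by simp
  next
    case (trig_add f g)
    then show ?case using trig.trig_add[of L "\<lambda>x. c * wave L k x * f x" "\<lambda>x. c * wave L k x * g x"]
      by (simp add: ring_distribs)
  qed
next
  case (trig_add f' f'')
  then show ?case using trig.trig_add[of L "\<lambda>x. f' x * g x" "\<lambda>x. f'' x * g x"]
    by (simp add: ring_distribs)
qed

text \<open>Realizes the torus as a product of unit circles. Functions of
  \<open>torus_map L x\<close> are automatically periodic, and Stone-Weierstrass applies on the
  compact image.\<close>

definition torus_map :: "real \<Rightarrow> real^'n \<Rightarrow> complex^'n" where
  "torus_map L x = (\<chi> i. wave L (axis i 1) x)"

lemma continuous_on_torus_map: "continuous_on S (torus_map L)"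
  unfolding torus_map_def[abs_def] by (intro continuous_intros)

lemma wave_axis: "wave L (axis i 1) x = exp (2 * complex_of_real pi * \<i> * of_real (x $ i / L))"
proof -
  have "dual_pt L (axis i 1) \<bullet> x = (\<Sum>j\<in>UNIV. if j = i then x $ j / L else 0)"
    unfolding dual_pt_def inner_vec_def by (intro sum.cong refl) (auto simp: axis_def)
  then show ?thesis by (simp add: wave_def)
qed

text \<open>Two coordinates in the half-open interval differ by strictly less than \<open>L\<close>,
  so a difference that is an integer multiple of \<open>L\<close> vanishes. On the closed box
  opposite faces would be identified.\<close>

lemma inj_on_torus_map:
  assumes L: "L > 0" shows "inj_on (torus_map L) (box_L L :: (real^'n) set)"
proof (rule inj_onI)
  fix x y :: "real^'n" assume x: "x \<in> box_L L" and y: "y \<in> box_L L"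
      and eq: "torus_map L x = torus_map L y"
  have "x $ i = y $ i" for i
  proof -
    have "exp (2 * complex_of_real pi * \<i> * of_real (x $ i / L))
        = exp (2 * complex_of_real pi * \<i> * of_real (y $ i / L))"
      using eq by (simp add: torus_map_def vec_eq_iff wave_axis)
    then obtain n :: int where "2 * complex_of_real pi * \<i> * of_real (x $ i / L)
        = 2 * complex_of_real pi * \<i> * of_real (y $ i / L) + of_real (of_int (2 * n) * pi) * \<i>"
      by (auto simp: exp_eq)
    then have "2 * pi * (x $ i / L) = 2 * pi * (y $ i / L) + of_int (2 * n) * pi"
      by (simp add: complex_eq_iff)
    then have "pi * (2 * (x $ i / L)) = pi * (2 * (y $ i / L) + 2 * of_int n)"
        by (simp add: algebra_simps)
    then have "2 * (x $ i / L) = 2 * (y $ i / L) + 2 * of_int n"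
      by (rule mult_left_cancel[OF pi_neq_zero, THEN iffD1])
    then have "x $ i / L - y $ i / L = of_int n" by linarith
    then have n: "x $ i - y $ i = of_int n * L" using L by (simp add: field_simps)
    have "\<bar>x $ i - y $ i\<bar> < L" using x y by (simp add: box_L_def abs_less_iff) (smt (verit)
        field_sum_of_halves)
    then have "\<bar>of_int n :: real\<bar> < 1" using L by (simp add: n abs_mult)
    then have "n = 0" by linarith
    then show ?thesis using n by simp
  qed
  then show "x = y" by (simp add: vec_eq_iff)
qed

text \<open>The base case rests on real coordinates of complex numbers: the real inner product with
  a complex number combines a wave with its conjugate, which is the wave of opposite index.\<close>

lemma trig_polynomial_torus:
  assumes "real_polynomial_function p"
  shows "trig L (\<lambda>x :: real^'n. complex_of_real (p (torus_map L x)))"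
  using assms
proof (induction rule: real_polynomial_function.induct)
  case (linear p)
  then interpret bounded_linear p .
  have comp: "trig L (\<lambda>x :: real^'n. complex_of_real (torus_map L x \<bullet> b))" for b
  proof -
    have inner_eq: "complex_of_real (w \<bullet> u) = cnj u / 2 * w + u / 2 * cnj w" for w u :: complex
      by (auto simp: complex_eq_iff inner_complex_def field_simps)
    have "trig L (\<lambda>x. \<Sum>i\<in>UNIV. (cnj (b $ i) / 2) * wave L (axis i 1) x
        + (b $ i / 2) * wave L (- axis i 1) x)"
      by (intro trig_sum trig_add trig_wave) simp
    moreover have "(\<lambda>x. \<Sum>i\<in>UNIV. (cnj (b $ i) / 2) * wave L (axis i 1) x
        + (b $ i / 2) * wave L (- axis i 1) x) =
      (\<lambda>x :: real^'n. complex_of_real (torus_map L x \<bullet> b))"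
      unfolding inner_vec_def of_real_sum inner_eq torus_map_def wave_cnj[symmetric] by simp
    ultimately show ?thesis by simp
  qed
  have "trig L (\<lambda>x :: real^'n. \<Sum>b\<in>Basis. complex_of_real (p b) * complex_of_real (torus_map L x \<bullet> b))"
    by (intro trig_sum trig_mult trig_const comp) simp
  moreover have p_eq: "p z = (\<Sum>b\<in>Basis. p b * (z \<bullet> b))" for z
  proof -
    have "p z = p (\<Sum>b\<in>Basis. (z \<bullet> b) *\<^sub>R b)" by (simp only: euclidean_representation)
    also have "\<dots> = (\<Sum>b\<in>Basis. p b * (z \<bullet> b))" by (simp only: sum scaleR real_scaleR_def mult.commute)
    finally show ?thesis .
  qed
  have "complex_of_real (p (torus_map L x)) = (\<Sum>b\<in>Basis. complex_of_real (p b) * complex_of_real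
      (torus_map L x \<bullet> b))" for x :: "real^'n"
    by (subst p_eq) simp
  ultimately show ?case by (simp only:)
next
  case (add f g)
  show ?case using trig.trig_add[OF add.IH] by simp
next
  case (mult f g)
  show ?case using trig_mult[OF mult.IH] by simp
qed (rule trig_const)

text \<open>Inner regularity approximates the set where \<open>h\<close> is positive by a closed
  subset \<open>T\<close>, compact because the box is bounded. A vanishing integral of a positive
  function over \<open>T\<close> makes \<open>T\<close> null, so the whole set has arbitrarily small
  measure.\<close>

lemma AE_nonpos_of_compact:
  fixes h :: "real^'n \<Rightarrow> real"
  assumes h: "integrable (LB L) h" and z: "\<And>A. compact A \<Longrightarrow> A \<subseteq> box_L L
      \<Longrightarrow> (LINT x|LB L. indicator A x * h x) = 0"
  shows "AE x in LB L. h x \<le> 0"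
proof -
  define S where "S = {x \<in> box_L L. h x > 0}"
  have hm [measurable]: "h \<in> borel_measurable (LB L)" using h by simp
  have "S = {x \<in> space (LB L). h x > 0}" by (simp add: S_def)
  also have "\<dots> \<in> sets (LB L)" by measurable
  finally have SL: "S \<in> sets (LB L)" .
  then have S: "S \<in> sets lebesgue" by (simp add: sets_restrict_space_iff)
  have small: "emeasure lebesgue S \<le> ennreal e" if e: "e > 0" for e
  proof -
    obtain T where T: "closed T" "T \<subseteq> S" "S - T \<in> lmeasurable" "emeasure lebesgue (S - T) < ennreal e"
      using sets_lebesgue_inner_closed[OF S e] by blast
    have TB: "T \<subseteq> box_L L" using T(2) by (auto simp: S_def)
    have comp: "compact T" using T(1) bounded_subset[OF bounded_box_L TB]
        by (simp add: compact_eq_bounded_closed)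
    have Tm: "T \<in> sets (LB L)" using TB T(1) by (auto simp: sets_restrict_space_iff)
    have int: "integrable (LB L) (\<lambda>x. indicator T x * h x)"
      using integrable_mult_indicator[OF Tm h] by simp
    have "AE x in LB L. indicator T x * h x = 0"
      using z[OF comp TB]
      by (subst integral_nonneg_eq_0_iff_AE[symmetric]) (use int T(2) in \<open>auto simp: S_def
          indicator_def subset_iff less_imp_le\<close>)
    then have "AE x in LB L. x \<notin> T"
      by eventually_elim (use T(2) in \<open>auto simp: S_def indicator_def split: if_splits\<close>)
    then have "emeasure (LB L) T = 0"
      using Tm by (subst (asm) AE_iff_measurable[where N = T]) (use TB in auto)
    then have T0: "emeasure lebesgue T = 0" using TB by (simp add: emeasure_restrict_space)
    have "emeasure lebesgue S = emeasure lebesgue (S - T) + emeasure lebesgue T"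
    proof -
      have "(S - T) \<union> T = S" using T(2) by auto
      moreover have "emeasure lebesgue (S - T) + emeasure lebesgue T = emeasure lebesgue ((S - T) \<union> T)"
        by (rule plus_emeasure) (use T S in auto)
      ultimately show ?thesis by simp
    qed
    then show ?thesis using T(4) T0 by simp
  qed
  have "emeasure lebesgue S \<le> 0"
    by (rule ennreal_le_epsilon) (use small in auto)
  then have "emeasure (LB L) S = 0" by (simp add: emeasure_restrict_space S_def)
  then show ?thesis
    using SL by (subst AE_iff_measurable[where N = S]) (auto simp: S_def not_le)
qed

text \<open>Orthogonality to the waves extends by linearity to trigonometric polynomials, by uniform
  approximation to continuous functions on the embedded torus, and by dominated convergence to
  indicators of compact subsets of the box. These detect the signs of the real and imaginary
  parts.\<close>

lemma total_nwave:
  assumes L: "L > 0" shows "total (LB L) (nwave L :: int^'n \<Rightarrow> _)"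
  unfolding total_def
proof (intro ballI impI)
  fix g :: "real^'n \<Rightarrow> complex" assume g: "g \<in> l2 (LB L)" and g0: "\<forall>k. ip (LB L) (nwave L k) g = 0"
  have gm [measurable]: "g \<in> borel_measurable (LB L)" using g by (rule l2_measurable)
  have int_b: "integrable (LB L) (\<lambda>x. f x * g x)"
    if "f \<in> borel_measurable (LB L)" "\<And>x. x \<in> box_L L \<Longrightarrow> cmod (f x) \<le> b" for f b
  proof -
    have "(\<lambda>x. cnj (f x)) \<in> l2 (LB L)" by (rule l2_bounded_LB[of _ _ b]) (use that in auto)
    from ip_integrable[OF this g] show ?thesis by simp
  qed
  have int_g: "integrable (LB L) g" using int_b[of "\<lambda>x. 1" 1] by simp
  have wave0: "(LINT x|LB L. wave L k x * g x) = 0" for k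
  proof -
    have "ip (LB L) (nwave L (- k)) g = of_real (1 / sqrt (L ^ CARD('n))) * ip (LB L) (wave L (- k)) g"
      unfolding nwave_def ip_cmult_left by simp
    then have "ip (LB L) (wave L (- k)) g = 0" using g0 L by simp
    then show ?thesis unfolding ip_def wave_cnj by simp
  qed
  have trig0: "integrable (LB L) (\<lambda>x. f x * g x) \<and> (LINT x|LB L. f x * g x) = 0" if "trig L f" for f
    using that
  proof induction
    case (trig_wave c k)
    have "wave L k \<in> borel_measurable (LB L)" by (intro borel_imp_LB_measurable) measurable
    then have "integrable (LB L) (\<lambda>x. wave L k x * g x)" by (intro int_b[of _ 1]) auto
    then show ?case using wave0[of k] by (simp add: mult.assoc)
  qed (simp add: ring_distribs)
  let ?K = "torus_map L ` cbox (\<chi> i. - L / 2) (\<chi> i. L / 2) :: (complex^'n) set"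
  have K: "compact ?K" by (intro compact_continuous_image continuous_on_torus_map compact_cbox)
  have cont0: "(LINT x|LB L. complex_of_real (h (torus_map L x)) * g x) = 0"
    if h: "continuous_on UNIV h" for h :: "complex^'n \<Rightarrow> real"
  proof -
    have hm: "(\<lambda>x. complex_of_real (h (torus_map L x))) \<in> borel_measurable (LB L)"
      by (intro borel_imp_LB_measurable borel_measurable_continuous_onI continuous_intros
          continuous_on_compose2[OF h continuous_on_torus_map]) auto
    have "cmod (LINT x|LB L. complex_of_real (h (torus_map L x)) * g x) \<le> e" if e: "e > 0" for e
    proof -
      define G where "G = (LINT x|LB L. cmod (g x))"
      have G: "G \<ge> 0" by (simp add: G_def)
      define d where "d = e / (G + 1)"
      have d: "d > 0" using e G by (simp add: d_def)
      obtain p where p: "real_polynomial_function p" and ph: "\<And>z. z \<in> ?K \<Longrightarrow> \<bar>h z - p z\<bar> < d"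
        using Stone_Weierstrass_real_polynomial_function[OF K continuous_on_subset[OF h] d] by auto
      have bd: "cmod (complex_of_real (h (torus_map L x)) - complex_of_real (p (torus_map L x)))
          \<le> d" if "x \<in> box_L L" for x
        using ph[OF imageI[OF subsetD[OF box_L_subset_cbox that]]] by (simp flip: of_real_diff)
      note t = trig0[OF trig_polynomial_torus[OF p]]
      have p_cont: "continuous_on UNIV p"
        using continuous_real_polymonial_function[OF p]
            by (simp add: continuous_on_eq_continuous_within)
      have pm: "(\<lambda>x. complex_of_real (p (torus_map L x))) \<in> borel_measurable (LB L)"
        by (intro borel_imp_LB_measurable borel_measurable_continuous_onI continuous_intros
          continuous_on_compose2[OF p_cont continuous_on_torus_map]) auto
      have int_d: "integrable (LB L) (\<lambda>x. (complex_of_real (h (torus_map L x))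
          - complex_of_real (p (torus_map L x))) * g x)"
        by (rule int_b[of _ d]) (use hm pm bd in auto)
      have "(LINT x|LB L. complex_of_real (h (torus_map L x)) * g x) =
          (LINT x|LB L. (complex_of_real (h (torus_map L x))
              - complex_of_real (p (torus_map L x))) * g x + complex_of_real (p (torus_map L x)) * g x)"
        by (simp add: algebra_simps)
      also have "\<dots> = (LINT x|LB L. (complex_of_real (h (torus_map L x))
          - complex_of_real (p (torus_map L x))) * g x)"
        using t int_d by (subst Bochner_Integration.integral_add) auto
      also have "cmod \<dots> \<le> (LINT x|LB L. d * cmod (g x))"
        by (rule order_trans[OF integral_norm_bound], rule integral_mono)
           (use integrable_norm[OF int_d] int_g bd in \<open>auto simp: norm_mult intro!: mult_right_mono\<close>)
      also have "\<dots> = d * G" by (simp add: G_def)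
      also have "\<dots> \<le> e" using e G by (simp add: d_def field_simps)
      finally show ?thesis .
    qed
    then have "cmod (LINT x|LB L. complex_of_real (h (torus_map L x)) * g x) \<le> 0"
        by (rule field_le_epsilon) simp
    then show ?thesis by simp
  qed
  have compact0: "(LINT x|LB L. complex_of_real (indicator A x) * g x) = 0"
      if A: "compact A" "A \<subseteq> box_L L" for A
  proof (cases "A = {}")
    case False
    \<comment> \<open>The distance is taken in the embedded torus, since a distance in the box would
      not give a periodic function. Injectivity of \<open>torus_map\<close> makes the limit the
      indicator of \<open>A\<close>. The empty set is treated apart because \<open>infdist\<close>
      to it is 0.\<close>
    define h where "h m z = max 0 (1 - real m * infdist z (torus_map L ` A))" for m z
    have h_cont: "continuous_on UNIV (h m)" for m unfolding h_def by (intro continuous_intros)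
    have cA: "closed (torus_map L ` A)"
      by (intro compact_imp_closed compact_continuous_image continuous_on_torus_map A)
    have "(\<lambda>m. LINT x|LB L. complex_of_real (h m (torus_map L x)) * g x) \<longlonglongrightarrow> (LINT x|LB L.
        complex_of_real (indicator A x) * g x)"
    proof (rule integral_dominated_convergence)
      show "integrable (LB L) (\<lambda>x. cmod (g x))" using int_g by simp
      show "(\<lambda>x. complex_of_real (indicator A x) * g x) \<in> borel_measurable (LB L)"
        using borel_imp_LB_measurable[of "indicator A :: _ \<Rightarrow> real" L] compact_imp_closed[OF A(1)]
            by auto
      show "(\<lambda>x. complex_of_real (h m (torus_map L x)) * g x) \<in> borel_measurable (LB L)" for m
        by (intro borel_measurable_times gm borel_imp_LB_measurable borel_measurable_continuous_onI
            continuous_intros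
          continuous_on_compose2[OF h_cont continuous_on_torus_map]) auto
      show "AE x in LB L. norm (complex_of_real (h m (torus_map L x)) * g x) \<le> cmod (g x)" for m
      proof (rule AE_I2)
        fix x
        have "\<bar>h m (torus_map L x)\<bar> \<le> 1" by (auto simp: h_def max_def intro!: mult_nonneg_nonneg
            infdist_nonneg)
        then show "norm (complex_of_real (h m (torus_map L x)) * g x) \<le> cmod (g x)"
          by (simp add: norm_mult mult_left_le_one_le)
      qed
      show "AE x in LB L. (\<lambda>m. complex_of_real (h m (torus_map L x)) * g x) \<longlonglongrightarrow> complex_of_real
          (indicator A x) * g x"
      proof (rule AE_I2)
        fix x :: "real^'n" assume "x \<in> space (LB L)"
        then have x: "x \<in> box_L L" by simp
        have "(\<lambda>m. h m (torus_map L x)) \<longlonglongrightarrow> indicator A x"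
        proof (cases "x \<in> A")
          case True
          then show ?thesis by (simp add: h_def)
        next
          case xA: False
          have "torus_map L x \<notin> torus_map L ` A"
            using inj_on_torus_map[OF L] x xA A(2) by (auto simp: inj_on_def subset_iff)
          then have pos: "infdist (torus_map L x) (torus_map L ` A) > 0"
            using infdist_pos_not_in_closed[OF cA] False by auto
          obtain N :: nat where N: "1 / infdist (torus_map L x) (torus_map L ` A) < N"
              using reals_Archimedean2 by blast
          have "h m (torus_map L x) = 0" if "m \<ge> N" for m
          proof -
            have "1 / infdist (torus_map L x) (torus_map L ` A) < real m" using N that by linarith
            then show ?thesis using pos by (simp add: h_def field_simps)
          qed
          then have "\<forall>\<^sub>F m in sequentially. h m (torus_map L x) = indicator A x"
            using xA by (auto simp: eventually_sequentially)
          then show ?thesis by (rule tendsto_eventually)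
        qed
        then show "(\<lambda>m. complex_of_real (h m (torus_map L x)) * g x) \<longlonglongrightarrow> complex_of_real (indicator A
            x) * g x"
          by (intro tendsto_intros)
      qed
    qed
    then show ?thesis by (simp add: cont0[OF h_cont] LIMSEQ_const_iff)
  qed simp
  have ind_int: "integrable (LB L) (\<lambda>x. complex_of_real (indicator A x) * g x)" if "compact A" for A
  proof (rule int_b[of _ 1])
    show "(\<lambda>x. complex_of_real (indicator A x)) \<in> borel_measurable (LB L)"
      using borel_imp_LB_measurable[of "indicator A :: _ \<Rightarrow> real" L] compact_imp_closed[OF that] by auto
  qed (auto split: split_indicator)
  have re: "(LINT x|LB L. indicator A x * Re (g x)) = 0"
      and im: "(LINT x|LB L. indicator A x * Im (g x)) = 0"
    if A: "compact A" "A \<subseteq> box_L L" for A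
  proof -
    have "(LINT x|LB L. indicator A x * Re (g x))
        = Re (LINT x|LB L. complex_of_real (indicator A x) * g x)"
      by (subst integral_Re[OF ind_int[OF A(1)], symmetric]) simp
    then show "(LINT x|LB L. indicator A x * Re (g x)) = 0" unfolding compact0[OF A] by simp
    have "(LINT x|LB L. indicator A x * Im (g x))
        = Im (LINT x|LB L. complex_of_real (indicator A x) * g x)"
      by (subst integral_Im[OF ind_int[OF A(1)], symmetric]) simp
    then show "(LINT x|LB L. indicator A x * Im (g x)) = 0" unfolding compact0[OF A] by simp
  qed
  have "AE x in LB L. Re (g x) \<le> 0" "AE x in LB L. Im (g x) \<le> 0"
    "AE x in LB L. - Re (g x) \<le> 0" "AE x in LB L. - Im (g x) \<le> 0"
    by (rule AE_nonpos_of_compact; use int_g re im in simp)+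
  then show "AE x in LB L. g x = 0" by eventually_elim (auto simp: complex_eq_iff)
qed

lemma nu_eq: "nu p = (2 * pi * norm p)\<^sup>2"
proof -
  \<comment> \<open>Since \<open>*\<^sub>R\<close> binds tighter than \<open>*\<close>, the 2 in
    \<open>nu\<close> is a constant vector multiplied componentwise; the value is the intended
    one.\<close>
  have "2 * pi *\<^sub>R p = (2 * pi) *\<^sub>R p" by (simp add: vec_eq_iff)
  then show ?thesis unfolding nu_def by simp
qed

lemma finite_int_box: "finite {n :: int^'n. \<forall>i. \<bar>n $ i\<bar> \<le> N}"
proof -
  have "{n :: int^'n. \<forall>i. \<bar>n $ i\<bar> \<le> N} \<subseteq> vec_lambda ` (PiE UNIV (\<lambda>_. {-N..N}))"
  proof
    fix n :: "int^'n" assume n: "n \<in> {n. \<forall>i. \<bar>n $ i\<bar> \<le> N}"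
    have "n $ i \<in> {-N..N}" for i using n by (simp add: abs_le_iff) (metis minus_le_iff)
    then show "n \<in> vec_lambda ` (PiE UNIV (\<lambda>_. {-N..N}))"
      by (intro image_eqI[of _ _ "vec_nth n"]) auto
  qed
  then show ?thesis by (rule finite_subset) (intro finite_imageI finite_PiE; simp)
qed

lemma finite_dual_bounded:
  assumes L: "L > 0" shows "finite {k :: int^'n. nu (dual_pt L k) \<le> c}"
proof -
  define N where "N = \<lceil>L * sqrt c\<rceil>"
  have "{k :: int^'n. nu (dual_pt L k) \<le> c} \<subseteq> {k. \<forall>i. \<bar>k $ i\<bar> \<le> N}"
  proof (clarify)
    fix k :: "int^'n" and i assume "nu (dual_pt L k) \<le> c"
    then have k: "(2 * pi * norm (dual_pt L k))\<^sup>2 \<le> c" by (simp add: nu_eq)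
    have "\<bar>of_int (k $ i) / L\<bar> \<le> norm (dual_pt L k)"
      using component_le_norm_cart[of "dual_pt L k" i] by (simp add: dual_pt_def)
    also have "\<dots> \<le> 2 * pi * norm (dual_pt L k)"
        using pi_ge_two mult_right_mono[of 1 "2 * pi" "norm (dual_pt L k)"] by simp
    also have "\<dots> \<le> sqrt c" using real_le_rsqrt[OF k] .
    finally have "\<bar>of_int (k $ i) :: real\<bar> / L \<le> sqrt c" using L by (simp add: abs_divide)
    then have "real_of_int \<bar>k $ i\<bar> \<le> L * sqrt c" using L by (simp add: field_simps)
    also have "\<dots> \<le> real_of_int N" unfolding N_def by (rule le_of_int_ceiling)
    finally show "\<bar>k $ i\<bar> \<le> N" unfolding of_int_le_iff .
  qed
  then show ?thesis by (rule finite_subset) (rule finite_int_box)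
qed

lemma infinite_dual: "infinite (UNIV :: (int^'n) set)"
proof -
  have "inj (vec :: int \<Rightarrow> int^'n)" by (auto simp: inj_def vec_eq_iff)
  then have "infinite (range (vec :: int \<Rightarrow> int^'n))" by (simp add: finite_image_iff)
  then show ?thesis by (rule infinite_super[rotated]) simp
qed

lemma spectral_basis_nwave:
  "L > 0 \<Longrightarrow> spectral_basis (LB L) (nwave L :: int^'n \<Rightarrow> _) (\<lambda>k. nu (dual_pt L k))"
  by (intro spectral_basis.intro orthonormal_nwave total_nwave finite_dual_bounded infinite_dual)
      (simp_all add: nu_eq)

section \<open>Cut-off trigonometric polynomials\<close>

text \<open>Partial derivative along the \<open>i\<close>-th axis, as a relation so that the sum and
  product rules deliver existence and formula together.\<close>

definition dd :: "'n \<Rightarrow> (real^'n \<Rightarrow> complex) \<Rightarrow> (real^'n \<Rightarrow> complex) \<Rightarrow> bool" where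
  "dd i f f' \<longleftrightarrow> (\<forall>x. ((\<lambda>h. f (x + h *\<^sub>R axis i 1)) has_vector_derivative f' x) (at 0))"

lemma dd_add: "dd i f f' \<Longrightarrow> dd i g g' \<Longrightarrow> dd i (\<lambda>x. f x + g x) (\<lambda>x. f' x + g' x)"
  by (auto simp: dd_def intro!: derivative_intros)

lemma dd_mult: 
  assumes "dd i f f'" "dd i g g'" shows "dd i (\<lambda>x. f x * g x) (\<lambda>x. f x * g' x + f' x * g x)"
  unfolding dd_def
proof
  fix x
  show "((\<lambda>h. f (x + h *\<^sub>R axis i 1) * g (x + h *\<^sub>R axis i 1)) has_vector_derivative f x * g' x
      + f' x * g x) (at 0)"
    using has_vector_derivative_mult[of "\<lambda>h. f (x + h *\<^sub>R axis i 1)" "f' x" 0 UNIV "\<lambda>h. g (x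
        + h *\<^sub>R axis i 1)" "g' x"] assms
    by (simp add: dd_def)
qed

lemma dd_const: "dd i (\<lambda>x. c) (\<lambda>x. 0)"
  by (simp add: dd_def)

lemma dd_cmult: "dd i f f' \<Longrightarrow> dd i (\<lambda>x. c * f x) (\<lambda>x. c * f' x)"
  using dd_mult[OF dd_const[of i c]] by fastforce

lemma dd_sum: "finite I \<Longrightarrow> (\<And>j. j \<in> I \<Longrightarrow> dd i (f j) (f' j)) \<Longrightarrow> dd i (\<lambda>x. \<Sum>j\<in>I. f j x) (\<lambda>x. \<Sum>j\<in>I. f' j x)"
  by (induction I rule: finite_induct) (auto intro: dd_add dd_const)

lemma dd_line:
  assumes "dd i f f'"
  shows "((\<lambda>h. f (x + h *\<^sub>R axis i 1)) has_vector_derivative f' (x + s *\<^sub>R axis i 1)) (at s)"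
proof -
  have "((\<lambda>h. f ((x + s *\<^sub>R axis i 1) + h *\<^sub>R axis i 1)) has_vector_derivative f' (x
      + s *\<^sub>R axis i 1)) (at 0)"
    using assms by (simp add: dd_def)
  then have "((\<lambda>h. f ((x + s *\<^sub>R axis i 1) + h *\<^sub>R axis i 1)) \<circ> (\<lambda>t. t
      - s) has_vector_derivative (1 *\<^sub>R f' (x + s *\<^sub>R axis i 1))) (at s)"
    by (intro vector_diff_chain_at) (auto intro!: derivative_eq_intros simp: has_vector_derivative_def)
  then show ?thesis by (simp add: comp_def algebra_simps)
qed

text \<open>Every difference quotient has integral zero by translation invariance. The mean value
  inequality bounds the quotients by \<open>C\<close>, and shifts of length at most 1 keep their
  supports in the ball of radius \<open>R + 1\<close>, so dominated convergence applies.\<close>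

lemma integral_dd_zero:
  fixes F F' :: "real^'n \<Rightarrow> complex"
  assumes d: "dd i F F'" and cont: "continuous_on UNIV F" "continuous_on UNIV F'"
    and supp: "\<And>x. norm x > R \<Longrightarrow> F x = 0" "\<And>x. norm x > R \<Longrightarrow> F' x = 0"
  shows "(LINT x|lborel. F' x) = 0"
proof -
  have [measurable]: "F \<in> borel_measurable borel" "F' \<in> borel_measurable borel"
    using cont by (auto intro: borel_measurable_continuous_onI)
  have bdd: "\<exists>C. \<forall>x. cmod (G x) \<le> C" if "continuous_on UNIV G" "\<And>x. norm x > R
      \<Longrightarrow> G x = 0" for G :: "real^'n \<Rightarrow> complex"
  proof -
    have "compact (G ` cball 0 R)" by (intro compact_continuous_image continuous_on_subset[OF
        that(1)]) auto
    then obtain C where C: "\<forall>y\<in>G ` cball 0 R. norm y \<le> C" using bounded_iff compact_imp_bounded by metis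
    have "cmod (G x) \<le> max C 0" for x
      using C that(2)[of x] by (cases "norm x \<le> R") (auto simp: le_max_iff_disj not_le)
    then show ?thesis by blast
  qed
  obtain C where C: "\<And>x. cmod (F' x) \<le> C" using bdd[OF cont(2) supp(2)] by blast
  obtain B where B: "\<And>x. cmod (F x) \<le> B" using bdd[OF cont(1) supp(1)] by blast
  have C0: "C \<ge> 0" using C[of 0] norm_ge_zero order_trans by blast
  have int_cball: "integrable lborel (\<lambda>x :: real^'n. D * indicator (cball 0 r) x :: real)" for D r
    by (intro integrable_mult_right integrable_real_indicator)
       (use emeasure_bounded_finite[OF bounded_cball[of "0::real^'n" r]] in auto)
  have int_F: "integrable lborel F"
    by (rule Bochner_Integration.integrable_bound[OF int_cball[of B R]])
       (use B supp(1) in \<open>auto simp: indicator_def not_le intro!: AE_I2 order_trans[OF B abs_ge_self]\<close>)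
  define G where "G n x = of_nat (Suc n) * (F (x + (1 / Suc n) *\<^sub>R axis i 1) - F x)" for n x
  have "(\<lambda>n. LINT x|lborel. G n x) \<longlonglongrightarrow> (LINT x|lborel. F' x)"
  proof (rule integral_dominated_convergence[OF _ _ int_cball[of C "R + 1"]])
    show "AE x in lborel. (\<lambda>n. G n x) \<longlonglongrightarrow> F' x"
    proof (rule AE_I2)
      fix x
      have "((\<lambda>h. (F (x + h *\<^sub>R axis i 1) - F x) /\<^sub>R h) \<longlongrightarrow> F' x) (at 0)"
      proof (rule LIM_zero_cancel, rule tendsto_norm_zero_cancel, rule Lim_transform_eventually)
        show "((\<lambda>h. cmod (F (x + h *\<^sub>R axis i 1) - F x - h *\<^sub>R F' x) / \<bar>h\<bar>) \<longlongrightarrow> 0) (at 0)"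
          using d by (simp add: dd_def has_vector_derivative_def has_derivative_at)
        have "cmod (F (x + h *\<^sub>R axis i 1) - F x - h *\<^sub>R F' x) / \<bar>h\<bar>
            = cmod ((F (x + h *\<^sub>R axis i 1) - F x) /\<^sub>R h - F' x)" if "h \<noteq> 0" for h
        proof -
          have "(F (x + h *\<^sub>R axis i 1) - F x) /\<^sub>R h - F' x
              = (F (x + h *\<^sub>R axis i 1) - F x - h *\<^sub>R F' x) /\<^sub>R h"
            using that by (simp add: scaleR_diff_right)
          then show ?thesis by (simp add: divide_inverse mult.commute)
        qed
        then show "\<forall>\<^sub>F h in at 0. cmod (F (x + h *\<^sub>R axis i 1) - F x - h *\<^sub>R F' x) / \<bar>h\<bar>
            = cmod ((F (x + h *\<^sub>R axis i 1) - F x) /\<^sub>R h - F' x)"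
          by (simp add: eventually_at_filter)
      qed
      then have "((\<lambda>n. (F (x + (1 / Suc n) *\<^sub>R axis i 1) - F x) /\<^sub>R (1 / Suc n)) \<longlongrightarrow> F' x) sequentially"
      proof (rule filterlim_compose)
        have "(\<lambda>n. 1 / real (Suc n)) \<longlonglongrightarrow> 0"
          using LIMSEQ_inverse_real_of_nat by (simp add: inverse_eq_divide)
        then show "filterlim (\<lambda>n. 1 / real (Suc n)) (at 0) sequentially" by (simp add: filterlim_at)
      qed
      then show "(\<lambda>n. G n x) \<longlonglongrightarrow> F' x" by (simp add: G_def scaleR_conv_of_real)
    qed
    show "AE x in lborel. norm (G n x) \<le> C * indicator (cball 0 (R + 1)) x" for n
    proof (rule AE_I2)
      fix x :: "real^'n"
      define h where "h = 1 / real (Suc n)"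
      have h: "h > 0" "h \<le> 1" by (auto simp: h_def)
      have "norm (F (x + h *\<^sub>R axis i 1) - F (x + 0 *\<^sub>R axis i 1)) \<le> C * norm (h - 0)"
      proof (rule differentiable_bound[where S = UNIV and f' = "\<lambda>s t. t *\<^sub>R F' (x + s *\<^sub>R axis i 1)"])
        show "onorm (\<lambda>t. t *\<^sub>R F' (x + s *\<^sub>R axis i 1)) \<le> C" for s
          by (rule onorm_le) (use mult_left_mono[OF C abs_ge_zero] in \<open>simp add: mult.commute[of C]\<close>)
      qed (use dd_line[OF d] in \<open>auto simp: has_vector_derivative_def\<close>)
      then have "norm (F (x + h *\<^sub>R axis i 1) - F x) \<le> C * h" using h by simp
      moreover have "norm (G n x) = norm (F (x + h *\<^sub>R axis i 1) - F x) / h"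
        by (simp add: G_def h_def norm_mult norm_of_nat del: of_nat_Suc)
      ultimately have "norm (G n x) \<le> C" using h by (simp add: pos_divide_le_eq)
      moreover have "G n x = 0" if "norm x > R + 1"
      proof -
        have "norm x \<le> norm (x + h *\<^sub>R axis i 1) + norm (h *\<^sub>R (axis i 1 :: real^'n))"
          using norm_triangle_ineq4[of "x + h *\<^sub>R axis i 1" "h *\<^sub>R (axis i 1 :: real^'n)"] by simp
        then have "norm (x + h *\<^sub>R axis i 1) > R" using that h by simp
        then show ?thesis using supp(1) that by (simp add: G_def h_def)
      qed
      ultimately show "norm (G n x) \<le> C * indicator (cball 0 (R + 1)) x"
        using C0 by (auto simp: indicator_def not_le)
    qed
  qed (auto simp: G_def)
  moreover have "(LINT x|lborel. G n x) = 0" for n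
  proof -
    have dist: "distr lborel borel (\<lambda>x. c + x) = (lborel :: (real^'n) measure)" for c
        by (rule lborel_distr_plus)
    have "integrable (distr lborel borel (\<lambda>x. c + x)) F" for c unfolding dist by (rule int_F)
    then have shift_int: "integrable lborel (\<lambda>x. F (c + x))" for c
      by (subst (asm) integrable_distr_eq) auto
    have "(LINT x|lborel. F (c + x)) = (LINT x|lborel. F x)" for c
      by (subst (2) dist[of c, symmetric], subst integral_distr) auto
    then show ?thesis unfolding G_def using int_F shift_int
      by (simp add: add.commute[of _ "_ *\<^sub>R _"])
  qed
  ultimately show ?thesis by (simp add: LIMSEQ_const_iff)
qed

lemma dual_axis: "dual_pt L k \<bullet> axis i 1 = of_int (k $ i) / L"
  by (simp add: dual_pt_def inner_axis)

lemma nu_dual: "nu (dual_pt L k) = (\<Sum>i\<in>UNIV. (2 * pi * (of_int (k $ i) / L))\<^sup>2)"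
  unfolding nu_eq power_mult_distrib power2_norm_eq_inner inner_vec_def
  by (simp add: dual_pt_def sum_distrib_left power2_eq_square)

definition wavenr :: "real \<Rightarrow> int^'n \<Rightarrow> 'n \<Rightarrow> complex" where
  "wavenr L k i = \<i> * complex_of_real (2 * pi * (of_int (k $ i) / L))"

lemma wavenr_sq: "(wavenr L k i)\<^sup>2 = - of_real ((2 * pi * (of_int (k $ i) / L))\<^sup>2)"
  unfolding wavenr_def power_mult_distrib[of \<i>] by (simp only: power2_i of_real_power mult_minus1)

lemma norm_wavenr: "cmod (wavenr L k i) = \<bar>2 * pi * (of_int (k $ i) / L)\<bar>"
  unfolding wavenr_def norm_mult norm_of_real by simp

lemma dd_wave: "dd i (wave L k) (\<lambda>x. wavenr L k i * wave L k x)"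
  unfolding dd_def
proof
  fix x :: "real^'a"
  have "((\<lambda>h. exp (2 * complex_of_real pi * \<i> * of_real (dual_pt L k \<bullet> x)
      + of_real h * wavenr L k i)) has_vector_derivative
      exp (2 * complex_of_real pi * \<i> * of_real (dual_pt L k \<bullet> x)
          + of_real 0 * wavenr L k i) * wavenr L k i) (at 0)"
    by (auto intro!: derivative_eq_intros has_vector_derivative_real_field)
  moreover have "2 * complex_of_real pi * \<i> * of_real (dual_pt L k \<bullet> x) + of_real h * wavenr L k i
      = 2 * complex_of_real pi * \<i> * of_real (dual_pt L k \<bullet> (x + h *\<^sub>R axis i 1))" for h
    by (simp add: inner_add_right dual_axis wavenr_def algebra_simps)
  ultimately show "((\<lambda>h. wave L k (x + h *\<^sub>R axis i 1)) has_vector_derivative wavenr L k i * wave L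
      k x) (at 0)"
    by (simp add: wave_def mult.commute)
qed

text \<open>Both integrations by parts are done at once: for a wave \<open>e\<close> with derivative
  \<open>m * e\<close>, the function \<open>e * u' - m * e * u\<close> has derivative
  \<open>e * u'' - m\<^sup>2 * e * u\<close>, and \<open>m\<^sup>2\<close> is negative.\<close>

lemma dd_fourier:
  fixes u u' u'' :: "real^'n \<Rightarrow> complex"
  assumes d: "dd i u u'" "dd i u' u''"
    and cont: "continuous_on UNIV u" "continuous_on UNIV u'" "continuous_on UNIV u''"
    and supp: "\<And>x. norm x > R \<Longrightarrow> u x = 0" "\<And>x. norm x > R \<Longrightarrow> u' x = 0" "\<And>x. norm x > R \<Longrightarrow> u'' x = 0"
  shows "(LINT x|lborel. wave L k x * u'' x + of_real ((2 * pi * (of_int (k $ i) / L))\<^sup>2) * (wave L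
      k x * u x)) = 0"
proof -
  let ?e = "wave L k" and ?m = "wavenr L k i"
  have "dd i (\<lambda>x. ?e x * u' x + (- ?m) * (?e x * u x))
     (\<lambda>x. (?e x * u'' x + ?m * ?e x * u' x) + (- ?m) * (?e x * u' x + ?m * ?e x * u x))"
    by (intro dd_add dd_mult dd_cmult dd_wave d)
  then have "(LINT x|lborel. (?e x * u'' x + ?m * ?e x * u' x) + (- ?m) * (?e x * u' x
      + ?m * ?e x * u x)) = 0"
    by (rule integral_dd_zero[where R = R]) (use supp in \<open>auto intro!: continuous_intros cont\<close>)
  moreover have "(?e x * u'' x + ?m * ?e x * u' x) + (- ?m) * (?e x * u' x + ?m * ?e x * u x)
     = ?e x * u'' x + of_real ((2 * pi * (of_int (k $ i) / L))\<^sup>2) * (?e x * u x)" for x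
  proof -
    have "(?e x * u'' x + ?m * ?e x * u' x) + (- ?m) * (?e x * u' x + ?m * ?e x * u x)
     = ?e x * u'' x + (- (?m\<^sup>2)) * (?e x * u x)"
      by (simp only: power2_eq_square) algebra
    then show ?thesis unfolding wavenr_sq minus_minus .
  qed
  ultimately show ?thesis by (simp only:)
qed

text \<open>An exponent of at least two removes the kink of \<open>max 0 y\<close> at the origin;
  elsewhere the function agrees locally with a monomial or with zero.\<close>

lemma max_power_derivative:
  "((\<lambda>y::real. (max 0 y) ^ Suc (Suc p)) has_real_derivative real (Suc (Suc p)) * (max 0 y) ^ Suc p)
      (at y)"
proof -
  consider "y > 0" | "y < 0" | "y = 0" by linarith
  then show ?thesis
  proof cases
    case 1
    have "((\<lambda>y::real. y ^ Suc (Suc p)) has_real_derivative real (Suc (Suc p)) * y ^ Suc p) (at y)"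
      using DERIV_pow[of "Suc (Suc p)" y] by simp
    then have "((\<lambda>y::real. (max 0 y) ^ Suc (Suc p)) has_real_derivative real (Suc (Suc p)) * y ^ Suc
        p) (at y)"
      by (rule has_field_derivative_transform_within_open[of _ _ _ "{0<..}"]) (use 1 in auto)
    then show ?thesis using 1 by simp
  next
    case 2
    have "((\<lambda>y::real. 0) has_real_derivative 0) (at y)" by simp
    then have "((\<lambda>y::real. (max 0 y) ^ Suc (Suc p)) has_real_derivative 0) (at y)"
      by (rule has_field_derivative_transform_within_open[of _ _ _ "{..<0}"]) (use 2 in auto)
    then show ?thesis using 2 by simp
  next
    case 3
    have "((\<lambda>h::real. (max 0 h) ^ Suc (Suc p) / h) \<longlongrightarrow> 0) (at 0)"
    proof (rule Lim_null_comparison)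
      show "\<forall>\<^sub>F h in at 0. norm ((max 0 h) ^ Suc (Suc p) / h) \<le> \<bar>h\<bar> ^ Suc p"
      proof (intro always_eventually allI)
        fix h :: real
        show "norm ((max 0 h) ^ Suc (Suc p) / h) \<le> \<bar>h\<bar> ^ Suc p"
        proof (cases "h > 0")
          case False
          then have "norm ((max 0 h) ^ Suc (Suc p) / h) = 0" by simp
          then show ?thesis by (simp only: zero_le_power_abs)
        qed simp
      qed
      show "((\<lambda>h::real. \<bar>h\<bar> ^ Suc p) \<longlongrightarrow> 0) (at 0)" by (auto intro!: tendsto_eq_intros)
    qed
    then show ?thesis using 3 by (simp add: has_field_derivative_iff)
  qed
qed

section \<open>The cutoff and its derivatives\<close>

definition bump :: "real \<Rightarrow> real^'n \<Rightarrow> real" where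
  "bump R x = max 0 (1 - (norm x)\<^sup>2 / R\<^sup>2)"

lemma continuous_on_bump [continuous_intros]: "continuous_on S (bump R)"
  unfolding bump_def[abs_def] by (auto intro!: continuous_intros simp: divide_inverse)

lemma bump_bounds: "0 \<le> bump R x" "bump R x \<le> 1"
  by (auto simp: bump_def)

lemma bump_outside: "R > 0 \<Longrightarrow> norm x > R \<Longrightarrow> bump R x = 0"
  by (auto simp: bump_def max_def field_simps)

lemma dd_bump_power:
  assumes R: "R > 0"
  shows "dd i (\<lambda>x. of_real (bump R x ^ Suc (Suc p))) (\<lambda>x. of_real (- 2 * real (Suc (Suc p)) * (x $
      i) / R\<^sup>2 * bump R x ^ Suc p))"
  unfolding dd_def
proof
  fix x :: "real^'a"
  have nrm: "1 - (norm (x + h *\<^sub>R axis i 1))\<^sup>2 / R\<^sup>2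
      = 1 - ((norm x)\<^sup>2 + 2 * h * (x $ i) + h\<^sup>2) / R\<^sup>2" for h
    unfolding power2_norm_eq_inner by (simp add: inner_add_left inner_add_right inner_axis
        inner_commute[of "axis i 1"] power2_eq_square inner_axis_axis algebra_simps)
  have "((\<lambda>h. 1 - ((norm x)\<^sup>2 + 2 * h * (x $ i)
      + h\<^sup>2) / R\<^sup>2) has_real_derivative - 2 * (x $ i) / R\<^sup>2) (at 0)"
    using R by (auto intro!: derivative_eq_intros simp: field_simps)
  from DERIV_chain2[OF max_power_derivative this, of p]
  have "((\<lambda>h. bump R (x + h *\<^sub>R axis i 1) ^ Suc (Suc p)) has_real_derivative
      (real (Suc (Suc p)) * (max 0 (1 - (norm x)\<^sup>2 / R\<^sup>2)) ^ Suc p) * (- 2 * (x $ i) / R\<^sup>2)) (at 0)"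
    unfolding bump_def nrm by (simp del: power_Suc)
  then have "((\<lambda>h. bump R (x + h *\<^sub>R axis i 1) ^ Suc (Suc p)) has_real_derivative
      - 2 * real (Suc (Suc p)) * (x $ i) / R\<^sup>2 * bump R x ^ Suc p) (at 0)"
    unfolding bump_def
    by (rule DERIV_cong) (simp add: algebra_simps add_divide_distrib diff_divide_distrib del: power_Suc)
  then show "((\<lambda>h. complex_of_real (bump R (x + h *\<^sub>R axis i 1) ^ Suc (Suc p))) has_vector_derivative
      complex_of_real (- 2 * real (Suc (Suc p)) * (x $ i) / R\<^sup>2 * bump R x ^ Suc p)) (at 0)"
    by (intro has_vector_derivative_of_real) (simp only: has_real_derivative_iff_has_vector_derivative)
qed


text \<open>The third is the lowest integer power of the truncated paraboloid that is twice
  continuously differentiable across the sphere of radius \<open>R\<close>. It has explicit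
  derivatives, \<open>chi1\<close> and \<open>chi2\<close>, of sizes \<open>1 / R\<close> and
  \<open>1 / R\<^sup>2\<close>.\<close>

definition chi :: "real \<Rightarrow> real^'n \<Rightarrow> real" where
  "chi R x = bump R x ^ 3"

definition chi1 :: "real \<Rightarrow> 'n \<Rightarrow> real^'n \<Rightarrow> real" where
  "chi1 R i x = - 6 * (x $ i) / R\<^sup>2 * bump R x ^ 2"

definition chi2 :: "real \<Rightarrow> 'n \<Rightarrow> real^'n \<Rightarrow> real" where
  "chi2 R i x = - 6 / R\<^sup>2 * bump R x ^ 2 + 24 * (x $ i)\<^sup>2 / R ^ 4 * bump R x"

lemma dd_coord: "dd i (\<lambda>x. complex_of_real (x $ i)) (\<lambda>x. 1)"
  unfolding dd_def
proof
  fix x :: "real^'a"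
  have "((\<lambda>h. complex_of_real (x $ i + h)) has_vector_derivative of_real 1) (at 0)"
    by (rule has_vector_derivative_of_real) (auto intro!: derivative_eq_intros simp:
        has_real_derivative_iff_has_vector_derivative[symmetric])
  then show "((\<lambda>h. complex_of_real ((x + h *\<^sub>R axis i 1) $ i)) has_vector_derivative 1) (at 0)" by simp
qed

lemma dd_chi: "R > 0 \<Longrightarrow> dd i (\<lambda>x. of_real (chi R x)) (\<lambda>x. of_real (chi1 R i x))"
  using dd_bump_power[of R i 1] by (simp add: chi_def chi1_def eval_nat_numeral)

lemma dd_chi1: 
  assumes R: "R > 0" shows "dd i (\<lambda>x. of_real (chi1 R i x)) (\<lambda>x. of_real (chi2 R i x))"
proof -
  have "dd i (\<lambda>x. of_real (- 6 / R\<^sup>2) * (of_real (x $ i) * of_real (bump R x ^ Suc (Suc 0))))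
     (\<lambda>x. of_real (- 6 / R\<^sup>2) * (of_real (x $ i) * of_real (- 2 * real (Suc (Suc 0)) * (x $ i) / R\<^sup>2
         * bump R x ^ Suc 0)
        + 1 * of_real (bump R x ^ Suc (Suc 0))))"
    by (intro dd_cmult dd_mult dd_coord dd_bump_power R)
  moreover have "(\<lambda>x :: real^'a. complex_of_real (- 6 / R\<^sup>2) * (of_real (x $ i) * of_real (bump R x
      ^ Suc (Suc 0)))) = (\<lambda>x. of_real (chi1 R i x))"
    by (simp add: chi1_def fun_eq_iff power2_eq_square)
  moreover have "(\<lambda>x :: real^'a. complex_of_real (- 6 / R\<^sup>2) * (of_real (x $ i) * of_real (- 2 *
      real (Suc (Suc 0)) * (x $ i) / R\<^sup>2 * bump R x ^ Suc 0)
        + 1 * of_real (bump R x ^ Suc (Suc 0)))) = (\<lambda>x. of_real (chi2 R i x))"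
  proof
    fix x :: "real^'a"
    have "(- 6 / R\<^sup>2) * ((x $ i) * (- 2 * real (Suc (Suc 0)) * (x $ i) / R\<^sup>2 * bump R x ^ Suc 0)
        + 1 * bump R x ^ Suc (Suc 0)) = chi2 R i x"
      using R by (simp add: chi2_def field_simps power2_eq_square power4_eq_xxxx)
    then show "complex_of_real (- 6 / R\<^sup>2) * (of_real (x $ i) * of_real (- 2 * real (Suc (Suc 0)) *
        (x $ i) / R\<^sup>2 * bump R x ^ Suc 0)
        + 1 * of_real (bump R x ^ Suc (Suc 0))) = of_real (chi2 R i x)"
      by (metis of_real_1 of_real_add of_real_mult)
  qed
  ultimately show ?thesis by simp
qed

lemma continuous_on_chi [continuous_intros]:
  "continuous_on S (chi R)" "continuous_on S (chi1 R i)" "continuous_on S (chi2 R i)"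
  unfolding chi_def[abs_def] chi1_def[abs_def] chi2_def[abs_def] divide_inverse
      by (intro continuous_intros)+

lemma chi_outside: "R > 0 \<Longrightarrow> norm x > R \<Longrightarrow> chi R x = 0" "R > 0 \<Longrightarrow> norm x > R \<Longrightarrow> chi1 R i x = 0"
  "R > 0 \<Longrightarrow> norm x > R \<Longrightarrow> chi2 R i x = 0"
  by (simp_all add: chi_def chi1_def chi2_def bump_outside)

lemma chi_bounds: "0 \<le> chi R x" "chi R x \<le> 1"
  by (auto simp: chi_def bump_bounds power_le_one)

lemma chi1_bound: 
  assumes R: "R > 0" shows "\<bar>chi1 R i x\<bar> \<le> 6 / R"
proof (cases "norm x > R")
  case True
  then show ?thesis using R by (simp add: chi_outside)
next
  case False
  then have x: "\<bar>x $ i\<bar> \<le> R" using component_le_norm_cart[of x i] by linarith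
  have b: "bump R x ^ 2 \<le> 1" "0 \<le> bump R x ^ 2" using bump_bounds[of R x]
      by (simp_all add: power_le_one)
  have "\<bar>chi1 R i x\<bar> = 6 * \<bar>x $ i\<bar> / R\<^sup>2 * bump R x ^ 2"
    using b by (simp add: chi1_def abs_mult abs_divide)
  also have "\<dots> \<le> 6 * \<bar>x $ i\<bar> / R\<^sup>2 * 1" using b by (intro mult_left_mono) auto
  also have "\<dots> \<le> 6 * R / R\<^sup>2" using x by (simp add: divide_right_mono)
  also have "\<dots> = 6 / R" using R by (simp add: power2_eq_square)
  finally show ?thesis .
qed

lemma chi2_bound: 
  assumes R: "R > 0" shows "\<bar>chi2 R i x\<bar> \<le> 30 / R\<^sup>2"
proof (cases "norm x > R")
  case True
  then show ?thesis using R by (simp add: chi_outside)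
next
  case False
  then have x: "\<bar>x $ i\<bar> \<le> R" using component_le_norm_cart[of x i] by linarith
  then have x2: "(x $ i)\<^sup>2 \<le> R\<^sup>2" using R by (metis abs_le_square_iff abs_of_pos)
  have b: "bump R x ^ 2 \<le> 1" "0 \<le> bump R x ^ 2" using bump_bounds[of R x]
      by (simp_all add: power_le_one)
  have "\<bar>chi2 R i x\<bar> \<le> 6 / R\<^sup>2 * bump R x ^ 2 + 24 * (x $ i)\<^sup>2 / R ^ 4 * bump R x"
    unfolding chi2_def using bump_bounds(1)[of R x]
    by (intro order_trans[OF abs_triangle_ineq] add_mono) (auto simp: abs_mult)
  also have "\<dots> \<le> 6 / R\<^sup>2 * 1 + 24 * R\<^sup>2 / R ^ 4 * 1"
    using b x2 bump_bounds[of R x] R by (intro add_mono mult_mono divide_right_mono mult_left_mono) auto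
  also have "\<dots> = 30 / R\<^sup>2" using R by (simp add: field_simps power2_eq_square power4_eq_xxxx)
  finally show ?thesis .
qed

section \<open>Localizing a trigonometric polynomial\<close>

context
  fixes L0 R :: real and K :: "(int^'n) set" and c :: "int^'n \<Rightarrow> complex"
begin

definition tpoly :: "real^'n \<Rightarrow> complex" where
  "tpoly x = (\<Sum>k\<in>K. c k * nwave L0 k x)"

definition tgrad :: "'n \<Rightarrow> real^'n \<Rightarrow> complex" where
  "tgrad i x = (\<Sum>k\<in>K. (c k * wavenr L0 k i) * nwave L0 k x)"

definition tlap :: "real^'n \<Rightarrow> complex" where
  "tlap x = (\<Sum>k\<in>K. of_real (nu (dual_pt L0 k)) * c k * nwave L0 k x)"

definition cutfun :: "real^'n \<Rightarrow> complex" where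
  "cutfun x = of_real (chi R x) * tpoly x"

text \<open>The Leibniz rule for the negative Laplacian of \<open>cutfun\<close>. The signs follow
  from \<open>tlap\<close> being the negative Laplacian of \<open>tpoly\<close>.\<close>

definition cutlap :: "real^'n \<Rightarrow> complex" where
  "cutlap x = of_real (chi R x) * tlap x - (\<Sum>i\<in>UNIV. 2 * of_real (chi1 R i x) * tgrad i x)
      - (\<Sum>i\<in>UNIV. of_real (chi2 R i x)) * tpoly x"

lemma continuous_on_nwave [continuous_intros]: "continuous_on S (nwave L k)"
  unfolding nwave_def[abs_def] by (intro continuous_intros)

lemma continuous_on_tpoly [continuous_intros]:
  "continuous_on S tpoly" "continuous_on S (tgrad i)" "continuous_on S tlap" "continuous_on S
      cutfun" "continuous_on S cutlap"
  unfolding tpoly_def[abs_def] tgrad_def[abs_def] tlap_def[abs_def] cutfun_def[abs_def]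
      cutlap_def[abs_def]
  by (intro continuous_intros)+

lemma cut_outside: "R > 0 \<Longrightarrow> norm x > R \<Longrightarrow> cutfun x = 0" "R > 0 \<Longrightarrow> norm x > R \<Longrightarrow> cutlap x = 0"
  by (simp_all add: cutfun_def cutlap_def chi_outside)

lemma dd_nwave: "dd i (nwave L k) (\<lambda>x :: real^'n. wavenr L k i * nwave L k x)"
proof -
  have "dd i (\<lambda>x. of_real (1 / sqrt (L ^ CARD('n))) * wave L k x) (\<lambda>x. of_real (1 / sqrt (L ^
      CARD('n))) * (wavenr L k i * wave L k x))"
    by (intro dd_cmult dd_wave)
  then show ?thesis by (simp add: nwave_def[abs_def] mult.left_commute)
qed

text \<open>The waves belong to an arbitrary size \<open>L\<close>, whereas \<open>tpoly\<close> is
  built on the lattice of \<open>L0\<close>. Compact support permits integration by parts over the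
  whole space without boundary terms, so the same pair serves as function and Laplacian on every
  torus that contains the support.\<close>

lemma ip_cutlap:
  assumes K: "finite K" and R: "R > 0"
  shows "(LINT x|lborel. wave L k x * cutlap x)
      = of_real (nu (dual_pt L k)) * (LINT x|lborel. wave L k x * cutfun x)"
proof -
  define t2 where "t2 i x = (\<Sum>k\<in>K. (c k * (wavenr L0 k i)\<^sup>2) * nwave L0 k x)" for i x
  define u1 where "u1 i x = of_real (chi R x) * tgrad i x + of_real (chi1 R i x) * tpoly x" for i x
  define u2 where "u2 i x = (of_real (chi R x) * t2 i x + of_real (chi1 R i x) * tgrad i x)
      + (of_real (chi1 R i x) * tgrad i x + of_real (chi2 R i x) * tpoly x)" for i x
  have dt: "dd i tpoly (tgrad i)" for i
  proof -
    have "dd i (\<lambda>x. \<Sum>k\<in>K. c k * nwave L0 k x) (\<lambda>x. \<Sum>k\<in>K. c k * (wavenr L0 k i * nwave L0 k x))"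
      by (intro dd_sum dd_cmult dd_nwave K)
    then show ?thesis by (simp add: tpoly_def[abs_def] tgrad_def[abs_def] mult.assoc)
  qed
  have dt2: "dd i (tgrad i) (t2 i)" for i
  proof -
    have "dd i (\<lambda>x. \<Sum>k\<in>K. (c k * wavenr L0 k i) * nwave L0 k x) (\<lambda>x. \<Sum>k\<in>K. (c k * wavenr L0 k i) *
        (wavenr L0 k i * nwave L0 k x))"
      by (intro dd_sum dd_cmult dd_nwave K)
    then show ?thesis by (simp add: t2_def[abs_def] tgrad_def[abs_def] mult.assoc power2_eq_square)
  qed
  have d1: "dd i cutfun (u1 i)" for i
    unfolding cutfun_def[abs_def] u1_def[abs_def] by (intro dd_mult dt dd_chi R)
  have d2: "dd i (u1 i) (u2 i)" for i
    unfolding u1_def[abs_def] u2_def[abs_def] by (intro dd_add dd_mult dt dt2 dd_chi dd_chi1 R)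
  have ct2: "continuous_on UNIV (t2 i)" for i unfolding t2_def[abs_def] by (intro continuous_intros)
  have cu1: "continuous_on UNIV (u1 i)" and cu2: "continuous_on UNIV (u2 i)" for i
    unfolding u1_def[abs_def] u2_def[abs_def] by (intro continuous_intros ct2)+
  have supp: "u1 i x = 0" "u2 i x = 0" if "norm x > R" for x i
    using R that by (simp_all add: u1_def u2_def chi_outside)
  have int: "integrable lborel (\<lambda>x. wave L k x * g x)" if "continuous_on UNIV g" "\<And>x. norm x > R
      \<Longrightarrow> g x = 0" for g
  proof -
    have "integrable lborel (\<lambda>x. indicator (cball 0 R) x *\<^sub>R (wave L k x * g x))"
      by (rule borel_integrable_compact) (auto intro!: continuous_intros continuous_on_subset[OF
          that(1)])
    then show ?thesis by (rule Bochner_Integration.integrable_cong[THEN iffD1, rotated -1])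
        (auto simp: indicator_def that(2) not_le)
  qed
  define \<kappa> where "\<kappa> i = (2 * pi * (of_int (k $ i) / L))\<^sup>2" for i
  have fz: "(LINT x|lborel. wave L k x * u2 i x + of_real (\<kappa> i) * (wave L k x * cutfun x)) = 0" for i
    unfolding \<kappa>_def
    by (rule dd_fourier[OF d1 d2 _ cu1 cu2, where R
        = R]) (auto intro!: continuous_intros simp: supp cut_outside R)
  have fi: "(LINT x|lborel. wave L k x * u2 i x)
      = - of_real (\<kappa> i) * (LINT x|lborel. wave L k x * cutfun x)" for i
  proof -
    have "(LINT x|lborel. wave L k x * u2 i x)
        + (LINT x|lborel. of_real (\<kappa> i) * (wave L k x * cutfun x)) = 0"
      using fz[of i] int[OF cu2[of i] supp(2)] int[OF continuous_on_tpoly(4) cut_outside(1)[OF R]]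
      by (subst Bochner_Integration.integral_add[symmetric]) auto
    then show ?thesis by (simp add: add_eq_0_iff)
  qed
  have lap: "cutlap x = - (\<Sum>i\<in>UNIV. u2 i x)" for x
  proof -
    have "(\<Sum>i\<in>UNIV. t2 i x) = (\<Sum>k\<in>K. \<Sum>i\<in>UNIV. c k * (wavenr L0 k i)\<^sup>2 * nwave L0 k x)"
      unfolding t2_def by (rule sum.swap)
    also have "\<dots> = (\<Sum>k\<in>K. - (of_real (nu (dual_pt L0 k)) * c k * nwave L0 k x))"
    proof (intro sum.cong refl)
      fix k :: "int^'n"
      have "(\<Sum>i\<in>UNIV. (wavenr L0 k i)\<^sup>2) = - of_real (nu (dual_pt L0 k))"
        unfolding wavenr_sq nu_dual of_real_sum sum_negf ..
      then show "(\<Sum>i\<in>UNIV. c k * (wavenr L0 k i)\<^sup>2 * nwave L0 k x)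
          = - (of_real (nu (dual_pt L0 k)) * c k * nwave L0 k x)"
        by (simp add: sum_distrib_left[symmetric] sum_distrib_right[symmetric])
    qed
    also have "\<dots> = - tlap x" by (simp add: tlap_def sum_negf)
    finally have t2s: "(\<Sum>i\<in>UNIV. t2 i x) = - tlap x" .
    have "(\<Sum>i\<in>UNIV. u2 i x) = of_real (chi R x) * (\<Sum>i\<in>UNIV. t2 i x)
        + (\<Sum>i\<in>UNIV. 2 * of_real (chi1 R i x) * tgrad i x)
       + (\<Sum>i\<in>UNIV. of_real (chi2 R i x)) * tpoly x"
      unfolding u2_def sum_distrib_left sum_distrib_right sum.distrib[symmetric]
      by (intro sum.cong refl) (simp add: algebra_simps)
    then show ?thesis unfolding t2s by (simp add: cutlap_def)
  qed
  have "(LINT x|lborel. wave L k x * cutlap x) = (LINT x|lborel. (\<Sum>i\<in>UNIV. - (wave L k x * u2 i x)))"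
    by (simp add: lap sum_distrib_left sum_negf)
  also have "\<dots> = (\<Sum>i\<in>UNIV. - (LINT x|lborel. wave L k x * u2 i x))"
    using int[OF cu2 supp(2)] by (subst Bochner_Integration.integral_sum) auto
  also have "\<dots> = (\<Sum>i\<in>UNIV. of_real (\<kappa> i) * (LINT x|lborel. wave L k x * cutfun x))" by (simp add: fi)
  also have "\<dots> = of_real (nu (dual_pt L k)) * (LINT x|lborel. wave L k x * cutfun x)"
    unfolding nu_dual \<kappa>_def by (simp add: sum_distrib_right)
  finally show ?thesis .
qed

end

section \<open>The infinite-volume limit for deterministic potentials\<close>

lemma continuous_imp_lebesgue_measurable:
  "continuous_on UNIV f \<Longrightarrow> f \<in> borel_measurable (lebesgue :: 'a::euclidean_space measure)"
  using borel_measurable_continuous_onI[of f] by (simp add: measurable_completion)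

lemma LB_l2_iff: "f \<in> l2 (LB L) \<longleftrightarrow> (\<lambda>x. indicator (box_L L) x *\<^sub>R f x) \<in> l2 lebesgue"
  and nrm_LB: "nrm (LB L) f = nrm lebesgue (\<lambda>x. indicator (box_L L) x *\<^sub>R f x)"
proof -
  have eq: "indicator (box_L L) x *\<^sub>R (cmod (f x))\<^sup>2 = (cmod (indicator (box_L L) x *\<^sub>R f x))\<^sup>2" for x
    by (simp add: indicator_def)
  show "f \<in> l2 (LB L) \<longleftrightarrow> (\<lambda>x. indicator (box_L L) x *\<^sub>R f x) \<in> l2 lebesgue"
    unfolding l2_def eq[symmetric] mem_Collect_eq
    by (subst integrable_restrict_space) (simp_all add: borel_measurable_restrict_space_iff
        set_integrable_def)
  show "nrm (LB L) f = nrm lebesgue (\<lambda>x. indicator (box_L L) x *\<^sub>R f x)"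
    unfolding nrm_def eq[symmetric] by (subst integral_restrict_space) (simp_all add:
        set_lebesgue_integral_def)
qed

lemma l2_restrict:
  assumes "f \<in> l2 lebesgue" shows "f \<in> l2 (LB L)" "nrm (LB L) f \<le> nrm lebesgue f"
proof -
  have m: "(\<lambda>x. indicator (box_L L) x *\<^sub>R f x) \<in> borel_measurable lebesgue"
    using l2_measurable[OF assms] by measurable
  have le: "cmod (indicator (box_L L) x *\<^sub>R f x) \<le> cmod (f x)" for x by (simp add: indicator_def)
  show "f \<in> l2 (LB L)" "nrm (LB L) f \<le> nrm lebesgue f"
    unfolding LB_l2_iff nrm_LB by (rule nrm_mono[OF m assms le])+
qed

lemma box_L_mono: "L0 \<le> L \<Longrightarrow> box_L L0 \<subseteq> box_L L"
  by (auto simp: box_L_def) (smt (verit) field_sum_of_halves)+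

lemma norm_imp_box: 
  assumes "L > 0" "norm x \<le> L / 8" shows "x \<in> box_L L"
  unfolding box_L_def
proof (clarify)
  fix i
  have "\<bar>x $ i\<bar> \<le> L / 8" using component_le_norm_cart[of x i] assms by linarith
  then show "- L / 2 \<le> x $ i \<and> x $ i < L / 2" using assms(1) by linarith
qed

text \<open>A function supported in the ball of radius \<open>L0 / 8\<close> has the same norm on
  every box of size at least \<open>L0\<close>. Estimates made on one torus thereby hold uniformly
  in \<open>L\<close>.\<close>

lemma nrm_cut:
  assumes f: "f \<in> borel_measurable lebesgue" and g: "g \<in> l2 (LB L0)" and L0: "L0 > 0" "L0 \<le> L"
    and c: "c \<ge> 0"
    and out: "\<And>x. norm x > L0 / 8 \<Longrightarrow> f x = 0"
    and le: "\<And>x. norm x \<le> L0 / 8 \<Longrightarrow> cmod (f x) \<le> c * cmod (g x)"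
  shows "f \<in> l2 (LB L) \<and> nrm (LB L) f \<le> c * nrm (LB L0) g"
proof
  let ?h = "\<lambda>x. indicator (box_L L) x *\<^sub>R f x"
      and ?k = "\<lambda>x. of_real c * (indicator (box_L L0) x *\<^sub>R g x)"
  have m: "?h \<in> borel_measurable lebesgue" using f by measurable
  have k: "?k \<in> l2 lebesgue" by (rule l2_cmult) (use g LB_l2_iff in blast)
  have hk: "cmod (?h x) \<le> cmod (?k x)" for x
  proof (cases "norm x \<le> L0 / 8")
    case True
    then have "x \<in> box_L L0" "x \<in> box_L L" using norm_imp_box[OF L0(1)] box_L_mono[OF L0(2)] by auto
    then show ?thesis using le[OF True] c by (simp add: norm_mult)
  next
    case False
    then show ?thesis using out c by (simp add: norm_mult)
  qed
  show "f \<in> l2 (LB L)" unfolding LB_l2_iff by (rule nrm_mono[OF m k hk])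
  have "nrm (LB L) f \<le> nrm lebesgue ?k" unfolding nrm_LB by (rule nrm_mono[OF m k hk])
  also have "\<dots> = c * nrm (LB L0) g" unfolding nrm_cmult nrm_LB using c by simp
  finally show "nrm (LB L) f \<le> c * nrm (LB L0) g" .
qed

lemma ip_nwave_lborel:
  fixes f :: "real^'n \<Rightarrow> complex"
  assumes f: "continuous_on UNIV f" "\<And>x. x \<notin> box_L L \<Longrightarrow> f x = 0"
  shows "ip (LB L) (nwave L k) f = of_real (1 / sqrt (L ^ CARD('n))) * (LINT x|lborel. wave L (- k)
      x * f x)"
proof -
  have "ip (LB L) (nwave L k) f = of_real (1 / sqrt (L ^ CARD('n))) * ip (LB L) (wave L k) f"
    unfolding nwave_def ip_cmult_left by simp
  also have "ip (LB L) (wave L k) f = (LINT x|lebesgue. indicator (box_L L) x *\<^sub>R (wave L (- k) x *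
      f x))"
    unfolding ip_def wave_cnj by (subst integral_restrict_space) (simp_all add:
        set_lebesgue_integral_def)
  also have "\<dots> = (LINT x|lebesgue. wave L (- k) x * f x)"
    by (intro Bochner_Integration.integral_cong refl) (auto simp: indicator_def f(2))
  also have "\<dots> = (LINT x|lborel. wave L (- k) x * f x)"
    using borel_measurable_continuous_onI[OF f(1)] by (intro integral_completion) simp
  finally show ?thesis .
qed

lemma nu_dual_uminus: "nu (dual_pt L (- k)) = nu (dual_pt L k)"
  unfolding nu_dual by simp

lemma norm_chi_diff: "cmod (of_real (chi R x) - 1) \<le> 1"
proof -
  have "complex_of_real (chi R x) - 1 = of_real (chi R x - 1)" by simp
  then show ?thesis using chi_bounds[of R x] by (simp only: norm_of_real abs_le_iff) simp
qed

lemma bump_tendsto: "((\<lambda>R. chi R x) \<longlongrightarrow> 1) at_top" for x :: "real^'n"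
proof -
  have "((\<lambda>R::real. (norm x)\<^sup>2 / R\<^sup>2) \<longlongrightarrow> 0) at_top" by real_asymp
  then have "((\<lambda>R::real. (max 0 (1 - (norm x)\<^sup>2 / R\<^sup>2)) ^ 3) \<longlongrightarrow> (max 0 (1 - 0)) ^ 3) at_top"
    by (intro tendsto_power tendsto_max tendsto_diff tendsto_const)
  then show ?thesis by (simp add: chi_def bump_def)
qed

lemma cutoff_error_tendsto:
  assumes phi: "\<phi> \<in> l2 lebesgue"
  shows "((\<lambda>R. nrm lebesgue (\<lambda>x. (of_real (chi R x) - 1) * \<phi> x)) \<longlongrightarrow> 0) at_top"
proof -
  have [measurable]: "\<phi> \<in> borel_measurable lebesgue" using phi by (rule l2_measurable)
  have [measurable]: "chi R \<in> borel_measurable lebesgue" for R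
    by (intro continuous_imp_lebesgue_measurable continuous_intros)
  have "((\<lambda>R. LINT x|lebesgue. (cmod ((of_real (chi R x)
      - 1) * \<phi> x))\<^sup>2) \<longlongrightarrow> (LINT x|(lebesgue :: (real^'a) measure). 0)) at_top"
  proof (rule integral_dominated_convergence_at_top[where w = "\<lambda>x. (cmod (\<phi> x))\<^sup>2"])
    show "\<forall>\<^sub>F R in at_top. AE x in lebesgue. norm ((cmod ((of_real (chi R x) - 1) * \<phi> x))\<^sup>2)
        \<le> (cmod (\<phi> x))\<^sup>2"
    proof (intro always_eventually allI AE_I2)
      fix R :: real and x :: "real^'a"
      have "(cmod (of_real (chi R x) - 1))\<^sup>2 * (cmod (\<phi> x))\<^sup>2 \<le> 1 * (cmod (\<phi> x))\<^sup>2"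
        using norm_chi_diff[of R x] by (intro mult_right_mono) (auto simp: power_le_one)
      then show "norm ((cmod ((of_real (chi R x) - 1) * \<phi> x))\<^sup>2) \<le> (cmod (\<phi> x))\<^sup>2"
        by (simp add: norm_mult power_mult_distrib)
    qed
    show "AE x in lebesgue. ((\<lambda>R. (cmod ((of_real (chi R x) - 1) * \<phi> x))\<^sup>2) \<longlongrightarrow> 0) at_top"
    proof (rule AE_I2)
      fix x :: "real^'a"
      have "((\<lambda>R. (cmod ((of_real (chi R x) - 1) * \<phi> x))\<^sup>2) \<longlongrightarrow> (cmod ((of_real 1 - 1) * \<phi> x))\<^sup>2) at_top"
        by (intro tendsto_intros bump_tendsto)
      then show "((\<lambda>R. (cmod ((of_real (chi R x) - 1) * \<phi> x))\<^sup>2) \<longlongrightarrow> 0) at_top" by simp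
    qed
    show "integrable lebesgue (\<lambda>x. (cmod (\<phi> x))\<^sup>2)" using phi by (rule l2_square_integrable)
  qed measurable
  then have "((\<lambda>R. sqrt (LINT x|lebesgue. (cmod ((of_real (chi R x) - 1) * \<phi> x))\<^sup>2)) \<longlongrightarrow> sqrt 0) at_top"
    by (intro tendsto_real_sqrt) simp
  then show ?thesis by (simp add: nrm_def)
qed

text \<open>The deterministic content of the almost sure event. \<open>V_bdd\<close> makes each
  operator well defined, with a bound that may depend on \<open>L\<close> in any way; the
  quantitative input is the linear growth in the ball of radius \<open>L / 8\<close> and, in
  \<open>V_local\<close>, stability under enlarging the box, uniformly in the larger size. The
  margin between the radius \<open>L / 8\<close> and the faces of the box keeps the periodization
  invisible near the center.\<close>

locale finite_volume =
  fixes V :: "real \<Rightarrow> real^'n \<Rightarrow> real" and L1 Kc :: real and \<delta> :: "real \<Rightarrow> real"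
  assumes L1_pos: "L1 > 0"
    and V_meas: "L \<ge> L1 \<Longrightarrow> V L \<in> borel_measurable borel"
    and V_bdd: "L \<ge> L1 \<Longrightarrow> \<exists>b. \<forall>x\<in>box_L L. \<bar>V L x\<bar> \<le> b"
    and V_growth: "L \<ge> L1 \<Longrightarrow> norm x \<le> L / 8 \<Longrightarrow> \<bar>V L x\<bar> \<le> Kc * L"
    and V_local: "L0 \<ge> L1 \<Longrightarrow> L \<ge> L0 \<Longrightarrow> norm x \<le> L0 / 8 \<Longrightarrow> \<bar>V L x - V L0 x\<bar> \<le> \<delta> L0"
    and \<delta>_lim: "(\<delta> \<longlongrightarrow> 0) at_top"
begin

lemma Kc_nonneg: "Kc \<ge> 0"
proof -
  have "0 \<le> Kc * L1" using V_growth[of L1 0] L1_pos by (intro order_trans[OF abs_ge_zero]) auto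
  then show ?thesis using L1_pos by (simp add: zero_le_mult_iff)
qed

text \<open>On the torus of size \<open>L0\<close> the potential is replaced by zero outside the support of the
  cutoff; this changes nothing after multiplication with the cutoff and makes it \<open>O(L0)\<close>.
  The gradient of \<open>t\<close> is then \<open>O(sqrt L0)\<close>, which the gradient \<open>O(1 / L0)\<close> of the cutoff
  compensates.\<close>

lemma resolvent_core_scale:
  assumes phi: "\<phi> \<in> l2 lebesgue" and z: "\<bar>Im z\<bar> = 1" "cmod z = 1" and eps: "\<epsilon> > 0"
    and L0: "L0 \<ge> L1" and G: "G = nrm lebesgue \<phi> + 1"
    and sm1: "nrm lebesgue (\<lambda>x. (of_real (chi (L0 / 8) x) - 1) * \<phi> x) \<le> \<epsilon> / 5"
    and sm2: "CARD('n) * (2 * (6 / (L0 / 8)) * (sqrt (Kc * L0 + 2) * G)) \<le> \<epsilon> / 5"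
    and sm3: "CARD('n) * (30 / (L0 / 8)\<^sup>2) * G \<le> \<epsilon> / 5"
    and sm4: "\<delta> L0 * G \<le> \<epsilon> / 5"
  shows "\<exists>u w. continuous_on UNIV u \<and> continuous_on UNIV w \<and> (\<forall>x. norm x > L0 / 8 \<longrightarrow> u x = 0 \<and> w x = 0) \<and>
     (\<forall>L\<ge>L0. (\<forall>k. ip (LB L) (nwave L k) w = of_real (nu (dual_pt L k)) * ip (LB L) (nwave L k) u) \<and>
        nrm (LB L) (\<lambda>x. w x + of_real (V L x) * u x - z * u x - \<phi> x) \<le> \<epsilon>)"
proof -
  define R where "R = L0 / 8"
  have L0p: "L0 > 0" using L0 L1_pos by simp
  then have R: "R > 0" by (simp add: R_def)
  define b where "b = Kc * L0"
  have b: "b \<ge> 0" using Kc_nonneg L0p by (simp add: b_def)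
  define W where "W x = (if norm x \<le> R then V L0 x else 0)" for x
  have Vm [measurable]: "V L \<in> borel_measurable borel" if "L \<ge> L0" for L using V_meas L0 that by simp
  have Wm: "W \<in> borel_measurable borel" unfolding W_def using Vm[OF order_refl] by measurable
  have Wb: "\<bar>W x\<bar> \<le> b" for x
    using V_growth[OF L0, of x] b by (auto simp: W_def R_def b_def)
  interpret spectral_basis "LB L0" "nwave L0 :: int^'n \<Rightarrow> _" "\<lambda>k. nu (dual_pt L0 k)"
    by (rule spectral_basis_nwave[OF L0p])
  interpret schroedinger "LB L0" "nwave L0 :: int^'n \<Rightarrow> _" "\<lambda>k. nu (dual_pt L0 k)" W b
    by unfold_locales (use Wm Wb b in \<open>auto intro: borel_imp_LB_measurable\<close>)
  have phi0 [simp]: "\<phi> \<in> l2 (LB L0)" and phi_n: "nrm (LB L0) \<phi> \<le> nrm lebesgue \<phi>"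
    using l2_restrict[OF phi] by auto
  have z0: "Im z \<noteq> 0" using z by auto
  \<comment> \<open>The accuracy \<open>\<epsilon> / 5\<close> is this term's share of the final
    error; the accuracy 1 yields \<open>nrm (LB L0) r \<le> G\<close>, which makes all later bounds
    independent of the polynomial.\<close>
  obtain K c where K: "finite K" and res: "nrm (LB L0) (\<lambda>x. tlap L0 K c x
      + of_real (W x) * tpoly L0 K c x
       - z * tpoly L0 K c x - \<phi> x) < min (\<epsilon> / 5) 1"
    unfolding tlap_def tpoly_def using dense_range[OF phi0 z0, of "min (\<epsilon> / 5) 1"] eps by auto
  define t where "t = tpoly L0 K c"
  define q where "q = tlap L0 K c"
  define g where "g i = tgrad L0 K c i" for i
  have [simp]: "t \<in> l2 (LB L0)" "q \<in> l2 (LB L0)" "g i \<in> l2 (LB L0)" for i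
    unfolding t_def q_def g_def tpoly_def[abs_def] tlap_def[abs_def] tgrad_def[abs_def]
        by (rule basis_sum_l2[OF orth])+
  define r where "r x = q x + of_real (W x) * t x - z * t x" for x
  have r [simp]: "r \<in> l2 (LB L0)" unfolding r_def by simp
  have rphi: "nrm (LB L0) (\<lambda>x. r x - \<phi> x) < min (\<epsilon> / 5) 1" using res by (simp add: r_def q_def t_def)
  have rG: "nrm (LB L0) r \<le> G"
    using nrm_triangle[of "\<lambda>x. r x - \<phi> x" "LB L0" \<phi>] rphi phi_n by (simp add: G)
  have tn: "nrm (LB L0) t \<le> G"
    using residual_bounds(1)[OF K, of z c] rG z
        by (simp add: t_def q_def r_def[abs_def] tpoly_def[abs_def] tlap_def[abs_def])
  have G0: "G \<ge> 0" using nrm_nonneg[of lebesgue \<phi>] G by linarith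
  have energy: "(\<Sum>k\<in>K. nu (dual_pt L0 k) * (cmod (c k))\<^sup>2) \<le> (b + 2) * G\<^sup>2"
  proof -
    have "(\<Sum>k\<in>K. nu (dual_pt L0 k) * (cmod (c k))\<^sup>2)
        \<le> nrm (LB L0) t * nrm (LB L0) r + (b + cmod z) * (nrm (LB L0) t)\<^sup>2"
      using residual_bounds(2)[OF K, of c z] by (simp add: t_def q_def r_def[abs_def]
          tpoly_def[abs_def] tlap_def[abs_def])
    also have "\<dots> \<le> G * G + (b + 1) * G\<^sup>2"
      using tn rG b z G0 by (intro add_mono mult_mono power_mono) auto
    finally show ?thesis by (simp add: power2_eq_square algebra_simps)
  qed
  have gn: "nrm (LB L0) (g i) \<le> sqrt (b + 2) * G" for i
  proof -
    have "(nrm (LB L0) (g i))\<^sup>2 = (\<Sum>k\<in>K. (cmod (c k * wavenr L0 k i))\<^sup>2)"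
      unfolding g_def tgrad_def[abs_def] by (rule nrm_basis_sum[OF orth K])
    also have "\<dots> \<le> (\<Sum>k\<in>K. nu (dual_pt L0 k) * (cmod (c k))\<^sup>2)"
    proof (rule sum_mono)
      fix k
      have "(cmod (wavenr L0 k i))\<^sup>2 \<le> nu (dual_pt L0 k)"
        unfolding norm_wavenr nu_dual power2_abs by (rule member_le_sum) auto
      then show "(cmod (c k * wavenr L0 k i))\<^sup>2 \<le> nu (dual_pt L0 k) * (cmod (c k))\<^sup>2"
        by (simp add: norm_mult power_mult_distrib mult.commute[of "(cmod (c k))\<^sup>2"] mult_right_mono)
    qed
    also have "\<dots> \<le> (b + 2) * G\<^sup>2" by (rule energy)
    also have "\<dots> = (sqrt (b + 2) * G)\<^sup>2" using b by (simp add: power_mult_distrib)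
    finally show ?thesis by (rule power2_le_imp_le) (use G0 b in simp)
  qed
  define u where "u = cutfun L0 R K c"
  define w where "w = cutlap L0 R K c"
  have cont: "continuous_on UNIV u" "continuous_on UNIV w"
    unfolding u_def w_def by (intro continuous_intros)+
  have out: "norm x > R \<Longrightarrow> u x = 0 \<and> w x = 0" for x
    unfolding u_def w_def using cut_outside[OF R] by blast
  have main: "nrm (LB L) (\<lambda>x. w x + of_real (V L x) * u x - z * u x - \<phi> x) \<le> \<epsilon>" if L: "L \<ge> L0" for L
  proof -
    have [measurable]: "\<phi> \<in> borel_measurable lebesgue" using phi by (rule l2_measurable)
    have lm [measurable]: "f \<in> borel_measurable lebesgue" if "continuous_on UNIV f"
        for f :: "real^'n \<Rightarrow> complex"
      using that by (rule continuous_imp_lebesgue_measurable)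
    have [measurable]: "chi R \<in> borel_measurable lebesgue" "chi1 R i \<in> borel_measurable lebesgue"
        "chi2 R i \<in> borel_measurable lebesgue" for i
      by (intro continuous_imp_lebesgue_measurable continuous_intros)+
    have [measurable]: "t \<in> borel_measurable lebesgue" "q \<in> borel_measurable lebesgue" "g i \<in>
        borel_measurable lebesgue" for i
      unfolding t_def q_def g_def by (intro lm continuous_intros)+
    have [measurable]: "W \<in> borel_measurable lebesgue" "V L \<in> borel_measurable lebesgue"
      using Wm Vm[OF L] by (auto intro: measurable_completion)
    \<comment> \<open>The residual splits into five parts, each allotted
      \<open>\<epsilon> / 5\<close>: the residual on the small torus, the part of
      \<open>\<phi>\<close> removed by the cutoff, the first and second order commutator terms, and
      the change of the potential between the sizes.\<close>
    define A where "A x = of_real (chi R x) * (r x - \<phi> x)" for x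
    define B where "B x = (of_real (chi R x) - 1) * \<phi> x" for x
    define C where "C i x = 2 * of_real (chi1 R i x) * g i x" for i x
    define D2 where "D2 x = (\<Sum>i\<in>UNIV. of_real (chi2 R i x)) * t x" for x
    define E where "E x = of_real (chi R x) * of_real (V L x - W x) * t x" for x
    have A: "A \<in> l2 (LB L) \<and> nrm (LB L) A \<le> 1 * nrm (LB L0) (\<lambda>x. r x - \<phi> x)"
    proof (rule nrm_cut[OF _ _ L0p L])
      show "A \<in> borel_measurable lebesgue" unfolding A_def r_def by measurable
      show "cmod (A x) \<le> 1 * cmod (r x - \<phi> x)" for x
        using chi_bounds[of R x] by (simp add: A_def norm_mult mult_left_le_one_le)
    qed (use chi_outside[OF R] in \<open>auto simp: A_def R_def\<close>)
    note A = A[THEN conjunct1] A[THEN conjunct2]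
    have B: "B \<in> l2 (LB L)" "nrm (LB L) B \<le> \<epsilon> / 5"
    proof -
      have "B \<in> l2 lebesgue" unfolding B_def
      proof (rule l2_mult_bounded[OF phi])
        show "cmod (of_real (chi R x) - 1) \<le> 1" for x
          by (rule norm_chi_diff)
      qed measurable
      then show "B \<in> l2 (LB L)" "nrm (LB L) B \<le> \<epsilon> / 5"
        using l2_restrict[of B L] sm1 unfolding R_def[symmetric] B_def[symmetric] by auto
    qed
    have C: "C i \<in> l2 (LB L) \<and> nrm (LB L) (C i) \<le> 2 * (6 / R) * nrm (LB L0) (g i)" for i
    proof (rule nrm_cut[OF _ _ L0p L])
      show "C i \<in> borel_measurable lebesgue" unfolding C_def by measurable
      show "cmod (C i x) \<le> 2 * (6 / R) * cmod (g i x)" for x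
        using mult_right_mono[OF chi1_bound[OF R, of i x], of "2 * cmod (g i x)"]
            by (simp add: C_def norm_mult)
    qed (use chi_outside[OF R] R in \<open>auto simp: C_def R_def\<close>)
    note C = C[THEN conjunct1] C[THEN conjunct2]
    have D2: "D2 \<in> l2 (LB L) \<and> nrm (LB L) D2 \<le> CARD('n) * (30 / R\<^sup>2) * nrm (LB L0) t"
    proof (rule nrm_cut[OF _ _ L0p L])
      show "D2 \<in> borel_measurable lebesgue" unfolding D2_def by measurable
      show "cmod (D2 x) \<le> CARD('n) * (30 / R\<^sup>2) * cmod (t x)" for x
      proof -
        have "cmod (\<Sum>i\<in>UNIV. of_real (chi2 R i x)) \<le> (\<Sum>i\<in>(UNIV :: 'n set). 30 / R\<^sup>2)"
          by (rule sum_norm_le) (use chi2_bound[OF R] in auto)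
        then have "cmod (\<Sum>i\<in>UNIV. of_real (chi2 R i x)) * cmod (t x)
            \<le> CARD('n) * (30 / R\<^sup>2) * cmod (t x)"
          by (intro mult_right_mono) auto
        then show ?thesis by (simp add: D2_def norm_mult)
      qed
    qed (use chi_outside[OF R] R in \<open>auto simp: D2_def R_def intro!: sum.neutral\<close>)
    note D2 = D2[THEN conjunct1] D2[THEN conjunct2]
    have dpos: "\<delta> L0 \<ge> 0" using V_local[OF L0 order_refl, of 0] L0p by simp
    have E: "E \<in> l2 (LB L) \<and> nrm (LB L) E \<le> \<delta> L0 * nrm (LB L0) t"
    proof (rule nrm_cut[OF _ _ L0p L])
      show "E \<in> borel_measurable lebesgue" unfolding E_def by measurable
      show "cmod (E x) \<le> \<delta> L0 * cmod (t x)" if x: "norm x \<le> L0 / 8" for x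
      proof -
        have "\<bar>V L x - W x\<bar> \<le> \<delta> L0" using V_local[OF L0 L x] x by (simp add: W_def R_def)
        then have "chi R x * \<bar>V L x - W x\<bar> \<le> 1 * \<delta> L0"
          using chi_bounds[of R x] by (intro mult_mono) auto
        then have "chi R x * \<bar>V L x - W x\<bar> * cmod (t x) \<le> \<delta> L0 * cmod (t x)"
          by (intro mult_right_mono) auto
        then show ?thesis using chi_bounds[of R x] by (simp add: E_def norm_mult del: of_real_diff)
      qed
    qed (use chi_outside[OF R] dpos in \<open>auto simp: E_def R_def\<close>)
    note E = E[THEN conjunct1] E[THEN conjunct2]
    have dec: "w x + of_real (V L x) * u x - z * u x - \<phi> x
        = (((A x + B x) - (\<Sum>i\<in>UNIV. C i x)) - D2 x) + E x" for x
      unfolding w_def u_def cutlap_def cutfun_def A_def B_def C_def D2_def E_def r_def t_def q_def g_def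
      by (simp add: algebra_simps)
    have CS: "(\<lambda>x. \<Sum>i\<in>UNIV. C i x) \<in> l2 (LB L)" by (rule l2_sum) (rule C)
    have "nrm (LB L) (\<lambda>x. w x + of_real (V L x) * u x - z * u x - \<phi> x)
       \<le> nrm (LB L) (\<lambda>x. ((A x + B x) - (\<Sum>i\<in>UNIV. C i x)) - D2 x) + nrm (LB L) E"
      unfolding dec by (rule nrm_triangle) (use A B CS D2 E in auto)
    also have "nrm (LB L) (\<lambda>x. ((A x + B x) - (\<Sum>i\<in>UNIV. C i x)) - D2 x)
        \<le> nrm (LB L) (\<lambda>x. (A x + B x) - (\<Sum>i\<in>UNIV. C i x)) + nrm (LB L) D2"
      by (rule nrm_triangle_diff) (use A B CS D2 E in auto)
    also have "nrm (LB L) (\<lambda>x. (A x + B x) - (\<Sum>i\<in>UNIV. C i x))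
        \<le> nrm (LB L) (\<lambda>x. A x + B x) + nrm (LB L) (\<lambda>x. \<Sum>i\<in>UNIV. C i x)"
      by (rule nrm_triangle_diff) (use A B CS D2 E in auto)
    also have "nrm (LB L) (\<lambda>x. A x + B x) \<le> nrm (LB L) A + nrm (LB L) B"
      by (rule nrm_triangle) (use A B CS D2 E in auto)
    also have "nrm (LB L) (\<lambda>x. \<Sum>i\<in>UNIV. C i x) \<le> (\<Sum>i\<in>UNIV. nrm (LB L) (C i))"
      by (rule nrm_sum_le) (rule C)
    finally have fin: "nrm (LB L) (\<lambda>x. w x + of_real (V L x) * u x - z * u x - \<phi> x)
      \<le> nrm (LB L) A + nrm (LB L) B + (\<Sum>i\<in>UNIV. nrm (LB L) (C i)) + nrm (LB L) D2 + nrm (LB L) E"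
          by simp
    have "(\<Sum>i\<in>UNIV. nrm (LB L) (C i)) \<le> (\<Sum>i\<in>(UNIV :: 'n set). 2 * (6 / R) * (sqrt (b + 2) * G))"
    proof (rule sum_mono)
      fix i
      have "2 * (6 / R) * nrm (LB L0) (g i) \<le> 2 * (6 / R) * (sqrt (b + 2) * G)"
        using gn[of i] R by (intro mult_left_mono) auto
      then show "nrm (LB L) (C i) \<le> 2 * (6 / R) * (sqrt (b + 2) * G)" using C(2)[of i] by linarith
    qed
    also have "\<dots> = CARD('n) * (2 * (6 / R) * (sqrt (b + 2) * G))" by simp
    also have "\<dots> \<le> \<epsilon> / 5" using sm2 by (simp add: R_def b_def)
    finally have c1: "(\<Sum>i\<in>UNIV. nrm (LB L) (C i)) \<le> \<epsilon> / 5" .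
    have "CARD('n) * (30 / R\<^sup>2) * nrm (LB L0) t \<le> CARD('n) * (30 / R\<^sup>2) * G"
      using tn by (intro mult_left_mono) auto
    also have "\<dots> \<le> \<epsilon> / 5" using sm3 by (simp only: R_def)
    finally have d1: "nrm (LB L) D2 \<le> \<epsilon> / 5" using D2(2) by linarith
    have "\<delta> L0 * nrm (LB L0) t \<le> \<delta> L0 * G" using tn dpos by (intro mult_left_mono) auto
    then have e1: "nrm (LB L) E \<le> \<epsilon> / 5" using E(2) sm4 by linarith
    have a1: "nrm (LB L) A \<le> \<epsilon> / 5" using A(2) rphi by simp
    show ?thesis using fin a1 B(2) c1 d1 e1 by linarith
  qed
  have lap: "ip (LB L) (nwave L k) w = of_real (nu (dual_pt L k)) * ip (LB L) (nwave L k) u"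
      if L: "L \<ge> L0" for L k
  proof -
    have outb: "u x = 0" "w x = 0" if "x \<notin> box_L L" for x
    proof -
      have "\<not> norm x \<le> R" using that norm_imp_box[OF L0p, of x] box_L_mono[OF L] by (auto simp: R_def)
      then show "u x = 0" "w x = 0" using out[of x] by auto
    qed
    show ?thesis
      using ip_cutlap[OF K R, of L "- k" L0 c]
          unfolding u_def[symmetric] w_def[symmetric] nu_dual_uminus
      by (simp add: ip_nwave_lborel[OF cont(1) outb(1)] ip_nwave_lborel[OF cont(2) outb(2)])
  qed
  show ?thesis using cont out main lap unfolding R_def by blast
qed


lemma resolvent_core:
  assumes phi: "\<phi> \<in> l2 lebesgue" and z: "\<bar>Im z\<bar> = 1" "cmod z = 1" and eps: "\<epsilon> > 0"
  shows "\<exists>u w L0. L0 \<ge> L1 \<and> continuous_on UNIV u \<and> continuous_on UNIV w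
      \<and> (\<forall>x. norm x > L0 / 8 \<longrightarrow> u x = 0 \<and> w x = 0) \<and>
     (\<forall>L\<ge>L0. (\<forall>k. ip (LB L) (nwave L k) w = of_real (nu (dual_pt L k)) * ip (LB L) (nwave L k) u) \<and>
        nrm (LB L) (\<lambda>x. w x + of_real (V L x) * u x - z * u x - \<phi> x) \<le> \<epsilon>)"
proof -
  define G where "G = nrm lebesgue \<phi> + 1"
  have G0: "G \<ge> 0" using nrm_nonneg[of lebesgue \<phi>] by (simp add: G_def)
  have e5: "\<epsilon> / 5 > 0" using eps by simp
  have "((\<lambda>L0. nrm lebesgue (\<lambda>x. (of_real (chi (L0 / 8) x) - 1) * \<phi> x)) \<longlongrightarrow> 0) at_top"
    by (rule filterlim_compose[OF cutoff_error_tendsto[OF phi]]) real_asymp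
  then have E1: "\<forall>\<^sub>F L0 in at_top. nrm lebesgue (\<lambda>x. (of_real (chi (L0 / 8) x) - 1) * \<phi> x) < \<epsilon> / 5"
    by (rule order_tendstoD(2)) (rule e5)
  \<comment> \<open>The 96 is \<open>2 * 6 * 8\<close> from the bound on \<open>chi1\<close> at
    radius \<open>L0 / 8\<close>. For \<open>L0 \<ge> 1\<close> the root of
    \<open>Kc * L0 + 2\<close> is at most \<open>sqrt (Kc + 2) * sqrt L0\<close>, so the commutator
    decays like \<open>sqrt L0 / L0\<close>.\<close>
  have "((\<lambda>L0::real. (CARD('n) * 96 * sqrt (Kc
      + 2) * G) * (sqrt L0 / L0)) \<longlongrightarrow> (CARD('n) * 96 * sqrt (Kc + 2) * G) * 0) at_top"
    by (intro tendsto_mult tendsto_const) real_asymp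
  then have E2: "\<forall>\<^sub>F L0 in at_top. (CARD('n) * 96 * sqrt (Kc + 2) * G) * (sqrt L0 / L0) < \<epsilon> / 5"
    by (rule order_tendstoD(2)) (simp only: mult_zero_right mult_zero_left e5)
  have "((\<lambda>L0::real. (CARD('n) * G) * (30 / (L0 / 8)\<^sup>2)) \<longlongrightarrow> (CARD('n) * G) * 0) at_top"
    by (intro tendsto_mult tendsto_const) real_asymp
  then have E3: "\<forall>\<^sub>F L0 in at_top. (CARD('n) * G) * (30 / (L0 / 8)\<^sup>2) < \<epsilon> / 5"
    by (rule order_tendstoD(2)) (simp only: mult_zero_right mult_zero_left e5)
  have "((\<lambda>L0. \<delta> L0 * G) \<longlongrightarrow> 0 * G) at_top" by (intro tendsto_mult tendsto_const \<delta>_lim)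
  then have E4: "\<forall>\<^sub>F L0 in at_top. \<delta> L0 * G < \<epsilon> / 5"
    by (rule order_tendstoD(2)) (simp only: mult_zero_right mult_zero_left e5)
  have "\<forall>\<^sub>F L0 in at_top. L0 \<ge> max L1 1 \<and> nrm lebesgue (\<lambda>x. (of_real (chi (L0 / 8) x)
      - 1) * \<phi> x) < \<epsilon> / 5 \<and>
     (CARD('n) * 96 * sqrt (Kc + 2) * G) * (sqrt L0 / L0) < \<epsilon> / 5 \<and>
     (CARD('n) * G) * (30 / (L0 / 8)\<^sup>2) < \<epsilon> / 5 \<and> \<delta> L0 * G < \<epsilon> / 5"
    by (intro eventually_conj E1 E2 E3 E4 eventually_ge_at_top)
  then obtain L0 where L0: "L0 \<ge> L1" "L0 \<ge> 1"
      and e: "nrm lebesgue (\<lambda>x. (of_real (chi (L0 / 8) x) - 1) * \<phi> x) < \<epsilon> / 5"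
     "(CARD('n) * 96 * sqrt (Kc + 2) * G) * (sqrt L0 / L0) < \<epsilon> / 5"
     "(CARD('n) * G) * (30 / (L0 / 8)\<^sup>2) < \<epsilon> / 5" "\<delta> L0 * G < \<epsilon> / 5"
    by (auto simp: eventually_at_top_linorder)
  have "sqrt (Kc * L0 + 2) \<le> sqrt ((Kc + 2) * L0)" using L0 by (simp add: algebra_simps)
  also have "\<dots> = sqrt (Kc + 2) * sqrt L0" by (rule real_sqrt_mult)
  finally have "CARD('n) * (2 * (6 / (L0 / 8)) * (sqrt (Kc * L0 + 2) * G))
      \<le> CARD('n) * (2 * (6 / (L0 / 8)) * (sqrt (Kc + 2) * sqrt L0 * G))"
    using L0 G0 by (intro mult_left_mono mult_right_mono) auto
  also have "\<dots> = (CARD('n) * 96 * sqrt (Kc + 2) * G) * (sqrt L0 / L0)" by simp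
  finally have e2: "CARD('n) * (2 * (6 / (L0 / 8)) * (sqrt (Kc * L0 + 2) * G)) \<le> \<epsilon> / 5" using e(2)
      by linarith
  have e3: "CARD('n) * (30 / (L0 / 8)\<^sup>2) * G \<le> \<epsilon> / 5" using e(3) by (simp add: ac_simps)
  show ?thesis
    using resolvent_core_scale[OF phi z eps L0(1) G_def less_imp_le[OF e(1)] e2 e3 less_imp_le[OF
        e(4)]] L0(1) by blast
qed

section \<open>Spectral data of the operators on the boxes\<close>

definition specE :: "real \<Rightarrow> nat \<Rightarrow> real" where
  "specE L = fst (SOME EP. eig_onb L (V L) (fst EP) (snd EP))"

definition specpsi :: "real \<Rightarrow> nat \<Rightarrow> real^'n \<Rightarrow> complex" where
  "specpsi L = snd (SOME EP. eig_onb L (V L) (fst EP) (snd EP))"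

lemma schroedinger_V:
  assumes L: "L \<ge> L1"
  obtains b where "schroedinger (LB L) (nwave L :: int^'n \<Rightarrow> _) (\<lambda>k. nu (dual_pt L k)) (V L) b"
proof -
  obtain b where b: "\<And>x. x \<in> box_L L \<Longrightarrow> \<bar>V L x\<bar> \<le> b" using V_bdd[OF L] by blast
  have Lp: "L > 0" using L L1_pos by simp
  have "0 \<in> box_L L" using norm_imp_box[OF Lp, of 0] Lp by simp
  then have b0: "b \<ge> 0" using order_trans[OF abs_ge_zero b] by blast
  have "schroedinger (LB L) (nwave L :: int^'n \<Rightarrow> _) (\<lambda>k. nu (dual_pt L k)) (V L) b"
    by (intro schroedinger.intro spectral_basis_nwave[OF Lp] schroedinger_axioms.intro
        borel_imp_LB_measurable V_meas L)
       (use b b0 in auto)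
  then show ?thesis by (rule that)
qed

text \<open>The domain condition of \<open>is_eig\<close> is not part of \<open>H\<close> but
  follows from Bessel: \<open>nu\<close> times a coefficient of \<open>\<psi>\<close> is a
  coefficient of the square-integrable function \<open>E * \<psi> - W * \<psi>\<close>.\<close>

lemma is_eig_iff_H:
  assumes L: "L > 0" and s: "schroedinger (LB L) (nwave L :: int^'n \<Rightarrow> _) (\<lambda>k. nu (dual_pt L k)) W b"
  shows "is_eig L W \<psi> E \<longleftrightarrow> schroedinger.H (LB L) (nwave L) (\<lambda>k. nu (dual_pt L k)) W \<psi> (\<lambda>x. of_real E
      * \<psi> x)"
proof -
  interpret schroedinger "LB L" "nwave L :: int^'n \<Rightarrow> _" "\<lambda>k. nu (dual_pt L k)" W b by (rule s)
  define S where "S = complex_of_real (sqrt (L ^ CARD('n)))"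
  have S: "S \<noteq> 0" using L by (simp add: S_def)
  have fc: "fcoef L g k = S * ip (LB L) (nwave L k) g" for g and k :: "int^'n"
    unfolding S_def by (rule fcoef_eq[OF L])
  have eqs: "of_real (nu (dual_pt L k)) * fcoef L \<psi> k + fcoef L (\<lambda>x. of_real (W x) * \<psi> x) k
      = of_real E * fcoef L \<psi> k \<longleftrightarrow>
     ip (LB L) (nwave L k) (\<lambda>x. of_real E * \<psi> x)
         = of_real (nu (dual_pt L k)) * ip (LB L) (nwave L k) \<psi>
         + ip (LB L) (nwave L k) (\<lambda>x. of_real (W x) * \<psi> x)" for k
  proof -
    have "of_real (nu (dual_pt L k)) * fcoef L \<psi> k + fcoef L (\<lambda>x. of_real (W x) * \<psi> x) k
        = S * (of_real (nu (dual_pt L k)) * ip (LB L) (nwave L k) \<psi>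
        + ip (LB L) (nwave L k) (\<lambda>x. of_real (W x) * \<psi> x))"
      by (simp add: fc algebra_simps)
    moreover have "of_real E * fcoef L \<psi> k = S * ip (LB L) (nwave L k) (\<lambda>x. of_real E * \<psi> x)"
      by (simp add: fc ip_cmult_right)
    ultimately show ?thesis by (simp only: mult_cancel_left) (use S in auto)
  qed
  have summ: "(\<lambda>k. (cmod (of_real (nu (dual_pt L k)) * fcoef L \<psi> k))\<^sup>2) summable_on UNIV"
      if H: "H \<psi> (\<lambda>x. of_real E * \<psi> x)"
  proof -
    note D = H_energy(1)[OF H]
    have "(\<lambda>k. (cmod S)\<^sup>2 * (cmod (ip (LB L) (nwave L k) (\<lambda>x. of_real E * \<psi> x
        - of_real (W x) * \<psi> x)))\<^sup>2) summable_on UNIV"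
      by (intro summable_on_cmult_right bessel_summable[OF orth] D_l2[OF D])
    moreover have "(cmod S)\<^sup>2 * (cmod (ip (LB L) (nwave L k) (\<lambda>x. of_real E * \<psi> x
        - of_real (W x) * \<psi> x)))\<^sup>2 = (cmod (of_real (nu (dual_pt L k)) * fcoef L \<psi> k))\<^sup>2" for k
      unfolding D_ip[OF D] fc by (simp add: norm_mult power_mult_distrib)
    ultimately show ?thesis by simp
  qed
  show ?thesis
  proof
    assume "is_eig L W \<psi> E"
    then show "H \<psi> (\<lambda>x. of_real E * \<psi> x)"
      unfolding is_eig_def lap_dom_def H_def L2_L_iff eqs by simp
  next
    assume H: "H \<psi> (\<lambda>x. of_real E * \<psi> x)"
    then show "is_eig L W \<psi> E"
      unfolding is_eig_def lap_dom_def L2_L_iff eqs using summ[OF H] by (simp add: H_def)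
  qed
qed

text \<open>\<open>fc_quad\<close> takes whatever eigenbasis \<open>SOME\<close> returns; existence
  of one, from \<open>eigenbasis\<close>, gives the selected one its defining properties.\<close>

lemma spec_eig_onb:
  assumes L: "L \<ge> L1" shows "eig_onb L (V L) (specE L) (specpsi L)"
proof -
  have Lp: "L > 0" using L L1_pos by simp
  obtain b where s: "schroedinger (LB L) (nwave L :: int^'n \<Rightarrow> _) (\<lambda>k. nu (dual_pt L k)) (V L) b"
    using schroedinger_V[OF L] .
  interpret schroedinger "LB L" "nwave L :: int^'n \<Rightarrow> _" "\<lambda>k. nu (dual_pt L k)" "V L" b by (rule s)
  obtain E :: "nat \<Rightarrow> real" and \<psi> where *: "\<And>n. H (\<psi> n) (\<lambda>x. of_real (E n) * \<psi> n x)" "orthonormal (LB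
      L) \<psi>" "total (LB L) \<psi>"
    using eigenbasis by blast
  have "eig_onb L (V L) E \<psi>"
    unfolding eig_onb_def is_eig_iff_H[OF Lp s]
  proof (intro conjI allI impI)
    fix g assume "L2_L L g \<and> (\<forall>n. ip_L L (\<psi> n) g = 0)"
    then have "AE x in LB L. g x = 0" using *(3) by (simp add: total_def L2_L_iff ip_L_eq)
    then show "AE x in lebesgue. x \<in> box_L L \<longrightarrow> g x = 0" by (subst (asm) AE_restrict_space_iff) auto
  qed (use * in \<open>auto simp: ip_L_eq orthonormal_ip\<close>)
  then have "eig_onb L (V L) (fst (E, \<psi>)) (snd (E, \<psi>))" by simp
  then have "eig_onb L (V L) (fst (SOME EP. eig_onb L (V L) (fst EP) (snd EP))) (snd (SOME EP.
      eig_onb L (V L) (fst EP) (snd EP)))"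
    by (rule someI[where P = "\<lambda>EP. eig_onb L (V L) (fst EP) (snd EP)"])
  then show ?thesis by (simp add: specE_def specpsi_def)
qed

lemma spec_orthonormal: "L \<ge> L1 \<Longrightarrow> orthonormal (LB L) (specpsi L)"
  and spec_total: "L \<ge> L1 \<Longrightarrow> total (LB L) (specpsi L)"
proof -
  assume L: "L \<ge> L1"
  note s = spec_eig_onb[OF L, unfolded eig_onb_def]
  have Lp: "L > 0" using L L1_pos by simp
  show "orthonormal (LB L) (specpsi L)"
    using s by (auto simp: orthonormal_def ip_L_eq is_eig_def lap_dom_def L2_L_iff)
  show "total (LB L) (specpsi L)"
    unfolding total_def
  proof (intro ballI impI)
    fix g assume "g \<in> l2 (LB L)" "\<forall>k. ip (LB L) (specpsi L k) g = 0"
    then have "AE x in lebesgue. x \<in> box_L L \<longrightarrow> g x = 0" using s by (simp add: L2_L_iff ip_L_eq)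
    then show "AE x in LB L. g x = 0" by (subst AE_restrict_space_iff) auto
  qed
qed

definition coef :: "real \<Rightarrow> nat \<Rightarrow> (real^'n \<Rightarrow> complex) \<Rightarrow> complex" where
  "coef L n g = ip (LB L) (specpsi L n) g"

lemma fc_quad_eq: "fc_quad L (V L) f \<phi> = (\<Sum>n. f (specE L n) * of_real ((cmod (coef L n \<phi>))\<^sup>2))"
  by (simp add: fc_quad_def Let_def specE_def specpsi_def coef_def ip_L_eq)

text \<open>Symmetry moves the operator from \<open>u\<close> onto the eigenfunction. The Laplacian
  of \<open>u\<close> is passed as a separate function \<open>w\<close> because
  \<open>resolvent_core\<close> supplies one such pair for all \<open>L\<close> at once.\<close>

lemma spec_intertwine:
  assumes L: "L \<ge> L1" and u: "u \<in> l2 (LB L)" "w \<in> l2 (LB L)"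
    and uw: "\<And>k. ip (LB L) (nwave L k) w = of_real (nu (dual_pt L k)) * ip (LB L) (nwave L k) u"
  shows "coef L n (\<lambda>x. w x + of_real (V L x) * u x) = of_real (specE L n) * coef L n u"
proof -
  have Lp: "L > 0" using L L1_pos by simp
  obtain b where s: "schroedinger (LB L) (nwave L :: int^'n \<Rightarrow> _) (\<lambda>k. nu (dual_pt L k)) (V L) b"
    using schroedinger_V[OF L] .
  interpret schroedinger "LB L" "nwave L :: int^'n \<Rightarrow> _" "\<lambda>k. nu (dual_pt L k)" "V L" b by (rule s)
  have "H (specpsi L n) (\<lambda>x. of_real (specE L n) * specpsi L n x)"
    using spec_eig_onb[OF L] unfolding eig_onb_def is_eig_iff_H[OF Lp s] by blast
  moreover have "H u (\<lambda>x. w x + of_real (V L x) * u x)"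
    using u by (simp add: H_def ip_add_right uw)
  ultimately have "ip (LB L) (specpsi L n) (\<lambda>x. w x + of_real (V L x) * u x)
      = ip (LB L) (\<lambda>x. of_real (specE L n) * specpsi L n x) u"
    by (rule H_symmetric)
  then show ?thesis by (simp add: coef_def ip_cmult_left)
qed

lemma coef_bessel:
  assumes "L \<ge> L1" "g \<in> l2 (LB L)" shows "(\<Sum>n<N. (cmod (coef L n g))\<^sup>2) \<le> (nrm (LB L) g)\<^sup>2"
  unfolding coef_def by (rule bessel_finite[OF spec_orthonormal[OF assms(1)] assms(2)]) simp

section \<open>The algebra of functions with a strong limit\<close>

definition deviation :: "real \<Rightarrow> nat \<Rightarrow> (real^'n \<Rightarrow> complex) \<Rightarrow> (real \<Rightarrow> complex) \<Rightarrow> (real^'n \<Rightarrow> complex) \<Rightarrow>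
    complex" where
  "deviation L n u r \<phi> = coef L n u - r (specE L n) * coef L n \<phi>"

text \<open>Applied to \<open>deviation\<close>, the coefficients of
  \<open>u - r(H L) \<phi>\<close> in the eigenbasis, this bounds a squared norm by
  \<open>\<epsilon>\<close> for all large \<open>L\<close>. Partial sums avoid a separate
  summability claim and match the finite form of Bessel's inequality.\<close>

definition eventually_small :: "(real \<Rightarrow> nat \<Rightarrow> complex) \<Rightarrow> real \<Rightarrow> bool" where
  "eventually_small x \<epsilon> \<longleftrightarrow> (\<forall>\<^sub>F L in at_top. \<forall>N. (\<Sum>n<N. (cmod (x L n))\<^sup>2) \<le> \<epsilon>)"

text \<open>The functions \<open>r\<close> for which \<open>r(H L) \<phi>\<close> has a strong limit, expressed without naming the limit.\<close>

definition converging :: "(real \<Rightarrow> complex) \<Rightarrow> bool" where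
  "converging r \<longleftrightarrow> (\<exists>b. \<forall>x. cmod (r x) \<le> b) \<and>
     (\<forall>\<phi>\<in>l2 lebesgue. \<forall>\<epsilon>>0. \<exists>u\<in>l2 lebesgue. eventually_small (\<lambda>L n. deviation L n u r \<phi>) \<epsilon>)"

lemma convergingD:
  assumes "converging r" "\<phi> \<in> l2 lebesgue" "\<epsilon> > 0"
  obtains u where "u \<in> l2 lebesgue" "eventually_small (\<lambda>L n. deviation L n u r \<phi>) \<epsilon>"
  using assms unfolding converging_def by blast

text \<open>Working with squares costs a factor 2 in the triangle inequality; hence the quarters of
  \<open>\<epsilon>\<close> in what follows.\<close>

lemma eventually_small_add:
  assumes x: "eventually_small x A" and y: "eventually_small y B"
    and w: "\<forall>\<^sub>F L in at_top. \<forall>n. w L n = x L n + y L n" and le: "2 * A + 2 * B \<le> \<epsilon>"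
  shows "eventually_small w \<epsilon>"
  unfolding eventually_small_def
  using x[unfolded eventually_small_def] y[unfolded eventually_small_def] w
proof eventually_elim
  case (elim L)
  show ?case
  proof
    fix N
    have "(\<Sum>n<N. (cmod (w L n))\<^sup>2) \<le> (\<Sum>n<N. 2 * (cmod (x L n))\<^sup>2 + 2 * (cmod (y L n))\<^sup>2)"
      using elim(3) by (intro sum_mono) (simp only: sum_sq_le)
    also have "\<dots> = 2 * (\<Sum>n<N. (cmod (x L n))\<^sup>2) + 2 * (\<Sum>n<N. (cmod (y L n))\<^sup>2)"
      by (simp add: sum.distrib sum_distrib_left)
    also have "\<dots> \<le> 2 * A + 2 * B" using elim by (intro add_mono mult_left_mono) auto
    finally show "(\<Sum>n<N. (cmod (w L n))\<^sup>2) \<le> \<epsilon>" using le by linarith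
  qed
qed

lemma eventually_small_mult:
  assumes x: "eventually_small x A" and y: "\<And>L n. cmod (y L n) \<le> d"
  shows "eventually_small (\<lambda>L n. y L n * x L n) (d\<^sup>2 * A)"
  unfolding eventually_small_def using x[unfolded eventually_small_def]
proof eventually_elim
  case (elim L)
  show ?case
  proof
    fix N
    have "(\<Sum>n<N. (cmod (y L n * x L n))\<^sup>2) \<le> (\<Sum>n<N. d\<^sup>2 * (cmod (x L n))\<^sup>2)"
      unfolding norm_mult power_mult_distrib using y by (intro sum_mono mult_right_mono power_mono) auto
    also have "\<dots> = d\<^sup>2 * (\<Sum>n<N. (cmod (x L n))\<^sup>2)" by (simp add: sum_distrib_left)
    also have "\<dots> \<le> d\<^sup>2 * A" using elim by (intro mult_left_mono) auto
    finally show "(\<Sum>n<N. (cmod (y L n * x L n))\<^sup>2) \<le> d\<^sup>2 * A" .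
  qed
qed

lemma eventually_small_coef:
  assumes phi: "\<phi> \<in> l2 lebesgue" shows "eventually_small (\<lambda>L n. coef L n \<phi>) ((nrm lebesgue \<phi>)\<^sup>2)"
  unfolding eventually_small_def using eventually_ge_at_top[of L1]
proof eventually_elim
  case (elim L)
  have "(nrm (LB L) \<phi>)\<^sup>2 \<le> (nrm lebesgue \<phi>)\<^sup>2" by (intro power_mono l2_restrict(2)[OF phi]) simp
  then show ?case using coef_bessel[OF elim l2_restrict(1)[OF phi]] order_trans by blast
qed

lemma converging_const: "converging (\<lambda>x. c)"
  unfolding converging_def
proof (intro conjI ballI allI impI)
  fix \<phi> :: "real^'n \<Rightarrow> complex" and \<epsilon> :: real assume phi: "\<phi> \<in> l2 lebesgue" and eps: "\<epsilon> > 0"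
  show "\<exists>u\<in>l2 lebesgue. eventually_small (\<lambda>L n. deviation L n u (\<lambda>x. c) \<phi>) \<epsilon>"
    by (rule bexI[of _ "\<lambda>x. c * \<phi> x"])
       (use phi eps in \<open>auto simp: eventually_small_def deviation_def coef_def ip_cmult_right\<close>)
qed auto

text \<open>\<open>u\<close> approximates \<open>r(H L) \<phi>\<close>, and \<open>w\<close> then
  approximates \<open>s(H L) u\<close>. The first error passes through \<open>s(H L)\<close> and is
  amplified by at most \<open>d\<close>, so \<open>u\<close> must be chosen with the finer tolerance
  \<open>\<epsilon>1\<close>; the summand 1 in its denominator covers \<open>d = 0\<close>.\<close>

lemma converging_mult:
  assumes r: "converging r" and s: "converging s" shows "converging (\<lambda>x. s x * r x)"
  unfolding converging_def
proof (intro conjI ballI allI impI)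
  obtain b where b: "\<And>x. cmod (r x) \<le> b" using r by (auto simp: converging_def)
  obtain d where d: "\<And>x. cmod (s x) \<le> d" using s by (auto simp: converging_def)
  have d0: "d \<ge> 0" using d[of 0] norm_ge_zero order_trans by blast
  show "\<exists>b. \<forall>x. cmod (s x * r x) \<le> b"
    using b d d0 by (intro exI[of _ "d * b"]) (auto simp: norm_mult intro!: mult_mono)
  fix \<phi> :: "real^'n \<Rightarrow> complex" and \<epsilon> :: real assume phi: "\<phi> \<in> l2 lebesgue" and eps: "\<epsilon> > 0"
  define \<epsilon>1 where "\<epsilon>1 = \<epsilon> / (4 * (d\<^sup>2 + 1))"
  have d1: "d\<^sup>2 + 1 > 0" by (simp add: add_nonneg_pos)
  have e1: "\<epsilon>1 > 0" and e4: "\<epsilon> / 4 > 0" using eps d1 by (simp_all add: \<epsilon>1_def)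
  obtain u where u: "u \<in> l2 lebesgue" and ue: "eventually_small (\<lambda>L n. deviation L n u r \<phi>) \<epsilon>1"
    using convergingD[OF r phi e1] .
  obtain w where w: "w \<in> l2 lebesgue" and we: "eventually_small (\<lambda>L n. deviation L n w s u) (\<epsilon> / 4)"
    using convergingD[OF s u e4] .
  have "p * (\<epsilon> / (4 * p)) = \<epsilon> / 4" if "p > 0" for p :: real using that by simp
  then have "(d\<^sup>2 + 1) * \<epsilon>1 = \<epsilon> / 4" unfolding \<epsilon>1_def using d1 by blast
  then have le: "2 * (\<epsilon> / 4) + 2 * (d\<^sup>2 * \<epsilon>1) \<le> \<epsilon>" using e1 by (simp add: distrib_right)
  have s_small: "eventually_small (\<lambda>L n. s (specE L n) * deviation L n u r \<phi>) (d\<^sup>2 * \<epsilon>1)"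
    by (rule eventually_small_mult[OF ue]) (rule d)
  have "deviation L n w (\<lambda>x. s x * r x) \<phi> = deviation L n w s u
      + s (specE L n) * deviation L n u r \<phi>" for L n
    by (simp add: deviation_def algebra_simps)
  then have "eventually_small (\<lambda>L n. deviation L n w (\<lambda>x. s x * r x) \<phi>) \<epsilon>"
    by (intro eventually_small_add[OF we s_small _ le] always_eventually allI)
  then show "\<exists>u\<in>l2 lebesgue. eventually_small (\<lambda>L n. deviation L n u (\<lambda>x. s x * r x) \<phi>) \<epsilon>"
    using w by blast
qed

lemma coef_add:
  assumes "L \<ge> L1" "f \<in> l2 lebesgue" "g \<in> l2 lebesgue"
  shows "coef L n (\<lambda>x. f x + g x) = coef L n f + coef L n g"
  unfolding coef_def
  by (rule ip_add_right) (use assms orthonormal_l2[OF spec_orthonormal] l2_restrict in auto)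

lemma converging_add:
  assumes r: "converging r" and s: "converging s" shows "converging (\<lambda>x. r x + s x)"
  unfolding converging_def
proof (intro conjI ballI allI impI)
  obtain b where b: "\<And>x. cmod (r x) \<le> b" using r by (auto simp: converging_def)
  obtain d where d: "\<And>x. cmod (s x) \<le> d" using s by (auto simp: converging_def)
  show "\<exists>b. \<forall>x. cmod (r x + s x) \<le> b"
    using b d by (intro exI[of _ "b + d"]) (auto intro!: order_trans[OF norm_triangle_ineq] add_mono)
  fix \<phi> :: "real^'n \<Rightarrow> complex" and \<epsilon> :: real assume phi: "\<phi> \<in> l2 lebesgue" and eps: "\<epsilon> > 0"
  have e4: "\<epsilon> / 4 > 0" using eps by simp
  obtain u where u: "u \<in> l2 lebesgue" and ue: "eventually_small (\<lambda>L n. deviation L n u r \<phi>) (\<epsilon> / 4)"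
    using convergingD[OF r phi e4] .
  obtain w where w: "w \<in> l2 lebesgue" and we: "eventually_small (\<lambda>L n. deviation L n w s \<phi>) (\<epsilon> / 4)"
    using convergingD[OF s phi e4] .
  have "\<forall>\<^sub>F L in at_top. \<forall>n. deviation L n (\<lambda>x. u x + w x) (\<lambda>x. r x + s x) \<phi>
      = deviation L n u r \<phi> + deviation L n w s \<phi>"
    using eventually_ge_at_top[of L1]
    by eventually_elim (simp add: deviation_def coef_add u w algebra_simps)
  then have "eventually_small (\<lambda>L n. deviation L n (\<lambda>x. u x + w x) (\<lambda>x. r x + s x) \<phi>) \<epsilon>"
    by (rule eventually_small_add[OF ue we]) (use eps in simp)
  then show "\<exists>u\<in>l2 lebesgue. eventually_small (\<lambda>L n. deviation L n u (\<lambda>x. r x + s x) \<phi>) \<epsilon>"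
    using u w by (intro bexI[of _ "\<lambda>x. u x + w x"]) auto
qed

text \<open>Replacing \<open>r\<close> by \<open>f\<close> changes each coefficient by at most
  \<open>e\<close> times that of \<open>\<phi>\<close>, and the squares of the latter sum to at most
  \<open>P\<close> by Bessel. The choice of \<open>e\<close> makes the total at most a quarter of
  \<open>\<epsilon>\<close>.\<close>

lemma converging_uniform_limit:
  assumes "\<And>e. e > 0 \<Longrightarrow> \<exists>r. converging r \<and> (\<forall>x. cmod (f x - r x) \<le> e)"
  shows "converging f"
  unfolding converging_def
proof (intro conjI ballI allI impI)
  obtain r1 where r1: "converging r1" "\<And>x. cmod (f x - r1 x) \<le> 1" using assms[of 1] by auto
  obtain b where b: "\<And>x. cmod (r1 x) \<le> b" using r1(1) by (auto simp: converging_def)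
  show "\<exists>b. \<forall>x. cmod (f x) \<le> b"
  proof (intro exI allI)
    show "cmod (f x) \<le> 1 + b" for x
      using norm_triangle_ineq[of "f x - r1 x" "r1 x"] r1(2)[of x] b[of x] by simp
  qed
  fix \<phi> :: "real^'n \<Rightarrow> complex" and \<epsilon> :: real assume phi: "\<phi> \<in> l2 lebesgue" and eps: "\<epsilon> > 0"
  define P where "P = (nrm lebesgue \<phi>)\<^sup>2"
  have P: "P \<ge> 0" by (simp add: P_def)
  define e where "e = sqrt (\<epsilon> / (4 * (P + 1)))"
  have e: "e > 0" using eps P by (simp add: e_def)
  have e4: "\<epsilon> / 4 > 0" using eps by simp
  obtain r where r: "converging r" and fr: "\<And>x. cmod (f x - r x) \<le> e" using assms[OF e] by blast
  obtain u where u: "u \<in> l2 lebesgue" and ue: "eventually_small (\<lambda>L n. deviation L n u r \<phi>) (\<epsilon> / 4)"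
    using convergingD[OF r phi e4] .
  have "e\<^sup>2 * P \<le> \<epsilon> / 4" using eps P by (simp add: e_def field_simps)
  then have le: "2 * (\<epsilon> / 4) + 2 * (e\<^sup>2 * P) \<le> \<epsilon>" by simp
  have f_small: "eventually_small (\<lambda>L n. - (f (specE L n) - r (specE L n)) * coef L n \<phi>) (e\<^sup>2 * P)"
    unfolding P_def by (rule eventually_small_mult[OF eventually_small_coef[OF phi]]) (simp only:
        norm_minus_cancel fr)
  have "deviation L n u f \<phi> = deviation L n u r \<phi>
      + (- (f (specE L n) - r (specE L n)) * coef L n \<phi>)" for L n
    by (simp add: deviation_def algebra_simps)
  then have "eventually_small (\<lambda>L n. deviation L n u f \<phi>) \<epsilon>"
    by (intro eventually_small_add[OF ue f_small _ le] always_eventually allI)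
  then show "\<exists>u\<in>l2 lebesgue. eventually_small (\<lambda>L n. deviation L n u f \<phi>) \<epsilon>"
    using u by blast
qed

text \<open>The \<open>u\<close> of \<open>resolvent_core\<close> satisfies the resolvent equation
  with an error \<open>h\<close> of norm at most \<open>sqrt \<epsilon>\<close> on every large
  torus. Coefficientwise the deviation is that of \<open>h\<close> divided by \<open>E - z\<close>,
  whose modulus is at least one. The hypotheses leave just \<open>\<i>\<close> and
  \<open>- \<i>\<close>, the points that the Cayley transform needs.\<close>

lemma converging_resolvent:
  assumes z: "\<bar>Im z\<bar> = 1" "cmod z = 1" shows "converging (\<lambda>x. 1 / (of_real x - z))"
  unfolding converging_def
proof (intro conjI ballI allI impI)
  have lb: "1 \<le> cmod (of_real x - z)" for x
    using abs_Im_le_cmod[of "of_real x - z"] z by simp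
  have nz: "of_real x - z \<noteq> 0" for x using lb[of x] by auto
  have r1: "cmod (1 / (of_real x - z)) \<le> 1" for x using lb[of x]
      by (simp add: norm_divide divide_le_eq_1)
  show "\<exists>b. \<forall>x. cmod (1 / (of_real x - z)) \<le> b" using r1 by blast
  fix \<phi> :: "real^'n \<Rightarrow> complex" and \<epsilon> :: real assume phi: "\<phi> \<in> l2 lebesgue" and eps: "\<epsilon> > 0"
  have se: "sqrt \<epsilon> > 0" using eps by simp
  obtain u w L0 where L0: "L0 \<ge> L1" and cont: "continuous_on UNIV u" "continuous_on UNIV w"
    and out: "\<And>x. norm x > L0 / 8 \<Longrightarrow> u x = 0" "\<And>x. norm x > L0 / 8 \<Longrightarrow> w x = 0"
    and lap: "\<And>L k. L \<ge> L0 \<Longrightarrow> ip (LB L) (nwave L k) w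
        = of_real (nu (dual_pt L k)) * ip (LB L) (nwave L k) u"
    and res: "\<And>L. L \<ge> L0 \<Longrightarrow> nrm (LB L) (\<lambda>x. w x + of_real (V L x) * u x - z * u x - \<phi> x) \<le> sqrt \<epsilon>"
    using resolvent_core[OF phi z se] by blast
  have ul2: "g \<in> l2 lebesgue" if g: "continuous_on UNIV g"
      and o: "\<And>x. norm x > L0 / 8 \<Longrightarrow> g x = 0" for g :: "real^'n \<Rightarrow> complex"
  proof -
    have "integrable lborel (\<lambda>x. indicator (cball 0 (L0 / 8)) x *\<^sub>R (cmod (g x))\<^sup>2)"
      by (rule borel_integrable_compact) (auto intro!: continuous_intros continuous_on_subset[OF g])
    moreover have "indicator (cball 0 (L0 / 8)) x *\<^sub>R (cmod (g x))\<^sup>2 = (cmod (g x))\<^sup>2" for x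
      using o[of x] by (auto simp: indicator_def not_le)
    ultimately have "integrable lborel (\<lambda>x. (cmod (g x))\<^sup>2)" by (simp only:)
    then have "integrable lebesgue (\<lambda>x. (cmod (g x))\<^sup>2)"
      using borel_measurable_integrable by (subst integrable_completion) auto
    then show ?thesis using continuous_imp_lebesgue_measurable[OF g] by (simp add: l2_def)
  qed
  have u: "u \<in> l2 lebesgue" by (rule ul2[OF cont(1) out(1)])
  have w: "w \<in> l2 lebesgue" by (rule ul2[OF cont(2) out(2)])
  have "eventually_small (\<lambda>L n. deviation L n u (\<lambda>x. 1 / (of_real x - z)) \<phi>) \<epsilon>"
    unfolding eventually_small_def deviation_def using eventually_ge_at_top[of L0]
  proof eventually_elim
    case (elim L)
    then have L: "L \<ge> L1" using L0 by simp
    note l2s = l2_restrict(1)[OF u, of L] l2_restrict(1)[OF w, of L] l2_restrict(1)[OF phi, of L]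
    obtain b where s: "schroedinger (LB L) (nwave L :: int^'n \<Rightarrow> _) (\<lambda>k. nu (dual_pt L k)) (V L) b"
      using schroedinger_V[OF L] .
    have Vu: "(\<lambda>x. of_real (V L x) * u x) \<in> l2 (LB L)" by (rule schroedinger.W_l2[OF s l2s(1)])
    define h where "h x = w x + of_real (V L x) * u x - z * u x - \<phi> x" for x
    have h: "h \<in> l2 (LB L)" unfolding h_def using l2s Vu by simp
    note psi = orthonormal_l2[OF spec_orthonormal[OF L]]
    have ch: "coef L n h = (of_real (specE L n) - z) * coef L n u - coef L n \<phi>" for n
    proof -
      have "coef L n h = coef L n (\<lambda>x. w x + of_real (V L x) * u x) - z * coef L n u - coef L n \<phi>"
        unfolding coef_def h_def using l2s Vu psi by (simp add: ip_diff_right ip_cmult_right)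
      also have "coef L n (\<lambda>x. w x + of_real (V L x) * u x) = of_real (specE L n) * coef L n u"
        by (rule spec_intertwine[OF L l2s(1,2) lap[OF elim]])
      finally show ?thesis by (simp add: algebra_simps)
    qed
    show ?case
    proof
      fix N
      have "(\<Sum>n<N. (cmod (coef L n u - 1 / (of_real (specE L n) - z) * coef L n \<phi>))\<^sup>2)
          \<le> (\<Sum>n<N. (cmod (coef L n h))\<^sup>2)"
      proof (rule sum_mono)
        fix n
        have "coef L n u - 1 / (of_real (specE L n) - z) * coef L n \<phi>
            = 1 / (of_real (specE L n) - z) * coef L n h"
          unfolding ch using nz[of "specE L n"] by (simp add: field_simps)
        then have "cmod (coef L n u - 1 / (of_real (specE L n) - z) * coef L n \<phi>)
            = cmod (1 / (of_real (specE L n) - z)) * cmod (coef L n h)"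
          by (simp only: norm_mult)
        also have "\<dots> \<le> 1 * cmod (coef L n h)" by (intro mult_right_mono r1) simp
        finally show "(cmod (coef L n u - 1 / (of_real (specE L n) - z) * coef L n \<phi>))\<^sup>2
            \<le> (cmod (coef L n h))\<^sup>2"
          by (intro power_mono) auto
      qed
      also have "\<dots> \<le> (nrm (LB L) h)\<^sup>2" by (rule coef_bessel[OF L h])
      also have "\<dots> \<le> (sqrt \<epsilon>)\<^sup>2" using res[OF elim] unfolding h_def by (intro power_mono) auto
      also have "\<dots> = \<epsilon>" using eps by simp
      finally show "(\<Sum>n<N. (cmod (coef L n u - 1 / (of_real (specE L n) - z) * coef L n \<phi>))\<^sup>2) \<le> \<epsilon>" .
    qed
  qed
  then show "\<exists>u\<in>l2 lebesgue. eventually_small (\<lambda>L n. deviation L n u (\<lambda>x. 1 / (of_real x - z)) \<phi>) \<epsilon>"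
    using u by blast
qed

text \<open>The Cayley transform of \<open>x\<close> has real part
  \<open>1 - 2 / (x\<^sup>2 + 1)\<close> and imaginary part
  \<open>- 2 * x / (x\<^sup>2 + 1)\<close>, both polynomials in the resolvents at
  \<open>\<i>\<close> and \<open>- \<i>\<close>. A real linear functional on the plane is a
  combination of these two parts, and the remaining cases are closure under sums and
  products.\<close>

lemma converging_polynomial:
  assumes "real_polynomial_function p"
  shows "converging (\<lambda>x. complex_of_real (p ((of_real x - \<i>) / (of_real x + \<i>))))"
  using assms
proof (induction rule: real_polynomial_function.induct)
  case (linear p)
  then interpret bounded_linear p .
  have rp: "converging (\<lambda>x. 1 / (of_real x - \<i>))" by (rule converging_resolvent) auto
  have rm: "converging (\<lambda>x. 1 / (of_real x - (- \<i>)))" by (rule converging_resolvent) auto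
  have "converging (\<lambda>x. of_real (p 1) * (1 + (-2) * (1 / (of_real x - \<i>) * (1 / (of_real x - (- \<i>)))))
     + of_real (- p \<i>) * (1 / (of_real x - \<i>) + 1 / (of_real x - (- \<i>))))"
    by (intro converging_add converging_mult converging_const rp rm)
  moreover have "of_real (p 1) * (1 + (-2) * (1 / (of_real x - \<i>) * (1 / (of_real x - (- \<i>)))))
     + of_real (- p \<i>) * (1 / (of_real x - \<i>) + 1 / (of_real x - (- \<i>)))
         = complex_of_real (p ((of_real x - \<i>) / (of_real x + \<i>)))" for x
  proof -
    define w where "w = (of_real x - \<i>) / (of_real x + \<i>)"
    have pos: "x\<^sup>2 + 1 > 0" by (simp add: add_nonneg_pos)
    have nz: "of_real x - \<i> \<noteq> 0" "of_real x + \<i> \<noteq> 0" by (auto simp: complex_eq_iff)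
    have prod: "(of_real x - \<i>) * (of_real x + \<i>) = of_real (x\<^sup>2 + 1)"
        by (simp add: algebra_simps power2_eq_square)
    have inv1: "1 / (of_real x - \<i>) = (of_real x + \<i>) / of_real (x\<^sup>2 + 1)"
      unfolding prod[symmetric] using nz by simp
    have inv2: "1 / (of_real x + \<i>) = (of_real x - \<i>) / of_real (x\<^sup>2 + 1)"
      unfolding prod[symmetric] using nz by simp
    have w_eq: "w = (of_real x - \<i>) * (of_real x - \<i>) / of_real (x\<^sup>2 + 1)"
      unfolding prod[symmetric] w_def using nz by simp
    have wr: "Re w = 1 - 2 / (x\<^sup>2 + 1)" "Im w = - (2 * x / (x\<^sup>2 + 1))"
      unfolding w_eq Re_divide_of_real Im_divide_of_real using pos
          by (simp_all add: field_simps power2_eq_square)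
    have "p w = p (Re w *\<^sub>R 1 + Im w *\<^sub>R \<i>)" by (rule arg_cong[where f = p]) (simp add: complex_eq_iff)
    also have "\<dots> = Re w * p 1 + Im w * p \<i>" by (simp only: add scaleR real_scaleR_def)
    finally have pw: "p w = Re w * p 1 + Im w * p \<i>" .
    have s1: "1 + (-2) * (1 / (of_real x - \<i>) * (1 / (of_real x - (- \<i>)))) = complex_of_real (Re w)"
    proof -
      have "1 / (of_real x - \<i>) * (1 / (of_real x - (- \<i>))) = 1 / complex_of_real (x\<^sup>2 + 1)"
        unfolding prod[symmetric] by simp
      then show ?thesis unfolding wr by simp
    qed
    have s2: "1 / (of_real x - \<i>) + 1 / (of_real x - (- \<i>)) = complex_of_real (- Im w)"
    proof -
      have "1 / (of_real x - \<i>) + 1 / (of_real x - (- \<i>))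
          = (of_real x + \<i>) / of_real (x\<^sup>2 + 1) + (of_real x - \<i>) / of_real (x\<^sup>2 + 1)"
        using inv1 inv2 by simp
      also have "\<dots> = complex_of_real (- Im w)" unfolding wr by (simp add: add_divide_distrib[symmetric])
      finally show ?thesis .
    qed
    show ?thesis unfolding s1 s2 w_def[symmetric] pw by simp
  qed
  ultimately show ?case by (simp only:)
next
  case (add f g)
  show ?case using converging_add[OF add.IH] by simp
next
  case (mult f g)
  show ?case using converging_mult[OF mult.IH(2,1)] by simp
qed (rule converging_const)

text \<open>The Cayley transform identifies the line with the circle without the point \<open>1\<close>, so that
  functions vanishing at infinity become continuous functions on a compact set.\<close>

lemma converging_C0:
  assumes f: "continuous_on UNIV f" and f0: "(f \<longlongrightarrow> 0) at_infinity"
  shows "converging f"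
proof (rule converging_uniform_limit)
  fix e :: real assume e: "e > 0"
  \<comment> \<open>The inverse of the Cayley transform. Its values on the circle are real by
    \<open>g_real\<close>, so \<open>Re\<close> discards nothing there.\<close>
  define g where "g w = \<i> * (1 + w) / (1 - w)" for w :: complex
  define F where "F w = (if w = 1 then 0 else f (Re (g w)))" for w
  have g_real: "Im (g w) = 0" if "w \<in> sphere 0 1" "w \<noteq> 1" for w
  proof -
    have w1: "w * cnj w = 1" using that complex_norm_square[of w] by simp
    have "cnj (g w) = - \<i> * (1 + cnj w) / (1 - cnj w)" by (simp add: g_def)
    also have "\<dots> = - \<i> * (w * (1 + cnj w)) / (w * (1 - cnj w))" using w1 by auto
    also have "\<dots> = - \<i> * (w + 1) / (w - 1)" by (simp add: ring_distribs w1)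
    also have "\<dots> = g w" unfolding g_def using that by (simp add: divide_simps) (simp add: algebra_simps)
    finally show ?thesis by (simp add: complex_eq_iff)
  qed
  have cont: "continuous_on (sphere 0 1) F"
    unfolding continuous_on_eq_continuous_within
  proof
    fix w :: complex assume w: "w \<in> sphere 0 1"
    show "continuous (at w within sphere 0 1) F"
    proof (cases "w = 1")
      case False
      have "continuous_on (- {1}) (\<lambda>w. f (Re (g w)))"
        unfolding g_def by (intro continuous_on_compose2[OF f] continuous_intros) auto
      then have "continuous_on (- {1}) F" by (rule continuous_on_eq) (simp add: F_def)
      then have "continuous (at w) F" using False
          by (simp add: continuous_on_eq_continuous_at open_Compl)
      then show ?thesis by (rule continuous_at_imp_continuous_at_within)
    next
      case True
      have "filterlim g at_infinity (at 1 within sphere 0 1)"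
        unfolding g_def
      proof (rule filterlim_divide_at_infinity)
        show "((\<lambda>w. \<i> * (1 + w)) \<longlongrightarrow> \<i> * (1 + 1)) (at 1 within sphere 0 1)" by (intro tendsto_intros)
        have "((\<lambda>w. 1 - w) \<longlongrightarrow> 1 - 1) (at (1::complex) within sphere 0 1)" by (intro tendsto_intros)
        then show "filterlim (\<lambda>w. 1 - w) (at 0) (at (1::complex) within sphere 0 1)"
          by (simp add: filterlim_at eventually_at_filter)
      qed simp
      then have g_inf: "filterlim (\<lambda>w. norm (g w)) at_top (at 1 within sphere 0 1)"
        by (simp add: filterlim_at_infinity_conv_norm_at_top)
      have "\<forall>\<^sub>F w in at 1 within sphere 0 1. norm (g w) = norm (Re (g w))"
        unfolding eventually_at_filter
        by (intro always_eventually allI impI) (use g_real in \<open>simp add: cmod_eq_Re\<close>)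
      then have "filterlim (\<lambda>w. norm (Re (g w))) at_top (at 1 within sphere 0 1)"
        using filterlim_cong[OF refl refl] g_inf by fast
      then have "filterlim (\<lambda>w. Re (g w)) at_infinity (at 1 within sphere 0 1)"
        by (simp add: filterlim_at_infinity_conv_norm_at_top)
      then have "((\<lambda>w. f (Re (g w))) \<longlongrightarrow> 0) (at 1 within sphere 0 1)" by (rule filterlim_compose[OF f0])
      moreover have "\<forall>\<^sub>F w in at 1 within sphere 0 1. f (Re (g w)) = F w"
        unfolding eventually_at_filter by (intro always_eventually allI impI) (simp add: F_def)
      ultimately have "(F \<longlongrightarrow> 0) (at 1 within sphere 0 1)" by (rule Lim_transform_eventually)
      then show ?thesis using True by (simp add: continuous_within F_def)
    qed
  qed
  have e2: "e / 2 > 0" using e by simp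
  obtain p1 where p1: "real_polynomial_function p1" "\<And>w. w \<in> sphere 0 1 \<Longrightarrow> \<bar>Re (F w) - p1 w\<bar> < e / 2"
    using Stone_Weierstrass_real_polynomial_function[OF compact_sphere continuous_on_Re[OF cont] e2]
        by blast
  obtain p2 where p2: "real_polynomial_function p2" "\<And>w. w \<in> sphere 0 1 \<Longrightarrow> \<bar>Im (F w) - p2 w\<bar> < e / 2"
    using Stone_Weierstrass_real_polynomial_function[OF compact_sphere continuous_on_Im[OF cont] e2]
        by blast
  define cay where "cay x = (complex_of_real x - \<i>) / (of_real x + \<i>)" for x
  define r where "r x = complex_of_real (p1 (cay x)) + \<i> * complex_of_real (p2 (cay x))" for x
  have "converging r" unfolding r_def cay_def
    by (intro converging_add converging_mult converging_const converging_polynomial p1(1) p2(1))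
  moreover have "cmod (f x - r x) \<le> e" for x
  proof -
    have nz: "complex_of_real x + \<i> \<noteq> 0" "complex_of_real x - \<i> \<noteq> 0" by (auto simp: complex_eq_iff)
    have "cmod (complex_of_real x - \<i>) = cmod (complex_of_real x + \<i>)" by (simp add: cmod_def)
    then have s: "cay x \<in> sphere 0 1" using nz by (simp add: cay_def norm_divide)
    have one: "1 - cay x = 2 * \<i> / (of_real x + \<i>)" "1 + cay x = 2 * of_real x / (of_real x + \<i>)"
      using nz by (simp_all add: cay_def field_simps)
    have "1 - cay x \<noteq> 0" unfolding one using nz by simp
    then have c1: "cay x \<noteq> 1" by auto
    have "g (cay x) = of_real x" unfolding g_def one using nz by simp
    then have F: "F (cay x) = f x" using c1 by (simp add: F_def)
    have "cmod (f x - r x) \<le> \<bar>Re (f x - r x)\<bar> + \<bar>Im (f x - r x)\<bar>" by (rule cmod_le)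
    also have "\<dots> \<le> e / 2 + e / 2"
      using p1(2)[OF s] p2(2)[OF s] unfolding F by (intro add_mono) (simp_all add: r_def)
    finally show ?thesis by simp
  qed
  ultimately show "\<exists>r. converging r \<and> (\<forall>x. cmod (f x - r x) \<le> e)" by blast
qed

lemma ip_LB_tendsto:
  assumes f: "f \<in> l2 lebesgue" and g: "g \<in> l2 lebesgue"
  shows "((\<lambda>L. ip (LB L) f g) \<longlongrightarrow> ip lebesgue f (g :: real^'n \<Rightarrow> complex)) at_top"
proof -
  have [measurable]: "f \<in> borel_measurable lebesgue" "g \<in> borel_measurable lebesgue"
    using f g by (auto dest: l2_measurable)
  have "((\<lambda>L. LINT x|lebesgue. indicator (box_L L) x *\<^sub>R (cnj (f x) * g x)) \<longlongrightarrow> (LINT x|lebesgue. cnj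
      (f x) * g x)) at_top"
  proof (rule integral_dominated_convergence_at_top[where w = "\<lambda>x. cmod (cnj (f x) * g x)"])
    show "integrable lebesgue (\<lambda>x. cmod (cnj (f x) * g x))" using ip_integrable[OF f g]
        by (rule integrable_norm)
    show "AE x in lebesgue. ((\<lambda>L. indicator (box_L L) x *\<^sub>R (cnj (f x) * g x)) \<longlongrightarrow> cnj (f x) * g x)
        at_top"
    proof (rule AE_I2)
      fix x :: "real^'n"
      have "\<forall>\<^sub>F L in at_top. indicator (box_L L) x *\<^sub>R (cnj (f x) * g x) = cnj (f x) * g x"
        using eventually_ge_at_top[of "8 * norm x"] eventually_gt_at_top[of 0]
      proof eventually_elim
        case (elim L)
        then have "x \<in> box_L L" by (intro norm_imp_box) auto
        then show ?case by simp
      qed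
      then show "((\<lambda>L. indicator (box_L L) x *\<^sub>R (cnj (f x) * g x)) \<longlongrightarrow> cnj (f x) * g x) at_top"
        by (rule tendsto_eventually)
    qed
    show "\<forall>\<^sub>F L in at_top. AE x in lebesgue. norm (indicator (box_L L) x *\<^sub>R (cnj (f x) * g x))
        \<le> cmod (cnj (f x) * g x)"
      by (intro always_eventually allI AE_I2) (simp add: indicator_def)
    show "(\<lambda>x. indicator (box_L L) x *\<^sub>R (cnj (f x) * g x)) \<in> borel_measurable lebesgue" for L
      by (intro borel_measurable_scaleR borel_measurable_indicator) measurable
  qed measurable
  moreover have "(LINT x|lebesgue. indicator (box_L L) x *\<^sub>R (cnj (f x) * g x)) = ip (LB L) f g" for L
    unfolding ip_def by (subst integral_restrict_space) (simp_all add: set_lebesgue_integral_def)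
  ultimately show ?thesis by (simp add: ip_def)
qed

text \<open>A Cauchy criterion in which the approximating point may depend on the tolerance, as it
  does below, where it is the inner product of \<open>\<phi>\<close> with a \<open>u\<close> that
  depends on \<open>\<epsilon>\<close>.\<close>

lemma tendsto_ex_of_approx:
  fixes Q :: "real \<Rightarrow> complex"
  assumes "\<And>\<epsilon>. \<epsilon> > 0 \<Longrightarrow> \<exists>l. \<forall>\<^sub>F L in at_top. dist (Q L) l \<le> \<epsilon>"
  shows "\<exists>l. (Q \<longlongrightarrow> l) at_top"
proof -
  have "\<exists>l. \<forall>\<^sub>F L in at_top. dist (Q L) l \<le> (1/2)^n" for n :: nat using assms[of "(1/2)^n"] by simp
  then obtain l where l: "\<And>n. \<forall>\<^sub>F L in at_top. dist (Q L) (l n) \<le> (1/2)^n" by metis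
  have ll: "dist (l m) (l n) \<le> (1/2)^m + (1/2)^n" for m n
  proof -
    have "\<forall>\<^sub>F L in (at_top :: real filter). dist (l m) (l n) \<le> (1/2)^m + (1/2)^n"
      using l[of m] l[of n]
    proof eventually_elim
      case (elim L)
      then show ?case using dist_triangle[of "l m" "l n" "Q L"] by (simp add: dist_commute)
    qed
    then show ?thesis by simp
  qed
  have "Cauchy l"
  proof (rule metric_CauchyI)
    fix e :: real assume e: "e > 0"
    obtain N where N: "(1/2::real)^N < e / 2" using real_arch_pow_inv[of "e/2" "1/2"] e by auto
    have "dist (l m) (l n) < e" if "m \<ge> N" "n \<ge> N" for m n
    proof -
      have "(1/2::real)^m \<le> (1/2)^N" "(1/2::real)^n \<le> (1/2)^N" using that
          by (auto intro!: power_decreasing)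
      then show ?thesis using ll[of m n] N by linarith
    qed
    then show "\<exists>N. \<forall>m\<ge>N. \<forall>n\<ge>N. dist (l m) (l n) < e" by blast
  qed
  then obtain l0 where l0: "l \<longlonglongrightarrow> l0" using Cauchy_convergent_iff convergent_def by blast
  have "(Q \<longlongrightarrow> l0) at_top"
  proof (rule tendstoI)
    fix e :: real assume e: "e > 0"
    obtain N where N: "(1/2::real)^N < e / 2" using real_arch_pow_inv[of "e/2" "1/2"] e by auto
    have "\<forall>\<^sub>F n in sequentially. dist (l n) l0 < e / 2" using l0 e by (intro tendstoD) auto
    then have "\<forall>\<^sub>F n in sequentially. n \<ge> N \<and> dist (l n) l0 < e / 2"
      by (intro eventually_conj eventually_ge_at_top)
    then obtain n where n: "n \<ge> N" "dist (l n) l0 < e / 2"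
      by (auto dest: eventually_happens)
    have le: "(1/2::real)^n \<le> (1/2)^N" using n by (intro power_decreasing) auto
    show "\<forall>\<^sub>F L in at_top. dist (Q L) l0 < e"
      using l[of n]
    proof eventually_elim
      case (elim L)
      then show ?case using dist_triangle[of "Q L" l0 "l n"] N n le by linarith
    qed
  qed
  then show ?thesis by blast
qed

text \<open>By Parseval and Cauchy-Schwarz the quadratic form differs from the inner product of
  \<open>\<phi>\<close> and \<open>u\<close> over the box by at most \<open>P\<close> times the
  deviation in norm, and that inner product converges as the box grows. \<open>\<epsilon>1\<close>
  is a square because deviations are measured in squares; the 1 in \<open>P\<close> keeps the
  divisor positive.\<close>

lemma converging_limit:
  assumes f: "converging f" and phi: "\<phi> \<in> l2 lebesgue"
  shows "\<exists>l. ((\<lambda>L. fc_quad L (V L) f \<phi>) \<longlongrightarrow> l) at_top"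
proof (rule tendsto_ex_of_approx)
  fix \<epsilon> :: real assume eps: "\<epsilon> > 0"
  obtain b where b: "\<And>x. cmod (f x) \<le> b" using f by (auto simp: converging_def)
  define P where "P = nrm lebesgue \<phi> + 1"
  have P: "P > 0" using nrm_nonneg[of lebesgue \<phi>] by (simp add: P_def add_nonneg_pos)
  define \<epsilon>1 where "\<epsilon>1 = (\<epsilon> / (2 * P))\<^sup>2"
  have e1: "\<epsilon>1 > 0" using eps P by (simp add: \<epsilon>1_def)
  obtain u where u: "u \<in> l2 lebesgue" and us: "eventually_small (\<lambda>L n. deviation L n u f \<phi>) \<epsilon>1"
    using convergingD[OF f phi e1] .
  have ue: "\<forall>\<^sub>F L in at_top. \<forall>N. (\<Sum>n<N. (cmod (coef L n u - f (specE L n) * coef L n \<phi>))\<^sup>2) \<le> \<epsilon>1"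
    using us unfolding eventually_small_def deviation_def .
  have e2: "\<epsilon> / 2 > 0" using eps by simp
  have "\<forall>\<^sub>F L in at_top. dist (ip (LB L) \<phi> u) (ip lebesgue \<phi> u) < \<epsilon> / 2"
    using ip_LB_tendsto[OF phi u] e2 by (rule tendstoD)
  then have "\<forall>\<^sub>F L in at_top. dist (fc_quad L (V L) f \<phi>) (ip lebesgue \<phi> u) \<le> \<epsilon>"
    using ue eventually_ge_at_top[of L1]
  proof eventually_elim
    case (elim L)
    note L = elim(3)
    note phiL = l2_restrict[OF phi, of L] and uL = l2_restrict[OF u, of L]
    have bes: "(\<Sum>n<N. (cmod (coef L n \<phi>))\<^sup>2) \<le> P\<^sup>2" for N
    proof -
      have "(\<Sum>n<N. (cmod (coef L n \<phi>))\<^sup>2) \<le> (nrm (LB L) \<phi>)\<^sup>2" by (rule coef_bessel[OF L phiL(1)])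
      also have "\<dots> \<le> P\<^sup>2" using phiL(2) by (intro power_mono) (auto simp: P_def)
      finally show ?thesis .
    qed
    have "summable (\<lambda>n. (cmod (coef L n \<phi>))\<^sup>2)"
      by (rule bounded_imp_summable[where B = "P\<^sup>2"]) (use bes[of "Suc _"] in \<open>auto simp:
          lessThan_Suc_atMost\<close>)
    then have "summable (\<lambda>n. b * (cmod (coef L n \<phi>))\<^sup>2)" by (rule summable_mult)
    then have "summable (\<lambda>n. f (specE L n) * of_real ((cmod (coef L n \<phi>))\<^sup>2))"
      by (rule summable_comparison_test') (use b in \<open>auto simp: norm_mult norm_power intro!:
          mult_right_mono\<close>)
    then have s_lim: "(\<lambda>N. \<Sum>n<N. f (specE L n) * of_real ((cmod (coef L n \<phi>))\<^sup>2)) \<longlonglongrightarrow> fc_quad L (V L) f \<phi>"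
      unfolding fc_quad_eq by (rule summable_LIMSEQ)
    have "((\<lambda>n. cnj (coef L n \<phi>) * coef L n u) has_sum ip (LB L) \<phi> u) UNIV"
      unfolding coef_def by (rule parseval_ip[OF spec_orthonormal[OF L] spec_total[OF L] phiL(1) uL(1)])
    then have p_lim: "(\<lambda>N. \<Sum>n<N. cnj (coef L n \<phi>) * coef L n u) \<longlonglongrightarrow> ip (LB L) \<phi> u"
      using has_sum_imp_sums sums_def by blast
    have "dist (fc_quad L (V L) f \<phi>) (ip (LB L) \<phi> u) \<le> \<epsilon> / 2"
    proof (rule LIMSEQ_le_const2[OF tendsto_dist[OF s_lim p_lim]])
      have "dist (\<Sum>n<N. f (specE L n) * of_real ((cmod (coef L n \<phi>))\<^sup>2)) (\<Sum>n<N. cnj (coef L n \<phi>) *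
          coef L n u) \<le> \<epsilon> / 2" for N
      proof -
        let ?d = "\<lambda>n. coef L n u - f (specE L n) * coef L n \<phi>"
        have "dist (\<Sum>n<N. f (specE L n) * of_real ((cmod (coef L n \<phi>))\<^sup>2)) (\<Sum>n<N. cnj (coef L n \<phi>) *
            coef L n u)
           = cmod (\<Sum>n<N. - (cnj (coef L n \<phi>) * ?d n))"
          unfolding dist_norm sum_subtractf[symmetric] complex_norm_square
          by (intro arg_cong[where f = cmod] sum.cong refl) (simp add: algebra_simps)
        also have "\<dots> \<le> (\<Sum>n<N. cmod (coef L n \<phi>) * cmod (?d n))"
          by (rule sum_norm_le) (simp add: norm_mult)
        also have "\<dots> \<le> L2_set (\<lambda>n. cmod (coef L n \<phi>)) {..<N} * L2_set (\<lambda>n. cmod (?d n)) {..<N}"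
          using L2_set_mult_ineq[of "\<lambda>n. cmod (coef L n \<phi>)" "\<lambda>n. cmod (?d n)" "{..<N}"] by simp
        also have "\<dots> \<le> sqrt (P\<^sup>2) * sqrt \<epsilon>1"
          unfolding L2_set_def using bes elim(2)
              by (intro mult_mono real_sqrt_le_mono) (auto intro!: sum_nonneg)
        also have "\<dots> = \<epsilon> / 2" using P eps by (simp add: \<epsilon>1_def real_sqrt_abs)
        finally show ?thesis .
      qed
      then show "\<exists>N. \<forall>n\<ge>N. dist (\<Sum>n<n. f (specE L n) * of_real ((cmod (coef L n \<phi>))\<^sup>2)) (\<Sum>n<n. cnj
          (coef L n \<phi>) * coef L n u) \<le> \<epsilon> / 2"
        by blast
    qed
    then show ?case using elim(1) dist_triangle[of "fc_quad L (V L) f \<phi>" "ip lebesgue \<phi> u" "ip (LB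
        L) \<phi> u"] by linarith
  qed
  then show "\<exists>l. \<forall>\<^sub>F L in at_top. dist (fc_quad L (V L) f \<phi>) l \<le> \<epsilon>" by blast
qed

end

section \<open>Potentials of marked point configurations\<close>

definition rv :: "int^'n \<Rightarrow> real^'n" where
  "rv n = (\<chi> i. of_int (n $ i))"

definition cidx :: "real^'n \<Rightarrow> int^'n" where
  "cidx x = (\<chi> i. \<lfloor>x $ i\<rfloor>)"

lemma rv_diff: "rv (m - n) = rv m - rv n"
  by (simp add: rv_def vec_eq_iff)

lemma norm_diff_rv_cidx: "norm (x - rv (cidx x)) \<le> CARD('n)" for x :: "real^'n"
proof -
  have "norm (x - rv (cidx x)) \<le> (\<Sum>i\<in>UNIV. \<bar>(x - rv (cidx x)) $ i\<bar>)" by (rule norm_le_l1_cart)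
  also have "\<dots> \<le> (\<Sum>i\<in>(UNIV :: 'n set). 1)"
    by (rule sum_mono) (simp add: rv_def cidx_def abs_le_iff, linarith)
  finally show ?thesis by simp
qed

text \<open>The lattice sum factorizes because \<open>1 + |n|\<close> is at least the geometric mean of the \<open>1 + |n i|\<close>.\<close>

lemma lattice_sum_bounded:
  fixes s :: real
  assumes s: "s > CARD('n)"
  shows "\<exists>A\<ge>0. \<forall>F :: (int^'n) set. finite F \<longrightarrow> (\<Sum>n\<in>F. (1 + norm (rv n)) powr (- s)) \<le> A"
proof -
  define t where "t = s / CARD('n)"
  have t: "t > 1" using s by (simp add: t_def)
  have "summable (\<lambda>k. real k powr (- t))" using t by (simp add: summable_real_powr_iff)
  then have sm: "summable (\<lambda>k. real (Suc k) powr (- t))" by (subst summable_Suc_iff)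
  define Z where "Z = (\<Sum>k. real (Suc k) powr (- t))"
  have Z0: "Z \<ge> 0" unfolding Z_def by (rule suminf_nonneg[OF sm]) simp
  have fin_Z: "(\<Sum>k\<in>F. real (Suc k) powr (- t)) \<le> Z" if "finite F" for F
    unfolding Z_def by (rule sum_le_suminf[OF sm that]) simp
  have one_dim: "(\<Sum>k=-N..N. (1 + \<bar>real_of_int k\<bar>) powr (- t)) \<le> 2 * Z" for N :: int
  proof -
    have "(\<Sum>k=-N..N. (1 + \<bar>real_of_int k\<bar>) powr (- t))
        \<le> (\<Sum>k\<in>{0..N} \<union> uminus ` {0..N}. (1 + \<bar>real_of_int k\<bar>) powr (- t))"
    proof (rule sum_mono2)
      show "{-N..N} \<subseteq> {0..N} \<union> uminus ` {0..N}"
      proof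
        fix k assume k: "k \<in> {-N..N}"
        show "k \<in> {0..N} \<union> uminus ` {0..N}"
          using k by (cases "k \<ge> 0") (auto intro!: image_eqI[of _ uminus "- k"])
      qed
    qed auto
    also have "\<dots> \<le> (\<Sum>k\<in>{0..N}. (1 + \<bar>real_of_int k\<bar>) powr (- t)) + (\<Sum>k\<in>uminus ` {0..N}. (1
        + \<bar>real_of_int k\<bar>) powr (- t))"
      by (subst sum_Un) (auto intro!: sum_nonneg)
    also have "(\<Sum>k\<in>uminus ` {0..N}. (1 + \<bar>real_of_int k\<bar>) powr (- t))
        = (\<Sum>k\<in>{0..N}. (1 + \<bar>real_of_int k\<bar>) powr (- t))"
      by (subst sum.reindex) auto
    also have "(\<Sum>k\<in>{0..N}. (1 + \<bar>real_of_int k\<bar>) powr (- t))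
        = (\<Sum>k\<in>nat ` {0..N}. real (Suc k) powr (- t))"
      by (subst sum.reindex) (auto simp: inj_on_def add.commute intro!: sum.cong)
    also have "\<dots> \<le> Z" by (rule fin_Z) simp
    finally show ?thesis by simp
  qed
  show ?thesis
  proof (intro exI[of _ "(2 * Z) ^ CARD('n)"] conjI allI impI)
    show "0 \<le> (2 * Z) ^ CARD('n)" using Z0 by simp
    fix F :: "(int^'n) set" assume F: "finite F"
    define N where "N = (\<Sum>n\<in>F. \<Sum>i\<in>UNIV. \<bar>n $ i\<bar>)"
    have N: "\<bar>n $ i\<bar> \<le> N" if "n \<in> F" for n i
    proof -
      have "\<bar>n $ i\<bar> \<le> (\<Sum>i\<in>UNIV. \<bar>n $ i\<bar>)" by (rule member_le_sum) auto
      also have "\<dots> \<le> N" unfolding N_def using that F by (intro member_le_sum) (auto intro!: sum_nonneg)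
      finally show ?thesis .
    qed
    have le: "(1 + norm (rv n)) powr (- s) \<le> (\<Prod>i\<in>UNIV. (1 + \<bar>real_of_int (n $ i)\<bar>) powr (- t))"
        for n :: "int^'n"
    proof -
      have "(1 + norm (rv n)) powr (- s) = (\<Prod>i\<in>(UNIV :: 'n set). (1 + norm (rv n)) powr (- t))"
      proof -
        have "s = t * CARD('n)" by (simp add: t_def)
        moreover have "0 < (1 + norm (rv n)) powr (- t)"
            by (simp add: add_pos_nonneg less_imp_neq[symmetric])
        ultimately show ?thesis by (simp add: powr_powr[of _ "- t" "real CARD('n)", simplified,
            symmetric] powr_realpow)
      qed
      also have "\<dots> \<le> (\<Prod>i\<in>UNIV. (1 + \<bar>real_of_int (n $ i)\<bar>) powr (- t))"
      proof (rule prod_mono, safe)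
        fix i
        have "\<bar>real_of_int (n $ i)\<bar> \<le> norm (rv n)" using component_le_norm_cart[of "rv n" i]
            by (simp add: rv_def)
        then show "(1 + norm (rv n)) powr (- t) \<le> (1 + \<bar>real_of_int (n $ i)\<bar>) powr (- t)"
          using t by (intro powr_mono2') auto
      qed simp
      finally show ?thesis .
    qed
    have "(\<Sum>n\<in>F. (1 + norm (rv n)) powr (- s))
        \<le> (\<Sum>n\<in>F. \<Prod>i\<in>UNIV. (1 + \<bar>real_of_int (n $ i)\<bar>) powr (- t))"
      by (rule sum_mono) (rule le)
    also have "\<dots> = (\<Sum>f\<in>vec_nth ` F. \<Prod>i\<in>UNIV. (1 + \<bar>real_of_int (f i)\<bar>) powr (- t))"
      by (subst sum.reindex) (auto simp: inj_on_def vec_nth_inject)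
    also have "\<dots> \<le> (\<Sum>f\<in>PiE (UNIV :: 'n set) (\<lambda>_. {-N..N}). \<Prod>i\<in>UNIV. (1
        + \<bar>real_of_int (f i)\<bar>) powr (- t))"
    proof (rule sum_mono2)
      show "vec_nth ` F \<subseteq> PiE UNIV (\<lambda>_. {-N..N})"
        using N by (auto simp: abs_le_iff) (metis abs_le_iff minus_le_iff)
    qed (auto intro!: finite_PiE prod_nonneg)
    also have "\<dots> = (\<Prod>i\<in>(UNIV :: 'n set). \<Sum>k=-N..N. (1 + \<bar>real_of_int k\<bar>) powr (- t))"
      by (rule prod_sum_PiE[symmetric]) auto
    also have "\<dots> \<le> (\<Prod>i\<in>(UNIV :: 'n set). 2 * Z)"
      by (rule prod_mono) (auto intro!: one_dim sum_nonneg)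
    finally show "(\<Sum>n\<in>F. (1 + norm (rv n)) powr (- s)) \<le> (2 * Z) ^ CARD('n)" by simp
  qed
qed

section \<open>Periodization\<close>

definition wrap :: "real \<Rightarrow> real^'n \<Rightarrow> real^'n" where
  "wrap L y = (\<chi> i. y $ i - L * of_int \<lfloor>y $ i / L + 1 / 2\<rfloor>)"

text \<open>Existence and uniqueness behind the \<open>THE\<close> in \<open>per_ext\<close>. Adding
  \<open>1 / 2\<close> before rounding down centers the period cell at the origin, with lower faces
  included and upper faces excluded as in \<open>box_L\<close>.\<close>

lemma wrap_unique:
  assumes L: "L > 0"
  shows "x \<in> box_L L \<and> (\<forall>i. (x $ i - y $ i) / L \<in> \<int>) \<longleftrightarrow> x = wrap L y"
proof
  assume x: "x = wrap L y"
  have "- L / 2 \<le> wrap L y $ i \<and> wrap L y $ i < L / 2" for i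
  proof -
    define m where "m = \<lfloor>y $ i / L + 1 / 2\<rfloor>"
    have "of_int m \<le> y $ i / L + 1 / 2" "y $ i / L + 1 / 2 < of_int m + 1" unfolding m_def by linarith+
    then have "L * of_int m \<le> y $ i + L / 2" "y $ i + L / 2 < L * of_int m + L" using L
        by (simp_all add: field_simps)
    then show ?thesis by (simp add: wrap_def m_def[symmetric])
  qed
  then show "x \<in> box_L L \<and> (\<forall>i. (x $ i - y $ i) / L \<in> \<int>)"
    unfolding x using L by (simp add: box_L_def) (simp add: wrap_def)
next
  assume *: "x \<in> box_L L \<and> (\<forall>i. (x $ i - y $ i) / L \<in> \<int>)"
  show "x = wrap L y"
  proof (simp add: vec_eq_iff, rule allI)
    fix i
    obtain m where m: "(x $ i - y $ i) / L = of_int m" using * by (auto simp: Ints_def)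
    then have xi: "x $ i = y $ i + L * of_int m" using L by (simp add: field_simps)
    have "- L / 2 \<le> x $ i" "x $ i < L / 2" using * by (auto simp: box_L_def)
    then have "0 \<le> (y $ i + L * of_int m + L / 2) / L" "(y $ i + L * of_int m + L / 2) / L < 1"
      using L unfolding xi by (simp_all add: field_simps)
    then have "of_int (- m) \<le> y $ i / L + 1 / 2" "y $ i / L + 1 / 2 < of_int (- m) + 1"
      using L by (simp_all add: add_divide_distrib)
    then have "\<lfloor>y $ i / L + 1 / 2\<rfloor> = - m" by linarith
    then show "x $ i = wrap L y $ i" by (simp add: wrap_def xi)
  qed
qed

lemma per_ext_wrap: "L > 0 \<Longrightarrow> per_ext L h y = h (wrap L y)"
  unfolding per_ext_def by (simp add: wrap_unique)

lemma wrap_id: "L > 0 \<Longrightarrow> y \<in> box_L L \<Longrightarrow> wrap L y = y"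
  using wrap_unique[of L y y] by simp


text \<open>Periodization cannot bring a distant point close to \<open>x\<close>. In the coordinate
  where \<open>y\<close> attains its largest modulus \<open>\<rho>\<close>, one has
  \<open>L0 / 4 \<le> \<rho> \<le> L / 2\<close> and \<open>x\<close> is at most
  \<open>\<rho> / 2\<close>. Without a shift the difference is at least \<open>\<rho> / 2\<close>; a
  shift moves it by at least \<open>L \<ge> 2 * \<rho>\<close>, which again leaves
  \<open>\<rho> / 2\<close>. Passing from the largest coordinate to the Euclidean norm costs the
  dimension.\<close>

lemma wrap_diff_lower:
  fixes x y :: "real^'n"
  assumes L: "0 < L0" "L0 \<le> L" and x: "norm x \<le> L0 / 8" and y: "y \<in> box_L L" and far: "\<bar>y $ j\<bar> \<ge> L0 / 4"
  shows "norm y \<le> 2 * real CARD('n) * norm (wrap L (x - y))"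
proof -
  define \<rho> where "\<rho> = Max (range (\<lambda>i. \<bar>y $ i\<bar>))"
  have \<rho>: "\<bar>y $ i\<bar> \<le> \<rho>" for i unfolding \<rho>_def by (rule Max_ge) auto
  have "\<rho> \<in> range (\<lambda>i. \<bar>y $ i\<bar>)" unfolding \<rho>_def by (rule Max_in) auto
  then obtain i where i: "\<rho> = \<bar>y $ i\<bar>" by auto
  have r4: "L0 / 4 \<le> \<rho>" using far \<rho>[of j] by linarith
  have "- L / 2 \<le> y $ i" "y $ i < L / 2" using y by (simp_all add: box_L_def)
  then have r2: "\<rho> \<le> L / 2" unfolding i by linarith
  have xi: "\<bar>x $ i\<bar> \<le> \<rho> / 2" using component_le_norm_cart[of x i] x r4 by linarith
  define m where "m = \<lfloor>(x - y) $ i / L + 1 / 2\<rfloor>"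
  have w: "wrap L (x - y) $ i = x $ i - y $ i - L * of_int m" by (simp add: wrap_def m_def)
  have "\<rho> / 2 \<le> \<bar>wrap L (x - y) $ i\<bar>"
  proof (cases "m = 0")
    case True
    then show ?thesis using xi i unfolding w by (simp add: abs_if split: if_splits)
  next
    case False
    then have "1 \<le> \<bar>real_of_int m\<bar>" by linarith
    then have "L * 1 \<le> L * \<bar>real_of_int m\<bar>" using L by (intro mult_left_mono) auto
    then have "L \<le> \<bar>L * of_int m\<bar>" using L by (simp add: abs_mult)
    moreover have "\<bar>L * of_int m\<bar> \<le> \<bar>wrap L (x - y) $ i\<bar> + \<bar>x $ i\<bar> + \<bar>y $ i\<bar>" unfolding w by linarith
    ultimately show ?thesis using xi i r2 by linarith
  qed
  also have "\<dots> \<le> norm (wrap L (x - y))" by (rule component_le_norm_cart)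
  finally have "\<rho> \<le> 2 * norm (wrap L (x - y))" by simp
  moreover have "norm y \<le> CARD('n) * \<rho>"
  proof -
    have "norm y \<le> (\<Sum>i\<in>UNIV. \<bar>y $ i\<bar>)" by (rule norm_le_l1_cart)
    also have "\<dots> \<le> (\<Sum>i\<in>(UNIV :: 'n set). \<rho>)" by (rule sum_mono) (rule \<rho>)
    finally show ?thesis by simp
  qed
  ultimately have "norm y \<le> CARD('n) * (2 * norm (wrap L (x - y)))"
      by (meson mult_left_mono of_nat_0_le_iff order_trans)
  then show ?thesis by (simp add: ac_simps)
qed


text \<open>A single realization of points and weights. \<open>mass\<close> allows linear growth
  over the unit cubes, and \<open>s > d + 1\<close> exceeds by one the exponent at which lattice
  sums converge, precisely to absorb it.\<close>

locale marked_points =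
  fixes y :: "nat \<Rightarrow> real^'n" and v :: "nat \<Rightarrow> real" and K s C :: real and B :: "real^'n \<Rightarrow> real"
      and lam d :: real
  assumes fin: "finite {\<gamma>. cidx (y \<gamma>) = n}"
    and mass: "(\<Sum>\<gamma> | cidx (y \<gamma>) = n. \<bar>v \<gamma>\<bar>) \<le> K * (1 + norm (rv n))"
    and d_def: "d = CARD('n)"
    and s: "s > d + 1"
    and B_meas: "B \<in> borel_measurable borel"
    and B_le: "\<bar>B x\<bar> \<le> C * (1 + norm x) powr (- s)"
    and lam: "lam \<ge> 0"
begin

lemma d_ge_1: "d \<ge> 1"
  by (simp add: d_def Suc_leI)

lemma cidx_err: "norm (x - rv (cidx x)) \<le> d" for x :: "real^'n"
  unfolding d_def by (rule norm_diff_rv_cidx)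

lemma K_nonneg: "K \<ge> 0"
proof -
  have "0 \<le> K * (1 + norm (rv (0 :: int^'n)))" using mass[of 0]
      by (rule order_trans[rotated]) (simp add: sum_nonneg)
  then show ?thesis by (simp add: rv_def zero_le_mult_iff) (smt (verit) norm_ge_zero)
qed

lemma C_nonneg: "C \<ge> 0"
  using order_trans[OF abs_ge_zero B_le[of 0]] by simp

lemma s_pos: "s > 0"
  using s d_ge_1 by linarith

text \<open>A displacement by at most \<open>d\<close>, the bound for the distance from a point to
  its cube's corner, changes the decay weight only by a constant factor. Points can thus be replaced
  by lattice points.\<close>

lemma powr_shift:
  assumes "norm (a - b) \<le> d"
  shows "(1 + norm a) powr (- s) \<le> (1 + d) powr s * (1 + norm b) powr (- s)"
proof -
  have "norm b \<le> norm a + norm (a - b)" using norm_triangle_ineq4[of a "a - b"] by simp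
  then have "1 + norm b \<le> 1 + norm a + d" using assms by simp
  also have "\<dots> \<le> (1 + d) * (1 + norm a)" using d_ge_1 by (simp add: algebra_simps)
  finally have le: "(1 + norm b) / (1 + d) \<le> 1 + norm a" using d_ge_1 by (simp add: field_simps)
  have "(1 + norm a) powr (- s) \<le> ((1 + norm b) / (1 + d)) powr (- s)"
    using s_pos le d_ge_1 by (intro powr_mono2') (auto simp: add_pos_nonneg)
  also have "\<dots> = (1 + d) powr s * (1 + norm b) powr (- s)"
    using d_ge_1 by (simp add: powr_divide powr_minus field_simps)
  finally show ?thesis .
qed

text \<open>Grouping the points by unit cubes turns a sum over the configuration into a lattice sum,
  at the price of one factor that is linear in the lattice point.\<close>

lemma sum_points_le:
  assumes F: "finite F" and g: "\<And>\<gamma>. \<gamma> \<in> F \<Longrightarrow> g \<gamma> \<le> h (cidx (y \<gamma>))" and h: "\<And>n. h n \<ge> 0"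
  shows "(\<Sum>\<gamma>\<in>F. \<bar>v \<gamma>\<bar> * g \<gamma>) \<le> (\<Sum>n\<in>(\<lambda>\<gamma>. cidx (y \<gamma>)) ` F. K * (1 + norm (rv n)) * h n)"
proof -
  have "(\<Sum>\<gamma>\<in>F. \<bar>v \<gamma>\<bar> * g \<gamma>) \<le> (\<Sum>\<gamma>\<in>F. \<bar>v \<gamma>\<bar> * h (cidx (y \<gamma>)))"
    by (intro sum_mono mult_left_mono g) auto
  also have "\<dots> = (\<Sum>n\<in>(\<lambda>\<gamma>. cidx (y \<gamma>)) ` F. \<Sum>\<gamma> | \<gamma> \<in> F \<and> cidx (y \<gamma>) = n. \<bar>v \<gamma>\<bar> * h (cidx (y \<gamma>)))"
    by (rule sum.image_gen[OF F])
  also have "\<dots> \<le> (\<Sum>n\<in>(\<lambda>\<gamma>. cidx (y \<gamma>)) ` F. K * (1 + norm (rv n)) * h n)"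
  proof (rule sum_mono)
    fix n
    have "(\<Sum>\<gamma> | \<gamma> \<in> F \<and> cidx (y \<gamma>) = n. \<bar>v \<gamma>\<bar> * h (cidx (y \<gamma>))) = (\<Sum>\<gamma> | \<gamma> \<in> F
        \<and> cidx (y \<gamma>) = n. \<bar>v \<gamma>\<bar>) * h n"
      unfolding sum_distrib_right by (rule sum.cong) auto
    also have "\<dots> \<le> (\<Sum>\<gamma> | cidx (y \<gamma>) = n. \<bar>v \<gamma>\<bar>) * h n"
      by (intro mult_right_mono sum_mono2 fin h) auto
    also have "\<dots> \<le> K * (1 + norm (rv n)) * h n" by (intro mult_right_mono mass h)
    finally show "(\<Sum>\<gamma> | \<gamma> \<in> F \<and> cidx (y \<gamma>) = n. \<bar>v \<gamma>\<bar> * h (cidx (y \<gamma>))) \<le> K * (1 + norm (rv n)) * h n" .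
  qed
  finally show ?thesis .
qed

definition a :: "nat \<Rightarrow> real" where
  "a \<gamma> = \<bar>v \<gamma>\<bar> * (1 + norm (y \<gamma>)) powr (- s)"

lemma a_nonneg: "a \<gamma> \<ge> 0"
  by (simp add: a_def)

text \<open>The linear growth of the masses uses up one power of the decay, and the exponent
  \<open>s - 1\<close> that remains is still larger than the dimension.\<close>

lemma a_summable: "a summable_on UNIV"
proof -
  obtain A where A: "\<And>F :: (int^'n) set. finite F \<Longrightarrow> (\<Sum>n\<in>F. (1 + norm (rv n)) powr (- (s - 1))) \<le> A"
    using lattice_sum_bounded[where 'n = 'n, of "s - 1"] s d_def by auto
  show ?thesis
  proof (rule nonneg_bdd_above_summable_on)
    show "bdd_above (sum a ` {F. F \<subseteq> UNIV \<and> finite F})"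
    proof (rule bdd_aboveI2)
      fix F :: "nat set" assume "F \<in> {F. F \<subseteq> UNIV \<and> finite F}"
      then have F: "finite F" by simp
      let ?I = "(\<lambda>\<gamma>. cidx (y \<gamma>)) ` F"
      have "sum a F \<le> (\<Sum>n\<in>?I. K * (1 + norm (rv n)) * ((1 + d) powr s * (1 + norm (rv n)) powr (- s)))"
        unfolding a_def
        by (rule sum_points_le[OF F]) (auto intro!: powr_shift cidx_err)
      also have "\<dots> = (\<Sum>n\<in>?I. (K * (1 + d) powr s) * (1 + norm (rv n)) powr (- (s - 1)))"
      proof (intro sum.cong refl)
        fix n
        have "(1 + norm (rv n)) * (1 + norm (rv n)) powr (- s) = (1 + norm (rv n)) powr (- (s - 1))"
        proof -
          have "(1 + norm (rv n)) powr (1 + - s)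
              = (1 + norm (rv n)) powr 1 * (1 + norm (rv n)) powr (- s)"
            by (rule powr_add)
          moreover have "(1 + norm (rv n)) powr 1 = 1 + norm (rv n)" by (simp add: add_nonneg_nonneg)
          ultimately show ?thesis by simp
        qed
        then show "K * (1 + norm (rv n)) * ((1 + d) powr s * (1 + norm (rv n)) powr (- s))
            = (K * (1 + d) powr s) * (1 + norm (rv n)) powr (- (s - 1))"
          by (simp only: mult.assoc mult.left_commute)
      qed
      also have "\<dots> = (K * (1 + d) powr s) * (\<Sum>n\<in>?I. (1 + norm (rv n)) powr (- (s - 1)))"
          by (simp add: sum_distrib_left)
      also have "\<dots> \<le> (K * (1 + d) powr s) * A" using K_nonneg F by (intro mult_left_mono A) auto
      finally show "sum a F \<le> (K * (1 + d) powr s) * A" .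
    qed
  qed (simp add: a_nonneg)
qed

text \<open>The total influence of the points outside a ball; a multiple of it at
  \<open>L / 4\<close> becomes the rate \<open>\<delta>\<close> of
  \<open>finite_volume\<close>.\<close>

definition tail :: "real \<Rightarrow> real" where
  "tail r = infsum a {\<gamma>. norm (y \<gamma>) \<ge> r}"

lemma tail_ge_sum: "finite F \<Longrightarrow> (\<And>\<gamma>. \<gamma> \<in> F \<Longrightarrow> norm (y \<gamma>) \<ge> r) \<Longrightarrow> sum a F \<le> tail r"
  unfolding tail_def by (rule finite_sum_le_infsum) (auto simp: a_nonneg intro:
      summable_on_subset_banach[OF a_summable])

lemma tail_nonneg: "tail r \<ge> 0"
  using tail_ge_sum[of "{}" r] by simp

lemma tail_antimono: "r \<le> r' \<Longrightarrow> tail r' \<le> tail r"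
  unfolding tail_def
  by (rule infsum_mono_neutral) (auto simp: a_nonneg intro: summable_on_subset_banach[OF a_summable])

lemma tail_tendsto: "(tail \<longlongrightarrow> 0) at_top"
proof (rule tendstoI)
  fix e :: real assume e: "e > 0"
  have "(a has_sum infsum a UNIV) UNIV" by (rule has_sum_infsum[OF a_summable])
  then have "\<forall>\<^sub>F F in finite_subsets_at_top UNIV. dist (sum a F) (infsum a UNIV) < e"
    unfolding has_sum_def using e by (rule tendstoD)
  then obtain F where F: "finite F" "dist (sum a F) (infsum a UNIV) < e"
    unfolding eventually_finite_subsets_at_top by blast
  have "dist (tail r) 0 < e" if r: "r \<ge> (\<Sum>\<gamma>\<in>F. norm (y \<gamma>)) + 1" for r
  proof -
    have "norm (y \<gamma>) < r" if "\<gamma> \<in> F" for \<gamma>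
      using member_le_sum[OF that, of "\<lambda>\<gamma>. norm (y \<gamma>)"] F(1) r by simp
    then have sub: "{\<gamma>. norm (y \<gamma>) \<ge> r} \<subseteq> UNIV - F" using leD by blast
    have "tail r \<le> infsum a (UNIV - F)"
      unfolding tail_def by (rule infsum_mono_neutral) (use sub in \<open>auto simp: a_nonneg intro:
          summable_on_subset_banach[OF a_summable]\<close>)
    also have "\<dots> = infsum a UNIV - infsum a F"
      by (rule infsum_Diff) (use F in \<open>auto intro: a_summable\<close>)
    also have "\<dots> < e" using F by (simp add: dist_real_def)
    finally show ?thesis using tail_nonneg[of r] by simp
  qed
  then show "\<forall>\<^sub>F r in at_top. dist (tail r) 0 < e" by (auto simp: eventually_at_top_linorder)
qed

definition P :: "real \<Rightarrow> nat set" where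
  "P L = {\<gamma>. y \<gamma> \<in> box_L L}"

lemma finite_P: "finite (P L)"
proof -
  define N where "N = \<lceil>\<bar>L\<bar>\<rceil> + 1"
  have "P L \<subseteq> (\<Union>n\<in>{n :: int^'n. \<forall>i. \<bar>n $ i\<bar> \<le> N}. {\<gamma>. cidx (y \<gamma>) = n})"
  proof
    fix \<gamma> assume "\<gamma> \<in> P L"
    then have b: "- L / 2 \<le> y \<gamma> $ i \<and> y \<gamma> $ i < L / 2" for i by (auto simp: P_def box_L_def)
    have "\<bar>cidx (y \<gamma>) $ i\<bar> \<le> N" for i
    proof -
      have "\<bar>y \<gamma> $ i\<bar> \<le> \<bar>L\<bar>" using b[of i] by linarith
      also have "\<bar>L\<bar> \<le> of_int \<lceil>\<bar>L\<bar>\<rceil>" by (rule le_of_int_ceiling)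
      finally have "\<bar>y \<gamma> $ i\<bar> \<le> of_int \<lceil>\<bar>L\<bar>\<rceil>" .
      then show ?thesis unfolding cidx_def N_def by (simp add: abs_le_iff) linarith
    qed
    then show "\<gamma> \<in> (\<Union>n\<in>{n :: int^'n. \<forall>i. \<bar>n $ i\<bar> \<le> N}. {\<gamma>. cidx (y \<gamma>) = n})" by auto
  qed
  then show ?thesis by (rule finite_subset) (intro finite_UN_I finite_int_box fin)
qed

section \<open>Growth and locality of the periodized potential\<close>

definition W :: "real \<Rightarrow> real^'n \<Rightarrow> real" where
  "W L x = (\<Sum>\<gamma>\<in>P L. v \<gamma> * B (wrap L (x - y \<gamma>)))"

lemma W_measurable: "W L \<in> borel_measurable borel"
proof -
  have wm: "(\<lambda>x :: real^'n. wrap L (x - c)) \<in> borel_measurable borel" for c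
    unfolding wrap_def
  proof (rule borel_measurable_euclidean_space[THEN iffD2], rule ballI)
    fix b :: "real^'n" assume "b \<in> Basis"
    then obtain i where b: "b = axis i 1" by (auto simp: Basis_vec_def)
    show "(\<lambda>x. (\<chi> i. (x - c) $ i - L * of_int \<lfloor>(x - c) $ i / L + 1 / 2\<rfloor>) \<bullet> b) \<in> borel_measurable borel"
      unfolding b inner_axis by simp
  qed
  have "(\<lambda>x. B (wrap L (x - c))) \<in> borel_measurable borel" for c
    using measurable_compose[OF wm B_meas] .
  then show ?thesis unfolding W_def by (intro borel_measurable_sum borel_measurable_times) auto
qed

lemma B_le_C: "\<bar>B x\<bar> \<le> C"
proof -
  have "(1 + norm x) powr (- s) \<le> 1 powr (- s)" using s_pos by (intro powr_mono2') auto
  then have "C * (1 + norm x) powr (- s) \<le> C * 1" using C_nonneg by (intro mult_left_mono) auto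
  then show ?thesis using B_le[of x] by linarith
qed

lemma W_bounded: "\<bar>W L x\<bar> \<le> (\<Sum>\<gamma>\<in>P L. \<bar>v \<gamma>\<bar> * C)"
  unfolding W_def
  by (rule order_trans[OF sum_abs], rule sum_mono) (auto simp: abs_mult intro!: mult_left_mono B_le_C)

text \<open>If \<open>norm x \<le> L / 8\<close>, the coordinates of \<open>x - y \<gamma>\<close>
  stay below \<open>3 * L / 8\<close>, hence inside the box: for these points periodization does
  nothing, in this box and in any larger one.\<close>

definition near :: "real \<Rightarrow> nat set" where
  "near L = {\<gamma>. \<forall>i. \<bar>y \<gamma> $ i\<bar> < L / 4}"

lemma near_subset: 
  assumes "0 < L0" "L0 \<le> L" shows "near L0 \<subseteq> P L"
  unfolding near_def P_def box_L_def
proof clarify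
  fix \<gamma> i assume "\<forall>i. \<bar>y \<gamma> $ i\<bar> < L0 / 4"
  then have "\<bar>y \<gamma> $ i\<bar> < L0 / 4" by blast
  then show "- L / 2 \<le> y \<gamma> $ i \<and> y \<gamma> $ i < L / 2" using assms by linarith
qed

lemma near_wrap:
  assumes "0 < L0" "L0 \<le> L" "norm x \<le> L0 / 8" "\<gamma> \<in> near L0" shows "wrap L (x - y \<gamma>) = x - y \<gamma>"
proof (rule wrap_id)
  have "- L / 2 \<le> (x - y \<gamma>) $ i \<and> (x - y \<gamma>) $ i < L / 2" for i
  proof -
    have "\<bar>x $ i\<bar> \<le> L0 / 8" using component_le_norm_cart[of x i] assms(3) by linarith
    moreover have "\<bar>y \<gamma> $ i\<bar> < L0 / 4" using assms(4) by (simp add: near_def)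
    ultimately have "\<bar>x $ i - y \<gamma> $ i\<bar> < L / 2" using assms(1,2) by linarith
    then show ?thesis unfolding vector_minus_component by linarith
  qed
  then show "x - y \<gamma> \<in> box_L L" by (simp add: box_L_def)
qed (use assms in simp)

text \<open>By \<open>wrap_diff_lower\<close> the wrapped distance of a far point is at least
  \<open>norm (y \<gamma>) / (2 * d)\<close>. Its contribution is therefore dominated by
  \<open>a \<gamma>\<close> up to a constant that does not depend on \<open>L\<close>.\<close>

lemma far_sum:
  assumes L: "0 < L0" "L0 \<le> L" and x: "norm x \<le> L0 / 8"
  shows "(\<Sum>\<gamma>\<in>P L - near L0. \<bar>v \<gamma> * B (wrap L (x - y \<gamma>))\<bar>) \<le> C * (2 * d) powr s * tail (L0 / 4)"
proof -
  have far: "\<exists>j. \<bar>y \<gamma> $ j\<bar> \<ge> L0 / 4" if "\<gamma> \<in> P L - near L0" for \<gamma>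
    using that by (auto simp: near_def not_less)
  note d1 = d_ge_1
  have "(\<Sum>\<gamma>\<in>P L - near L0. \<bar>v \<gamma> * B (wrap L (x - y \<gamma>))\<bar>)
      \<le> (\<Sum>\<gamma>\<in>P L - near L0. (C * (2 * d) powr s) * a \<gamma>)"
  proof (rule sum_mono)
    fix \<gamma> assume g: "\<gamma> \<in> P L - near L0"
    obtain j where j: "\<bar>y \<gamma> $ j\<bar> \<ge> L0 / 4" using far[OF g] by blast
    have "norm (y \<gamma>) \<le> 2 * d * norm (wrap L (x - y \<gamma>))"
      unfolding d_def by (rule wrap_diff_lower[OF L x _ j]) (use g in \<open>simp add: P_def\<close>)
    then have "1 + norm (y \<gamma>) \<le> 2 * d * (1 + norm (wrap L (x - y \<gamma>)))" using d1
        by (simp add: algebra_simps)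
    then have "(1 + norm (y \<gamma>)) / (2 * d) \<le> 1 + norm (wrap L (x - y \<gamma>))" using d1
        by (simp add: field_simps)
    then have "(1 + norm (wrap L (x - y \<gamma>))) powr (- s) \<le> ((1 + norm (y \<gamma>)) / (2 * d)) powr (- s)"
      using s_pos d1 by (intro powr_mono2') (auto simp: add_pos_nonneg)
    also have "\<dots> = (2 * d) powr s * (1 + norm (y \<gamma>)) powr (- s)"
      using d1 by (simp add: powr_divide powr_minus field_simps)
    finally have "\<bar>B (wrap L (x - y \<gamma>))\<bar> \<le> C * ((2 * d) powr s * (1 + norm (y \<gamma>)) powr (- s))"
      using B_le[of "wrap L (x - y \<gamma>)"] C_nonneg by (meson mult_left_mono order_trans)
    then have "\<bar>v \<gamma>\<bar> * \<bar>B (wrap L (x - y \<gamma>))\<bar>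
        \<le> \<bar>v \<gamma>\<bar> * (C * ((2 * d) powr s * (1 + norm (y \<gamma>)) powr (- s)))"
      by (intro mult_left_mono) auto
    then show "\<bar>v \<gamma> * B (wrap L (x - y \<gamma>))\<bar> \<le> (C * (2 * d) powr s) * a \<gamma>"
      by (simp add: abs_mult a_def ac_simps)
  qed
  also have "\<dots> = (C * (2 * d) powr s) * sum a (P L - near L0)" by (simp add: sum_distrib_left)
  also have "\<dots> \<le> (C * (2 * d) powr s) * tail (L0 / 4)"
  proof (intro mult_left_mono tail_ge_sum)
    fix \<gamma> assume g: "\<gamma> \<in> P L - near L0"
    obtain j where "\<bar>y \<gamma> $ j\<bar> \<ge> L0 / 4" using far[OF g] by blast
    then show "L0 / 4 \<le> norm (y \<gamma>)" using component_le_norm_cart[of "y \<gamma>" j] by linarith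
  qed (use finite_P C_nonneg in auto)
  finally show ?thesis .
qed

text \<open>The near sum depends on \<open>L0\<close> and \<open>x\<close> but not on
  \<open>L\<close>. Comparing two box sizes with the same near sum yields locality of the
  potential.\<close>

lemma W_split:
  assumes L: "0 < L0" "L0 \<le> L" and x: "norm x \<le> L0 / 8"
  shows "\<bar>W L x - (\<Sum>\<gamma>\<in>near L0. v \<gamma> * B (x - y \<gamma>))\<bar> \<le> C * (2 * d) powr s * tail (L0 / 4)"
proof -
  have "W L x = (\<Sum>\<gamma>\<in>P L - near L0. v \<gamma> * B (wrap L (x - y \<gamma>)))
      + (\<Sum>\<gamma>\<in>near L0. v \<gamma> * B (wrap L (x - y \<gamma>)))"
    unfolding W_def by (rule sum.subset_diff[OF near_subset[OF L] finite_P])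
  also have "(\<Sum>\<gamma>\<in>near L0. v \<gamma> * B (wrap L (x - y \<gamma>))) = (\<Sum>\<gamma>\<in>near L0. v \<gamma> * B (x - y \<gamma>))"
    using near_wrap[OF L x] by (intro sum.cong refl) simp
  finally have "\<bar>W L x - (\<Sum>\<gamma>\<in>near L0. v \<gamma> * B (x - y \<gamma>))\<bar>
      = \<bar>\<Sum>\<gamma>\<in>P L - near L0. v \<gamma> * B (wrap L (x - y \<gamma>))\<bar>" by simp
  also have "\<dots> \<le> (\<Sum>\<gamma>\<in>P L - near L0. \<bar>v \<gamma> * B (wrap L (x - y \<gamma>))\<bar>)" by (rule sum_abs)
  also have "\<dots> \<le> C * (2 * d) powr s * tail (L0 / 4)" by (rule far_sum[OF L x])
  finally show ?thesis .
qed

text \<open>The unit cubes met by \<open>near L\<close> have masses of order \<open>L\<close>, and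
  the decay of \<open>B\<close> is summed around \<open>x\<close>. Since lattice sums are
  translation invariant, the bound is uniform in \<open>x\<close>.\<close>

lemma near_sum:
  "\<exists>c\<ge>0. \<forall>L\<ge>1. \<forall>x. \<bar>\<Sum>\<gamma>\<in>near L. v \<gamma> * B (x - y \<gamma>)\<bar> \<le> c * L"
proof -
  obtain A where A0: "A \<ge> 0" and A: "\<And>F :: (int^'n) set. finite F
      \<Longrightarrow> (\<Sum>n\<in>F. (1 + norm (rv n)) powr (- s)) \<le> A"
    using lattice_sum_bounded[where 'n = 'n, of s] s d_def by auto
  have d0: "d \<ge> 0" using d_ge_1 by simp
  \<comment> \<open>One factor for moving the point to its cube's corner, the other for moving
    \<open>x\<close> to its own.\<close>
  define D where "D = (1 + d) powr s * (1 + d) powr s"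
  have D: "D \<ge> 0" by (simp add: D_def)
  have main: "\<bar>\<Sum>\<gamma>\<in>near L. v \<gamma> * B (x - y \<gamma>)\<bar> \<le> (K * (1 + 2 * d) * C * D * A) * L" if L: "L \<ge> 1" for L x
  proof -
    have fn: "finite (near L)" using near_subset[of L L] finite_P L
        by (meson finite_subset less_le_trans order_refl zero_less_one)
    let ?I = "(\<lambda>\<gamma>. cidx (y \<gamma>)) ` near L"
    define h where "h n = C * (D * (1 + norm (rv (cidx x - n))) powr (- s))" for n
    have "\<bar>\<Sum>\<gamma>\<in>near L. v \<gamma> * B (x - y \<gamma>)\<bar> \<le> (\<Sum>\<gamma>\<in>near L. \<bar>v \<gamma>\<bar> * \<bar>B (x - y \<gamma>)\<bar>)"
      by (rule order_trans[OF sum_abs]) (simp add: abs_mult)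
    also have "\<dots> \<le> (\<Sum>n\<in>?I. K * (1 + norm (rv n)) * h n)"
    proof (rule sum_points_le[OF fn])
      fix \<gamma>
      have "norm ((x - y \<gamma>) - (x - rv (cidx (y \<gamma>)))) \<le> d"
        using cidx_err[of "y \<gamma>"] by (simp add: norm_minus_commute)
      then have 1: "(1 + norm (x - y \<gamma>)) powr (- s)
          \<le> (1 + d) powr s * (1 + norm (x - rv (cidx (y \<gamma>)))) powr (- s)" by (rule powr_shift)
      have "(1 + norm (x - rv (cidx (y \<gamma>)))) powr (- s)
          \<le> (1 + d) powr s * (1 + norm (rv (cidx x - cidx (y \<gamma>)))) powr (- s)"
      proof (rule powr_shift)
        show "norm ((x - rv (cidx (y \<gamma>))) - rv (cidx x - cidx (y \<gamma>))) \<le> d"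
          using cidx_err[of x] by (simp add: rv_diff)
      qed
      then have "(1 + d) powr s * (1 + norm (x - rv (cidx (y \<gamma>)))) powr (- s)
          \<le> (1 + d) powr s * ((1 + d) powr s * (1 + norm (rv (cidx x - cidx (y \<gamma>)))) powr (- s))"
        by (intro mult_left_mono) auto
      with 1 have "(1 + norm (x - y \<gamma>)) powr (- s)
          \<le> D * (1 + norm (rv (cidx x - cidx (y \<gamma>)))) powr (- s)"
        unfolding D_def mult.assoc by linarith
      then show "\<bar>B (x - y \<gamma>)\<bar> \<le> h (cidx (y \<gamma>))"
        unfolding h_def using B_le[of "x - y \<gamma>"] C_nonneg by (meson mult_left_mono order_trans)
    qed (use C_nonneg D in \<open>simp add: h_def\<close>)
    also have "\<dots> \<le> (\<Sum>n\<in>?I. (K * ((1 + 2 * d) * L)) * h n)"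
    proof (rule sum_mono)
      fix n assume "n \<in> ?I"
      then obtain \<gamma> where g: "\<gamma> \<in> near L" "n = cidx (y \<gamma>)" by blast
      have "norm (y \<gamma>) \<le> (\<Sum>i\<in>UNIV. \<bar>y \<gamma> $ i\<bar>)" by (rule norm_le_l1_cart)
      also have "\<dots> \<le> (\<Sum>i\<in>(UNIV :: 'n set). L)"
      proof (rule sum_mono)
        fix i
        have "\<bar>y \<gamma> $ i\<bar> < L / 4" using g by (simp add: near_def)
        then show "\<bar>y \<gamma> $ i\<bar> \<le> L" using L by linarith
      qed
      finally have "norm (y \<gamma>) \<le> d * L" by (simp add: d_def)
      moreover have "norm (rv n) \<le> norm (y \<gamma>) + d"
        using cidx_err[of "y \<gamma>"] norm_triangle_ineq2[of "rv n" "y \<gamma>"] g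
            by (simp add: norm_minus_commute)
      moreover have "d * 1 \<le> d * L" using L d0 by (intro mult_left_mono) auto
      ultimately have "1 + norm (rv n) \<le> (1 + 2 * d) * L" using L by (simp add: algebra_simps)
      then show "K * (1 + norm (rv n)) * h n \<le> (K * ((1 + 2 * d) * L)) * h n"
        using K_nonneg C_nonneg D by (intro mult_right_mono mult_left_mono) (auto simp: h_def)
    qed
    also have "\<dots> = (K * ((1 + 2 * d) * L)) * (C * (D * (\<Sum>n\<in>?I. (1
        + norm (rv (cidx x - n))) powr (- s))))"
      by (simp add: h_def sum_distrib_left)
    also have "\<dots> \<le> (K * ((1 + 2 * d) * L)) * (C * (D * A))"
    proof (intro mult_left_mono)
      have "(\<Sum>n\<in>?I. (1 + norm (rv (cidx x - n))) powr (- s))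
          = (\<Sum>n\<in>(\<lambda>n. cidx x - n) ` ?I. (1 + norm (rv n)) powr (- s))"
        by (subst sum.reindex) (auto simp: inj_on_def)
      also have "\<dots> \<le> A" by (rule A) (use fn in auto)
      finally show "(\<Sum>n\<in>?I. (1 + norm (rv (cidx x - n))) powr (- s)) \<le> A" .
    qed (use D C_nonneg K_nonneg L d0 in auto)
    finally show ?thesis by (simp add: ac_simps)
  qed
  moreover have "K * (1 + 2 * d) * C * D * A \<ge> 0" using K_nonneg C_nonneg D A0 d0 by simp
  ultimately show ?thesis by blast
qed

lemma finite_volume_W:
  "\<exists>Kc \<delta>. finite_volume (\<lambda>L x. lam * W L x) 1 Kc \<delta>"
proof -
  obtain c where c: "c \<ge> 0" "\<And>L x. L \<ge> 1 \<Longrightarrow> \<bar>\<Sum>\<gamma>\<in>near L. v \<gamma> * B (x - y \<gamma>)\<bar> \<le> c * L"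
    using near_sum by blast
  define D where "D = C * (2 * d) powr s"
  have D: "D \<ge> 0" using C_nonneg by (simp add: D_def)
  \<comment> \<open>\<open>tail 0\<close> is the full sum and dominates every tail; for
    \<open>L \<ge> 1\<close> this constant fits under the linear growth bound.\<close>
  have "finite_volume (\<lambda>L x. lam * W L x) 1 (lam * (c + D * tail 0)) (\<lambda>L. lam * (2 * D * tail (L / 4)))"
  proof
    show "(\<lambda>x. lam * W L x) \<in> borel_measurable borel" for L using W_measurable by simp
    show "\<exists>b. \<forall>x\<in>box_L L. \<bar>lam * W L x\<bar> \<le> b" for L
      using W_bounded lam by (intro exI[of _ "lam * (\<Sum>\<gamma>\<in>P L. \<bar>v \<gamma>\<bar> * C)"]) (auto simp: abs_mult
          intro!: mult_left_mono)
    show "\<bar>lam * W L x\<bar> \<le> lam * (c + D * tail 0) * L" if L: "1 \<le> L" and x: "norm x \<le> L / 8" for L x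
    proof -
      have "\<bar>W L x - (\<Sum>\<gamma>\<in>near L. v \<gamma> * B (x - y \<gamma>))\<bar> \<le> D * tail (L / 4)"
        unfolding D_def by (rule W_split) (use L x in auto)
      also have "\<dots> \<le> D * tail 0 * 1" using D L by (simp add: mult_left_mono tail_antimono)
      also have "\<dots> \<le> D * tail 0 * L" using D L tail_nonneg[of 0] by (intro mult_left_mono) auto
      finally have "\<bar>W L x\<bar> \<le> c * L + D * tail 0 * L" using c(2)[OF L, of x] by linarith
      then have "lam * \<bar>W L x\<bar> \<le> lam * (c * L + D * tail 0 * L)" using lam by (intro mult_left_mono)
      then show ?thesis using lam by (simp add: abs_mult algebra_simps)
    qed
    show "\<bar>lam * W L x - lam * W L0 x\<bar> \<le> lam * (2 * D * tail (L0 / 4))" if L: "1 \<le> L0" "L0 \<le> L"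
        and x: "norm x \<le> L0 / 8" for L0 L x
    proof -
      have L0: "L0 > 0" using L by simp
      have "\<bar>W L x - W L0 x\<bar> \<le> 2 * D * tail (L0 / 4)"
        using W_split[OF L0 L(2) x] W_split[OF L0 order_refl x] unfolding D_def[symmetric] by linarith
      then have "lam * \<bar>W L x - W L0 x\<bar> \<le> lam * (2 * D * tail (L0 / 4))" using lam
          by (intro mult_left_mono)
      then show ?thesis using lam by (simp add: abs_mult flip: right_diff_distrib)
    qed
    have "((\<lambda>L. tail (L / 4)) \<longlongrightarrow> 0) at_top"
      by (rule filterlim_compose[OF tail_tendsto]) real_asymp
    then have "((\<lambda>L. lam * (2 * D * tail (L / 4))) \<longlongrightarrow> lam * (2 * D * 0)) at_top"
      by (intro tendsto_intros)
    then show "((\<lambda>L. lam * (2 * D * tail (L / 4))) \<longlongrightarrow> 0) at_top" by simp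
  qed simp
  then show ?thesis by blast
qed

end

section \<open>The Poisson model\<close>

definition cube :: "int^'n \<Rightarrow> (real^'n) set" where
  "cube n = {x. cidx x = n}"

lemma cube_eq: "cube n = {x. \<forall>i. of_int (n $ i) \<le> x $ i \<and> x $ i < of_int (n $ i) + 1}"
  by (auto simp: cube_def cidx_def vec_eq_iff floor_eq_iff)

lemma cube_borel [measurable]: "cube n \<in> sets (borel :: (real^'n) measure)"
  unfolding cube_eq by measurable

lemma cube_bounded: "bounded (cube n :: (real^'n) set)"
  by (rule bounded_subset[OF bounded_cbox[of "rv n" "rv n + 1"]])
     (auto simp: cube_eq mem_box_cart rv_def less_imp_le)

lemma measure_cube: "measure lborel (cube n :: (real^'n) set) = 1"
proof -
  have b1: "(rv n + 1 - rv n) \<bullet> b = 1" if "b \<in> Basis" for b :: "real^'n"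
    using that by (auto simp: Basis_vec_def inner_axis)
  have le: "rv n \<bullet> b \<le> (rv n + 1) \<bullet> b" if "b \<in> Basis" for b :: "real^'n"
    using b1[OF that] by (simp add: inner_add_left)
  have "emeasure lborel (box (rv n) (rv n + 1 :: real^'n)) \<le> emeasure lborel (cube n)"
    by (rule emeasure_mono) (auto simp: cube_eq mem_box_cart rv_def less_imp_le)
  moreover have "emeasure lborel (cube n) \<le> emeasure lborel (cbox (rv n) (rv n + 1 :: real^'n))"
    by (rule emeasure_mono) (auto simp: cube_eq mem_box_cart rv_def less_imp_le)
  moreover have "emeasure lborel (box (rv n) (rv n + 1 :: real^'n)) = 1"
    by (subst emeasure_lborel_box[OF le]) (use b1 in \<open>auto intro!: prod.neutral\<close>)
  moreover have "emeasure lborel (cbox (rv n) (rv n + 1 :: real^'n)) = 1"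
    by (subst emeasure_lborel_cbox[OF le]) (use b1 in \<open>auto intro!: prod.neutral\<close>)
  ultimately have "emeasure lborel (cube n :: (real^'n) set) = 1" by simp
  then show ?thesis by (simp add: measure_def)
qed

text \<open>The sum is at most the number of terms times the largest term. This is cruder than the
  power mean inequality by one factor of the cardinality, which is harmless because Poisson counts
  have all moments.\<close>

lemma power_sum_le:
  fixes a :: "'i \<Rightarrow> real"
  assumes F: "finite F" and a: "\<And>i. i \<in> F \<Longrightarrow> a i \<ge> 0"
  shows "(\<Sum>i\<in>F. a i) ^ Suc p \<le> real (card F) ^ Suc p * (\<Sum>i\<in>F. a i ^ Suc p)"
proof (cases "F = {}")
  case False
  have "Max (a ` F) \<in> a ` F" using F False by (intro Max_in) auto
  then obtain j where j: "j \<in> F" "Max (a ` F) = a j" by auto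
  have "(\<Sum>i\<in>F. a i) \<le> (\<Sum>i\<in>F. a j)"
    by (rule sum_mono) (use F j in \<open>auto simp flip: j(2)\<close>)
  then have "(\<Sum>i\<in>F. a i) ^ Suc p \<le> (card F * a j) ^ Suc p"
    by (intro power_mono sum_nonneg a) auto
  also have "\<dots> = real (card F) ^ Suc p * a j ^ Suc p" by (rule power_mult_distrib)
  also have "\<dots> \<le> real (card F) ^ Suc p * (\<Sum>i\<in>F. a i ^ Suc p)"
    by (intro mult_left_mono member_le_sum j F) (use a in auto)
  finally show ?thesis .
qed simp

text \<open>Measurability of the level sets is recovered from the formula itself: a nonmeasurable
  set has \<open>measure\<close> 0, whereas the stated values are positive. As the probabilities add
  up to 1, finiteness holds almost surely; \<open>fin\<close> keeps apart empty and infinite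
  configurations, both of which have \<open>card\<close> 0. The moment bound uses
  \<open>k \<le> exp k\<close>, which turns the series into that of
  \<open>exp (exp q)\<close>.\<close>

lemma (in prob_space) poisson_moment:
  fixes N :: "'a \<Rightarrow> nat" and fin :: "'a \<Rightarrow> bool"
  assumes poi: "\<And>k. measure M {\<omega> \<in> space M. fin \<omega> \<and> N \<omega> = k} = exp (- 1) * 1 ^ k / fact k"
  shows "AE \<omega> in M. fin \<omega>" and "(\<integral>\<^sup>+\<omega>. ennreal (real (N \<omega>) ^ q) \<partial>M) \<le> ennreal (exp (exp (real q)))"
proof -
  define X where "X k = {\<omega> \<in> space M. fin \<omega> \<and> N \<omega> = k}" for k
  have mX: "measure M (X k) = exp (- 1) / fact k" for k using poi[of k] by (simp add: X_def)
  have X [measurable]: "X k \<in> sets M" for k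
  proof (rule ccontr)
    assume "X k \<notin> sets M"
    then have "measure M (X k) = 0" by (rule measure_notin_sets)
    then show False by (simp add: mX)
  qed
  have disj: "disjoint_family X" by (auto simp: disjoint_family_on_def X_def)
  have "(\<lambda>k. measure M (X k)) sums measure M (\<Union>k. X k)"
    by (rule finite_measure_UNION) (use X disj in auto)
  moreover have "(\<lambda>k. measure M (X k)) sums 1"
  proof -
    have "(\<lambda>k. exp (- 1) * (1 ^ k /\<^sub>R fact k)) sums (exp (- 1) * exp (1::real))"
      by (intro sums_mult exp_converges)
    then show ?thesis by (simp add: mX divide_inverse flip: exp_add)
  qed
  ultimately have "prob (\<Union>k. X k) = 1" using sums_unique2 by blast
  then have AE_X: "AE \<omega> in M. \<omega> \<in> (\<Union>k. X k)"
    using prob_eq_1[of "\<Union>k. X k"] X by auto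
  then show "AE \<omega> in M. fin \<omega>" by eventually_elim (auto simp: X_def)
  have "(\<integral>\<^sup>+\<omega>. ennreal (real (N \<omega>) ^ q) \<partial>M) = (\<integral>\<^sup>+\<omega>. (\<Sum>k. ennreal (real k ^ q) * indicator (X k) \<omega>) \<partial>M)"
  proof (rule nn_integral_cong_AE)
    show "AE \<omega> in M. ennreal (real (N \<omega>) ^ q) = (\<Sum>k. ennreal (real k ^ q) * indicator (X k) \<omega>)"
      using AE_X
    proof eventually_elim
      case (elim \<omega>)
      then have "(\<Sum>k. ennreal (real k ^ q) * indicator (X k) \<omega>)
          = (\<Sum>k\<in>{N \<omega>}. ennreal (real k ^ q) * indicator (X k) \<omega>)"
        by (intro suminf_finite) (auto simp: X_def indicator_def)
      also have "\<dots> = ennreal (real (N \<omega>) ^ q)" using elim by (auto simp: X_def indicator_def)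
      finally show ?case by simp
    qed
  qed
  also have "\<dots> = (\<Sum>k. ennreal (real k ^ q) * emeasure M (X k))"
    by (subst nn_integral_suminf) (auto simp: nn_integral_cmult_indicator)
  also have "\<dots> \<le> (\<Sum>k. ennreal (exp (real q) ^ k /\<^sub>R fact k))"
  proof (rule suminf_le)
    fix k
    have "real k \<le> exp (real k)" using exp_ge_add_one_self[of "real k"] by linarith
    then have "real k ^ q \<le> exp (real k) ^ q" by (intro power_mono) auto
    also have "\<dots> = exp (real q) ^ k" by (simp add: exp_of_nat_mult[symmetric] mult.commute)
    finally have "real k ^ q * (exp (- 1) / fact k) \<le> exp (real q) ^ k * (1 / fact k)"
      by (intro mult_mono divide_right_mono) auto
    then have "ennreal (real k ^ q) * ennreal (exp (- 1) / fact k)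
        \<le> ennreal (exp (real q) ^ k /\<^sub>R fact k)"
      by (simp add: divide_inverse mult.commute ennreal_mult'[symmetric] del: ennreal_mult'')
    then show "ennreal (real k ^ q) * emeasure M (X k) \<le> ennreal (exp (real q) ^ k /\<^sub>R fact k)"
      by (simp add: emeasure_eq_measure mX)
  qed auto
  also have "\<dots> = ennreal (exp (exp (real q)))"
    by (intro suminf_ennreal_eq exp_converges) auto
  finally show "(\<integral>\<^sup>+\<omega>. ennreal (real (N \<omega>) ^ q) \<partial>M) \<le> ennreal (exp (exp (real q)))" .
qed

text \<open>Independence makes the joint law agree with the product law on rectangles and hence
  everywhere; Tonelli does the rest. Values in \<open>ennreal\<close> spare integrability
  conditions.\<close>

lemma (in prob_space) nn_integral_indep_mult:
  assumes X: "X \<in> M \<rightarrow>\<^sub>M S" and Y: "Y \<in> M \<rightarrow>\<^sub>M T"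
    and indep: "indep_set {X -` A \<inter> space M | A. A \<in> sets S} {Y -` A \<inter> space M | A. A \<in> sets T}"
    and f [measurable]: "f \<in> borel_measurable S" and g [measurable]: "g \<in> borel_measurable T"
  shows "(\<integral>\<^sup>+\<omega>. f (X \<omega>) * g (Y \<omega>) \<partial>M) = (\<integral>\<^sup>+\<omega>. f (X \<omega>) \<partial>M) * (\<integral>\<^sup>+\<omega>. g (Y \<omega>) \<partial>M)"
proof -
  note [measurable] = X Y
  have eq: "distr M S X \<Otimes>\<^sub>M distr M T Y = distr M (S \<Otimes>\<^sub>M T) (\<lambda>\<omega>. (X \<omega>, Y \<omega>))"
  proof (rule pair_measure_eqI)
    show "sigma_finite_measure (distr M S X)" "sigma_finite_measure (distr M T Y)"
      using prob_space_distr[OF X] prob_space_distr[OF Y] by (simp_all add: prob_space_imp_sigma_finite)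
    fix A B assume A: "A \<in> sets (distr M S X)" and B: "B \<in> sets (distr M T Y)"
    have "prob ((X -` A \<inter> space M) \<inter> (Y -` B \<inter> space M))
        = prob (X -` A \<inter> space M) * prob (Y -` B \<inter> space M)"
      by (rule indep_setD[OF indep]) (use A B in auto)
    moreover have "(\<lambda>\<omega>. (X \<omega>, Y \<omega>)) -` (A \<times> B) \<inter> space M = (X -` A \<inter> space M) \<inter> (Y -` B \<inter> space M)"
        by auto
    ultimately show "emeasure (distr M S X) A * emeasure (distr M T Y) B
        = emeasure (distr M (S \<Otimes>\<^sub>M T) (\<lambda>\<omega>. (X \<omega>, Y \<omega>))) (A \<times> B)"
      using A B by (simp add: emeasure_distr emeasure_eq_measure ennreal_mult')
  qed simp
  interpret DY: prob_space "distr M T Y" by (rule prob_space_distr[OF Y])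
  have "(\<integral>\<^sup>+\<omega>. f (X \<omega>) * g (Y \<omega>) \<partial>M) = (\<integral>\<^sup>+p. f (fst p) * g (snd p) \<partial>distr M (S \<Otimes>\<^sub>M T) (\<lambda>\<omega>. (X \<omega>, Y
      \<omega>)))"
    by (subst nn_integral_distr) auto
  also have "\<dots> = (\<integral>\<^sup>+a. \<integral>\<^sup>+b. f a * g b \<partial>distr M T Y \<partial>distr M S X)"
    unfolding eq[symmetric] by (subst DY.nn_integral_fst[symmetric]) auto
  also have "\<dots> = (\<integral>\<^sup>+a. f a * (\<integral>\<^sup>+b. g b \<partial>distr M T Y) \<partial>distr M S X)"
    by (intro nn_integral_cong nn_integral_cmult) simp
  also have "\<dots> = (\<integral>\<^sup>+a. f a \<partial>distr M S X) * (\<integral>\<^sup>+b. g b \<partial>distr M T Y)"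
    by (rule nn_integral_multc) simp
  also have "\<dots> = (\<integral>\<^sup>+\<omega>. f (X \<omega>) \<partial>M) * (\<integral>\<^sup>+\<omega>. g (Y \<omega>) \<partial>M)"
    by (simp add: nn_integral_distr)
  finally show ?thesis .
qed

text \<open>The moment of order \<open>d + 1\<close> of the mass in a unit cube is bounded uniformly over the cubes, by
  \<open>(\<Sum>a)\<^sup>p \<le> N\<^sup>p * (\<Sum>a\<^sup>p)\<close> for \<open>N\<close> summands. Hence
  \<open>\<Sum>n. (mass n / (1 + |n|))\<^sup>d\<^sup>+\<^sup>1\<close> has finite expectation.\<close>

lemma AE_linear_mass:
  fixes M :: "'w measure" and y :: "nat \<Rightarrow> 'w \<Rightarrow> real^'n" and v :: "nat \<Rightarrow> 'w \<Rightarrow> real"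
  assumes M: "prob_space M"
    and y_meas: "(\<lambda>\<omega> \<gamma>. y \<gamma> \<omega>) \<in> M \<rightarrow>\<^sub>M Pi\<^sub>M UNIV (\<lambda>_. borel)"
    and v_meas: "(\<lambda>\<omega> \<gamma>. v \<gamma> \<omega>) \<in> M \<rightarrow>\<^sub>M Pi\<^sub>M UNIV (\<lambda>_. borel)"
    and poisson: "poisson_pp M y"
    and v_ident: "\<And>\<gamma>. distr M borel (v \<gamma>) = distr M borel (v 0)"
    and v_moment: "integrable M (\<lambda>\<omega>. (v 0 \<omega>) ^ Suc CARD('n))"
    and yv_indep: "prob_space.indep_set M
        {(\<lambda>\<omega> \<gamma>. y \<gamma> \<omega>) -` X \<inter> space M | X. X \<in> sets (Pi\<^sub>M UNIV (\<lambda>_. borel :: (real^'n) measure))}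
        {(\<lambda>\<omega> \<gamma>. v \<gamma> \<omega>) -` X \<inter> space M | X. X \<in> sets (Pi\<^sub>M UNIV (\<lambda>_. borel :: real measure))}"
  shows "AE \<omega> in M. (\<forall>n. finite {\<gamma>. cidx (y \<gamma> \<omega>) = n}) \<and>
     (\<exists>K. \<forall>n. (\<Sum>\<gamma> | cidx (y \<gamma> \<omega>) = n. \<bar>v \<gamma> \<omega>\<bar>) \<le> K * (1 + norm (rv n)))"
proof -
  interpret prob_space M by (rule M)
  define p where "p = Suc CARD('n)"
  have ym [measurable]: "y \<gamma> \<in> borel_measurable M" for \<gamma>
    using measurable_compose[OF y_meas measurable_component_singleton[of \<gamma> UNIV]] by simp
  have vm [measurable]: "v \<gamma> \<in> borel_measurable M" for \<gamma>
    using measurable_compose[OF v_meas measurable_component_singleton[of \<gamma> UNIV]] by simp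
  have pts: "{\<gamma>. y \<gamma> \<omega> \<in> cube n} = {\<gamma>. cidx (y \<gamma> \<omega>) = n}" for \<omega> n by (simp add: cube_def)
  have poi: "measure M {\<omega> \<in> space M. finite {\<gamma>. y \<gamma> \<omega> \<in> cube n}
      \<and> card {\<gamma>. y \<gamma> \<omega> \<in> cube n} = k} = exp (- 1) * 1 ^ k / fact k" for n k
    using poisson cube_borel[of n] cube_bounded[of n] by (simp add: poisson_pp_def measure_cube)
  have fin: "AE \<omega> in M. finite {\<gamma>. y \<gamma> \<omega> \<in> cube n}" for n by (rule poisson_moment(1)[OF poi])
  \<comment> \<open>The count is a function of the whole sequence of positions, with infinite counts
    allowed. This makes it measurable on the product space, where independence from the sequence of
    weights is assumed.\<close>
  define T where "T n \<eta> = (\<Sum>\<gamma>. indicator (cube n) (\<eta> \<gamma>) :: ennreal)" for n :: "int^'n"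
      and \<eta> :: "nat \<Rightarrow> real^'n"
  define S where "S n \<omega> = (\<Sum>\<gamma>. indicator (cube n) (y \<gamma> \<omega>) * ennreal \<bar>v \<gamma> \<omega>\<bar>)" for n :: "int^'n" and \<omega>
  have Tm [measurable]: "T n \<in> borel_measurable (Pi\<^sub>M UNIV (\<lambda>_. borel))" for n
    unfolding T_def by measurable
  have Sm [measurable]: "S n \<in> borel_measurable M" for n unfolding S_def by measurable
  have T_eq: "T n (\<lambda>\<gamma>. y \<gamma> \<omega>) = ennreal (real (card {\<gamma>. y \<gamma> \<omega> \<in> cube n}))"
      if "finite {\<gamma>. y \<gamma> \<omega> \<in> cube n}" for n \<omega>
  proof -
    have "T n (\<lambda>\<gamma>. y \<gamma> \<omega>) = (\<Sum>\<gamma> | y \<gamma> \<omega> \<in> cube n. indicator (cube n) (y \<gamma> \<omega>))"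
      unfolding T_def by (rule suminf_finite[OF that]) auto
    also have "\<dots> = (\<Sum>\<gamma> | y \<gamma> \<omega> \<in> cube n. 1)" by (rule sum.cong) auto
    finally show ?thesis by (simp add: ennreal_of_nat_eq_real_of_nat)
  qed
  have S_eq: "S n \<omega> = ennreal (\<Sum>\<gamma> | y \<gamma> \<omega> \<in> cube n. \<bar>v \<gamma> \<omega>\<bar>)" if "finite {\<gamma>. y \<gamma> \<omega> \<in> cube n}" for n \<omega>
  proof -
    have "S n \<omega> = (\<Sum>\<gamma> | y \<gamma> \<omega> \<in> cube n. indicator (cube n) (y \<gamma> \<omega>) * ennreal \<bar>v \<gamma> \<omega>\<bar>)"
      unfolding S_def by (rule suminf_finite[OF that]) auto
    also have "\<dots> = (\<Sum>\<gamma> | y \<gamma> \<omega> \<in> cube n. ennreal \<bar>v \<gamma> \<omega>\<bar>)" by (rule sum.cong) auto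
    finally show ?thesis by simp
  qed
  define \<mu> where "\<mu> = (\<integral>\<^sup>+\<omega>. ennreal (\<bar>v 0 \<omega>\<bar> ^ p) \<partial>M)"
  have mu_fin: "\<mu> < \<infinity>"
  proof -
    have "integrable M (\<lambda>\<omega>. \<bar>v 0 \<omega>\<bar> ^ p)" using integrable_abs[OF v_moment]
        by (simp add: p_def power_abs abs_mult)
    then show ?thesis unfolding \<mu>_def by (subst nn_integral_eq_integral) auto
  qed
  have mu: "(\<integral>\<^sup>+\<omega>. ennreal (\<bar>v \<gamma> \<omega>\<bar> ^ p) \<partial>M) = \<mu>" for \<gamma>
  proof -
    have "(\<integral>\<^sup>+\<omega>. ennreal (\<bar>v \<gamma> \<omega>\<bar> ^ p) \<partial>M) = (\<integral>\<^sup>+t. ennreal (\<bar>t\<bar> ^ p) \<partial>distr M borel (v \<gamma>))" for \<gamma>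
      by (subst nn_integral_distr) auto
    then show ?thesis unfolding \<mu>_def by (simp add: v_ident[of \<gamma>])
  qed
  \<comment> \<open>The exponent is \<open>Suc p\<close> because the factor \<open>N^p\<close> is
    summed over the \<open>N\<close> points of the cube.\<close>
  define c where "c = \<mu> * ennreal (exp (exp (real (Suc p))))"
  have c_fin: "c < \<infinity>" using mu_fin by (simp add: c_def ennreal_mult_less_top)
  have S_moment: "(\<integral>\<^sup>+\<omega>. S n \<omega> ^ p \<partial>M) \<le> c" for n
  proof -
    have "(\<integral>\<^sup>+\<omega>. S n \<omega> ^ p \<partial>M) \<le> (\<integral>\<^sup>+\<omega>. (\<Sum>\<gamma>. (T n (\<lambda>\<gamma>. y \<gamma> \<omega>) ^ p * indicator (cube n) (y \<gamma> \<omega>)) *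
        ennreal (\<bar>v \<gamma> \<omega>\<bar> ^ p)) \<partial>M)"
    proof (rule nn_integral_mono_AE)
      show "AE \<omega> in M. S n \<omega> ^ p \<le> (\<Sum>\<gamma>. (T n (\<lambda>\<gamma>. y \<gamma> \<omega>) ^ p * indicator (cube n) (y \<gamma> \<omega>)) * ennreal
          (\<bar>v \<gamma> \<omega>\<bar> ^ p))"
        using fin[of n]
      proof eventually_elim
        case (elim \<omega>)
        let ?F = "{\<gamma>. y \<gamma> \<omega> \<in> cube n}"
        have "S n \<omega> ^ p = ennreal ((\<Sum>\<gamma>\<in>?F. \<bar>v \<gamma> \<omega>\<bar>) ^ p)"
          unfolding S_eq[OF elim] by (simp add: ennreal_power sum_nonneg)
        also have "\<dots> \<le> ennreal (real (card ?F) ^ p * (\<Sum>\<gamma>\<in>?F. \<bar>v \<gamma> \<omega>\<bar> ^ p))"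
          unfolding p_def by (intro ennreal_leI power_sum_le elim) auto
        also have "\<dots> = T n (\<lambda>\<gamma>. y \<gamma> \<omega>) ^ p * (\<Sum>\<gamma>\<in>?F. ennreal (\<bar>v \<gamma> \<omega>\<bar> ^ p))"
          unfolding T_eq[OF elim] by (simp add: ennreal_mult' ennreal_power sum_nonneg)
        also have "\<dots> = (\<Sum>\<gamma>\<in>?F. (T n (\<lambda>\<gamma>. y \<gamma> \<omega>) ^ p * indicator (cube n) (y \<gamma> \<omega>)) * ennreal (\<bar>v \<gamma> \<omega>\<bar>
            ^ p))"
          unfolding sum_distrib_left by (rule sum.cong) auto
        also have "\<dots> = (\<Sum>\<gamma>. (T n (\<lambda>\<gamma>. y \<gamma> \<omega>) ^ p * indicator (cube n) (y \<gamma> \<omega>)) * ennreal (\<bar>v \<gamma> \<omega>\<bar> ^ p))"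
          by (rule suminf_finite[symmetric, OF elim]) auto
        finally show ?case .
      qed
    qed
    also have "\<dots> = (\<Sum>\<gamma>. \<integral>\<^sup>+\<omega>. (T n (\<lambda>\<gamma>. y \<gamma> \<omega>) ^ p * indicator (cube n) (y \<gamma> \<omega>)) * ennreal (\<bar>v \<gamma> \<omega>\<bar>
        ^ p) \<partial>M)"
      by (rule nn_integral_suminf) (use measurable_compose[OF y_meas Tm] in measurable)
    \<comment> \<open>For a fixed label the count and the position depend on \<open>y\<close> alone
      and the weight on \<open>v\<close> alone, so the expectation factorizes. The weights being
      identically distributed, the factor \<open>\<mu>\<close> is common to all labels.\<close>
    also have "\<dots> = (\<Sum>\<gamma>. (\<integral>\<^sup>+\<omega>. T n (\<lambda>\<gamma>. y \<gamma> \<omega>) ^ p * indicator (cube n) (y \<gamma> \<omega>) \<partial>M) * \<mu>)"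
    proof (rule suminf_cong)
      fix \<gamma>
      have "(\<integral>\<^sup>+\<omega>. (T n (\<lambda>\<gamma>. y \<gamma> \<omega>) ^ p * indicator (cube n) (y \<gamma> \<omega>)) * ennreal (\<bar>v \<gamma> \<omega>\<bar> ^ p) \<partial>M)
        = (\<integral>\<^sup>+\<omega>. T n (\<lambda>\<gamma>. y \<gamma> \<omega>) ^ p * indicator (cube n) (y \<gamma> \<omega>) \<partial>M) * (\<integral>\<^sup>+\<omega>. ennreal (\<bar>v \<gamma> \<omega>\<bar> ^ p)
            \<partial>M)"
        by (rule nn_integral_indep_mult[OF y_meas v_meas yv_indep, of "\<lambda>\<eta>. T n \<eta> ^ p * indicator
            (cube n) (\<eta> \<gamma>)" "\<lambda>\<eta>. ennreal (\<bar>\<eta> \<gamma>\<bar> ^ p)"]) measurable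
      then show "(\<integral>\<^sup>+\<omega>. (T n (\<lambda>\<gamma>. y \<gamma> \<omega>) ^ p * indicator (cube n) (y \<gamma> \<omega>)) * ennreal (\<bar>v \<gamma> \<omega>\<bar> ^ p) \<partial>M)
        = (\<integral>\<^sup>+\<omega>. T n (\<lambda>\<gamma>. y \<gamma> \<omega>) ^ p * indicator (cube n) (y \<gamma> \<omega>) \<partial>M) * \<mu>" by (simp only: mu)
    qed
    also have "\<dots> = (\<Sum>\<gamma>. \<integral>\<^sup>+\<omega>. T n (\<lambda>\<gamma>. y \<gamma> \<omega>) ^ p * indicator (cube n) (y \<gamma> \<omega>) \<partial>M) * \<mu>"
      by (rule ennreal_suminf_multc)
    also have "(\<Sum>\<gamma>. \<integral>\<^sup>+\<omega>. T n (\<lambda>\<gamma>. y \<gamma> \<omega>) ^ p * indicator (cube n) (y \<gamma> \<omega>) \<partial>M)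
        = (\<integral>\<^sup>+\<omega>. (\<Sum>\<gamma>. T n (\<lambda>\<gamma>. y \<gamma> \<omega>) ^ p * indicator (cube n) (y \<gamma> \<omega>)) \<partial>M)"
      by (rule nn_integral_suminf[symmetric]) (use measurable_compose[OF y_meas Tm] in measurable)
    also have "\<dots> = (\<integral>\<^sup>+\<omega>. ennreal (real (card {\<gamma>. y \<gamma> \<omega> \<in> cube n}) ^ Suc p) \<partial>M)"
    proof (rule nn_integral_cong_AE)
      show "AE \<omega> in M. (\<Sum>\<gamma>. T n (\<lambda>\<gamma>. y \<gamma> \<omega>) ^ p * indicator (cube n) (y \<gamma> \<omega>))
          = ennreal (real (card {\<gamma>. y \<gamma> \<omega> \<in> cube n}) ^ Suc p)"
        using fin[of n]
      proof eventually_elim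
        case (elim \<omega>)
        have "(\<Sum>\<gamma>. T n (\<lambda>\<gamma>. y \<gamma> \<omega>) ^ p * indicator (cube n) (y \<gamma> \<omega>))
            = T n (\<lambda>\<gamma>. y \<gamma> \<omega>) ^ p * T n (\<lambda>\<gamma>. y \<gamma> \<omega>)"
          unfolding ennreal_suminf_cmult T_def ..
        also have "\<dots> = T n (\<lambda>\<gamma>. y \<gamma> \<omega>) ^ Suc p" by (simp add: mult.commute)
        also have "\<dots> = ennreal (real (card {\<gamma>. y \<gamma> \<omega> \<in> cube n}) ^ Suc p)"
          unfolding T_eq[OF elim] by (rule ennreal_power) simp
        finally show ?case .
      qed
    qed
    also have "\<dots> \<le> ennreal (exp (exp (real (Suc p))))" by (rule poisson_moment(2)[OF poi])
    finally have "(\<integral>\<^sup>+\<omega>. S n \<omega> ^ p \<partial>M) \<le> ennreal (exp (exp (real (Suc p)))) * \<mu>"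
        by (simp add: mult_right_mono)
    then show ?thesis by (simp add: c_def mult.commute)
  qed
  have inf: "infinite (UNIV :: (int^'n) set)" by (rule infinite_dual)
  obtain b :: "nat \<Rightarrow> int^'n" where b: "bij b"
    using countableE_infinite[OF _ inf] by (metis bij_betw_inv countableI_type)
  \<comment> \<open>The exponent \<open>p\<close> is the dimension plus one, just enough for an
    integer exponent to make the weights summable over the lattice.\<close>
  define w where "w j = (1 + norm (rv (b j))) powr (- real p)" for j
  have w0: "w j > 0" for j by (simp add: w_def add_pos_nonneg less_imp_neq[symmetric])
  have w_sum: "summable w"
  proof -
    obtain A where A: "\<And>F :: (int^'n) set. finite F \<Longrightarrow> (\<Sum>n\<in>F. (1 + norm (rv n)) powr (- real p)) \<le> A"
      using lattice_sum_bounded[where 'n = 'n, of "real p"] by (auto simp: p_def)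
    show ?thesis
    proof (rule bounded_imp_summable)
      show "sum w {..N} \<le> A" for N
      proof -
        have "sum w {..N} = (\<Sum>n\<in>b ` {..N}. (1 + norm (rv n)) powr (- real p))"
          unfolding w_def using b by (subst sum.reindex) (auto simp: bij_def intro: inj_on_subset)
        also have "\<dots> \<le> A" by (rule A) simp
        finally show ?thesis .
      qed
    qed (use w0 less_imp_le in blast)
  qed
  have "(\<integral>\<^sup>+\<omega>. (\<Sum>j. S (b j) \<omega> ^ p * ennreal (w j)) \<partial>M) = (\<Sum>j. (\<integral>\<^sup>+\<omega>. S (b j) \<omega> ^ p \<partial>M) * ennreal (w j))"
    by (subst nn_integral_suminf) (auto simp: nn_integral_multc)
  also have "\<dots> \<le> (\<Sum>j. c * ennreal (w j))"
    by (intro suminf_le mult_right_mono S_moment) auto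
  also have "\<dots> = c * ennreal (suminf w)"
    unfolding ennreal_suminf_cmult using w0 w_sum by (subst suminf_ennreal2) (auto intro: less_imp_le)
  also have "\<dots> < \<infinity>" using c_fin by (simp add: ennreal_mult_less_top)
  finally have "AE \<omega> in M. (\<Sum>j. S (b j) \<omega> ^ p * ennreal (w j)) \<noteq> \<infinity>"
    by (intro nn_integral_noteq_infinite) auto
  moreover have "AE \<omega> in M. \<forall>n. finite {\<gamma>. y \<gamma> \<omega> \<in> cube n}"
    using fin by (subst AE_all_countable) auto
  ultimately show ?thesis
  proof eventually_elim
    case (elim \<omega>)
    define Q where "Q = (\<Sum>j. S (b j) \<omega> ^ p * ennreal (w j))"
    obtain q where q: "q \<ge> 0" "Q = ennreal q" using elim(1) by (cases Q) (auto simp: Q_def)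
    \<comment> \<open>With \<open>K \<ge> 1\<close> one has \<open>q \<le> K \<le> K^p\<close>,
      which replaces taking a \<open>p\<close>-th root.\<close>
    define K where "K = max 1 q"
    have "(\<Sum>\<gamma> | cidx (y \<gamma> \<omega>) = n. \<bar>v \<gamma> \<omega>\<bar>) \<le> K * (1 + norm (rv n))" for n
    proof -
      obtain j where j: "n = b j" using b by (metis bij_pointE)
      define r where "r = (\<Sum>\<gamma> | y \<gamma> \<omega> \<in> cube n. \<bar>v \<gamma> \<omega>\<bar>)"
      have r0: "r \<ge> 0" by (simp add: r_def sum_nonneg)
      have "S (b j) \<omega> ^ p * ennreal (w j) \<le> Q"
        unfolding Q_def using sum_le_suminf[of "\<lambda>j. S (b j) \<omega> ^ p * ennreal (w j)" "{j}"] by simp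
      then have "ennreal (r ^ p * w j) \<le> ennreal q"
        using S_eq[of \<omega> n] elim(2) r0 w0[of j] unfolding q(2) j r_def
        by (simp add: ennreal_power ennreal_mult'' less_imp_le)
      then have "r ^ p * w j \<le> q" using q by simp
      moreover have "w j = 1 / (1 + norm (rv n)) ^ p"
        unfolding w_def j by (simp add: powr_minus powr_realpow add_pos_nonneg divide_inverse)
      moreover have pos: "1 + norm (rv n) > 0" by (simp add: add_pos_nonneg)
      ultimately have "r ^ p \<le> q * (1 + norm (rv n)) ^ p" by (simp add: field_simps)
      also have "\<dots> \<le> K ^ p * (1 + norm (rv n)) ^ p"
      proof (intro mult_right_mono)
        have "q \<le> K" by (simp add: K_def)
        also have "K \<le> K ^ p" by (rule self_le_power) (auto simp: K_def p_def)
        finally show "q \<le> K ^ p" .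
      qed (use pos in simp)
      finally have "r ^ Suc CARD('n) \<le> (K * (1 + norm (rv n))) ^ Suc CARD('n)"
        by (simp only: p_def power_mult_distrib)
      then have "r \<le> K * (1 + norm (rv n))"
        by (rule power_le_imp_le_base) (use pos in \<open>simp add: K_def\<close>)
      then show ?thesis by (simp add: r_def pts)
    qed
    then show ?case using elim(2) by (auto simp: pts)
  qed
qed

theorem theorem2p1:
  fixes M :: "'w measure"
    and y :: "nat \<Rightarrow> 'w \<Rightarrow> real^'n"
    and v :: "nat \<Rightarrow> 'w \<Rightarrow> real"
    and B :: "real^'n \<Rightarrow> real"
    and C_B eps lam :: real
    and \<phi> :: "real^'n \<Rightarrow> complex"
    and f :: "real \<Rightarrow> complex"
  assumes M: "prob_space M"
    and y_meas: "(\<lambda>\<omega> \<gamma>. y \<gamma> \<omega>) \<in> M \<rightarrow>\<^sub>M Pi\<^sub>M UNIV (\<lambda>_. borel)"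
    and v_meas: "(\<lambda>\<omega> \<gamma>. v \<gamma> \<omega>) \<in> M \<rightarrow>\<^sub>M Pi\<^sub>M UNIV (\<lambda>_. borel)"
    and poisson: "poisson_pp M y"
    and v_indep: "prob_space.indep_vars M (\<lambda>_. borel) v UNIV"
    and v_ident: "\<And>\<gamma>. distr M borel (v \<gamma>) = distr M borel (v 0)"
    and v_moments: "\<And>k. 1 \<le> k \<Longrightarrow> k \<le> CARD('n) + 1 \<Longrightarrow> integrable M (\<lambda>\<omega>. (v 0 \<omega>) ^ k)"
    and yv_indep: "prob_space.indep_set M
        {(\<lambda>\<omega> \<gamma>. y \<gamma> \<omega>) -` X \<inter> space M | X. X \<in> sets (Pi\<^sub>M UNIV (\<lambda>_. borel :: (real^'n) measure))}
        {(\<lambda>\<omega> \<gamma>. v \<gamma> \<omega>) -` X \<inter> space M | X. X \<in> sets (Pi\<^sub>M UNIV (\<lambda>_. borel :: real measure))}"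
    and B_meas: "B \<in> borel_measurable borel"
    and eps_pos: "eps > 0"
    and B_decay: "\<And>x. \<bar>B x\<bar> \<le> C_B * (sqrt (1 + (norm x)\<^sup>2)) powr (- (real CARD('n) + 1 + eps))"
    and lam: "lam \<ge> 0"
    and phi_meas: "\<phi> \<in> borel_measurable lebesgue"
    and phi_L2: "integrable lebesgue (\<lambda>x. (cmod (\<phi> x))\<^sup>2)"
    and f_cont: "continuous_on UNIV f"
    and f_vanish: "(f \<longlongrightarrow> 0) at_infinity"
  shows "AE \<omega> in M. \<exists>l. ((\<lambda>L. fc_quad L (\<lambda>x. lam * pot L y v B \<omega> x) f \<phi>) \<longlongrightarrow> l) at_top"
proof -
  define s where "s = real CARD('n) + 1 + eps"
  \<comment> \<open>The factor compares the two weights: \<open>sqrt (1 + (norm x)\<^sup>2)\<close>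
    is at least \<open>(1 + norm x) / sqrt 2\<close>.\<close>
  define C where "C = C_B * sqrt 2 powr s"
  have s: "s > real CARD('n) + 1" using eps_pos by (simp add: s_def)
  have CB: "C_B \<ge> 0" using order_trans[OF abs_ge_zero B_decay[of 0]] by simp
  have B_le: "\<bar>B x\<bar> \<le> C * (1 + norm x) powr (- s)" for x
  proof -
    have "(1 + norm x)\<^sup>2 \<le> 2 * (1 + (norm x)\<^sup>2)"
      using zero_le_power2[of "1 - norm x"] by (simp add: power2_eq_square algebra_simps)
    then have "1 + norm x \<le> sqrt (2 * (1 + (norm x)\<^sup>2))" by (rule real_le_rsqrt)
    also have "\<dots> = sqrt 2 * sqrt (1 + (norm x)\<^sup>2)" by (rule real_sqrt_mult)
    finally have "(1 + norm x) / sqrt 2 \<le> sqrt (1 + (norm x)\<^sup>2)" by (simp add: field_simps)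
    then have "sqrt (1 + (norm x)\<^sup>2) powr (- s) \<le> ((1 + norm x) / sqrt 2) powr (- s)"
      using s by (intro powr_mono2') (auto simp: add_pos_nonneg)
    also have "\<dots> = sqrt 2 powr s * (1 + norm x) powr (- s)"
      by (simp add: powr_divide powr_minus field_simps)
    finally have "C_B * sqrt (1 + (norm x)\<^sup>2) powr (- s)
        \<le> C_B * (sqrt 2 powr s * (1 + norm x) powr (- s))"
      by (intro mult_left_mono CB)
    then show ?thesis using B_decay[of x] unfolding s_def[symmetric] C_def mult.assoc by linarith
  qed
  have phi: "\<phi> \<in> l2 lebesgue" using phi_meas phi_L2 by (simp add: l2_def)
  have "integrable M (\<lambda>\<omega>. (v 0 \<omega>) ^ Suc CARD('n))" using v_moments[of "Suc CARD('n)"] by simp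
  \<comment> \<open>This is the only almost sure statement; it involves neither \<open>f\<close> nor
    \<open>\<phi>\<close>, and everything after it concerns one fixed realization.\<close>
  from AE_linear_mass[OF M y_meas v_meas poisson v_ident this yv_indep]
  show ?thesis
  proof eventually_elim
    case (elim \<omega>)
    then obtain K where K: "\<And>n. (\<Sum>\<gamma> | cidx (y \<gamma> \<omega>) = n. \<bar>v \<gamma> \<omega>\<bar>) \<le> K * (1 + norm (rv n))" by blast
    interpret marked_points "\<lambda>\<gamma>. y \<gamma> \<omega>" "\<lambda>\<gamma>. v \<gamma> \<omega>" K s C B lam "real CARD('n)"
      by unfold_locales (use elim K s B_meas B_le lam in auto)
    obtain Kc \<delta> where "finite_volume (\<lambda>L x. lam * W L x) 1 Kc \<delta>" using finite_volume_W by blast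
    then interpret fv: finite_volume "\<lambda>L x. lam * W L x" 1 Kc \<delta> .
    obtain l where l: "((\<lambda>L. fc_quad L (\<lambda>x. lam * W L x) f \<phi>) \<longlongrightarrow> l) at_top"
      using fv.converging_limit[OF fv.converging_C0[OF f_cont f_vanish] phi] by blast
    \<comment> \<open>The two potentials agree only for positive \<open>L\<close>, where the
      representative selected by \<open>per_ext\<close> exists and equals
      \<open>wrap\<close>.\<close>
    have "\<forall>\<^sub>F L in at_top. fc_quad L (\<lambda>x. lam * W L x) f \<phi> = fc_quad L (\<lambda>x. lam * pot L y v B \<omega> x) f \<phi>"
      using eventually_gt_at_top[of 0]
    proof eventually_elim
      case (elim L)
      have "pot L y v B \<omega> x = W L x" for x
        unfolding pot_def W_def P_def using elim by (simp add: per_ext_wrap)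
      then show ?case by simp
    qed
    with l have "((\<lambda>L. fc_quad L (\<lambda>x. lam * pot L y v B \<omega> x) f \<phi>) \<longlongrightarrow> l) at_top"
      by (rule Lim_transform_eventually)
    then show ?case by blast
  qed
qed

end
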